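(* Let $\mathfrak{M}=(\mathcal{Q},\mathcal{W},\mathcal{R})$ be an hereditary abelian model structure on an abelian category $\mathcal{A}$. For all objects $A,B\in\mathcal{A}$ and all $n\in\mathbb{Z}$ there are natural isomorphisms $$\mathrm{Ho}(\mathfrak{M})(\Omega^nA,B)\cong\mathrm{Ext}^n_{\mathrm{Ho}(\mathfrak{M})}(A,B)\cong\mathrm{Ho}(\mathfrak{M})(A,\Sigma^nB).$$
   Context: $\mathrm{Ext}^n_{\mathcal{A}}$ denotes Yoneda Ext in $\mathcal{A}$. A cotorsion pair is a pair of classes $(\mathcal{X},\mathcal{Y})$ with $\mathcal{Y}=\{Y:\mathrm{Ext}^1_{\mathcal{A}}(X,Y)=0\ \forall X\in\mathcal{X}\}$ and $\mathcal{X}=\{X:\mathrm{Ext}^1_{\mathcal{A}}(X,Y)=0\ \forall Y\in\mathcal{Y}\}$. It is complete if every object $A$ admits short exact sequences $0\to Y\to X\to A\to0$ and $0\to A\to Y'\to X'\to 0$ with $X,X'\in\mathcal{X}$, $Y,Y'\in\mathcal{Y}$; hereditary if $\mathrm{Ext}^i_{\mathcal{A}}(X,Y)=0$ for all $X\in\mathcal{X}$, $Y\in\mathcal{Y}$, $i\ge1$. An hereditary abelian model structure is a triple $\mathfrak{M}=(\mathcal{Q},\mathcal{W},\mathcal{R})$ of classes of objects such that $\mathcal{W}$ is thick (2 out of 3 property on short exact sequences) and, with $\mathcal{Q}_{\mathcal{W}}=\mathcal{Q}\cap\mathcal{W}$ and $\mathcal{R}_{\mathcal{W}}=\mathcal{W}\cap\mathcal{R}$,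 both $(\mathcal{Q},\mathcal{R}_{\mathcal{W}})$ and $(\mathcal{Q}_{\mathcal{W}},\mathcal{R})$ are complete hereditary cotorsion pairs. Objects of $\mathcal{Q}$ are cofibrant, objects of $\mathcal{R}$ fibrant. The core is $\omega=\mathcal{Q}\cap\mathcal{W}\cap\mathcal{R}$; $f\sim^\omega g$ means $g-f$ factors through an object of $\omega$, and $\underline{\mathrm{Hom}}_\omega(A,B)=\mathrm{Hom}_{\mathcal{A}}(A,B)/\sim^\omega$. A cofibrant replacement $QA$ is given by a short exact sequence $0\to F\to QA\to A\to0$ with $QA\in\mathcal{Q}$, $F\in\mathcal{R}_{\mathcal{W}}$; a fibrant replacement $RA$ by $0\to A\to RA\to C\to0$ with $RA\in\mathcal{R}$, $C\in\mathcal{Q}_{\mathcal{W}}$. $\mathrm{Ho}(\mathfrak{M})$ has the objects of $\mathcal{A}$ and $\mathrm{Ho}(\mathfrak{M})(A,B)=\underline{\mathrm{Hom}}_\omega(RQA,RQB)$ (different choices of bifibrant replacements are canonically isomorphic). Suspension and loop: $\Sigma X$ is any object in a short exact sequence $0\to X\to W\to\Sigma X\to0$ with $W\in\mathcal{W}$, and $\Omega X$ any object in $0\to\Omega X\to W\to X\to0$ with $W\in\mathcal{W}$; these give well-defined (up to canonical isomorphism) additive endofunctors of $\mathrm{Ho}(\mathfrak{M})$. For $\Sigma$ on morphisms: such sequences for $X,X'$ have bifibrant replacement sequences $0\to RQX\to RQW\to RQ\Sigma X\to0$ with $RQW\in\omega$ (similarly for $X'$), a representative $f:RQX\to RQX'$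 extends to a morphism of short exact sequences with right-hand map $c$, and $\Sigma([f])=[c]$; $\Omega$ is defined dually. For $n>0$, $\Omega^{-n}:=\Sigma^n$ and $\Sigma^{-n}:=\Omega^n$. An $\mathfrak{M}$-resolution of $A$ is an exact chain complex $W_A\equiv\cdots\to Q_1\xrightarrow{d_1}Q_0\xrightarrow{d_0}R_{-1}\xrightarrow{d_{-1}}R_{-2}\to\cdots$ with $d_0=\eta\epsilon$, where $\cdots\to Q_1\to Q_0\xrightarrow{\epsilon}A\to0$ is exact with each $Q_i\in\mathcal{Q}_{\mathcal{W}}$ and all kernels $\ker\epsilon$, $\ker d_i$ ($i\ge1$) in $\mathcal{R}$, and $0\to A\xrightarrow{\eta}R_{-1}\to R_{-2}\to\cdots$ is exact with each $R_i\in\mathcal{R}_{\mathcal{W}}$ and all cokernels $\mathrm{cok}\,\eta$, $\mathrm{cok}\,d_i$ ($i\le-1$) in $\mathcal{Q}$. An $\mathfrak{M}$-coresolution $W^B$ of $B$ is the same kind of complex written as a cochain complex $\cdots\to Q^{-2}\to Q^{-1}\to R^0\to R^1\to\cdots$, with $d^{-1}$ factoring as $Q^{-1}\twoheadrightarrow B\hookrightarrow R^0$. For $A$ cofibrant and $B$ fibrant, $\mathrm{Ext}^n_{\mathfrak{M}}(A,B)$ denotes the group $H^n[\mathrm{Hom}_{\mathcal{A}}(W_A,B)]$, canonically isomorphic to $H^n[\mathrm{Hom}_{\mathcal{A}}(A,W^B)]$ and independent of choices. For arbitrary $A,B$, $\mathrm{Ext}^n_{\mathrm{Ho}(\mathfrak{M})}(A,B):=\mathrm{Ext}^n_{\mathfrak{M}}(RQA,RQB)$.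 *)

theory Defs
  imports "HOL-Algebra.Coset"
begin

section \<open>Abelian categories\<close>

record ('o, 'm) additive_cat =
  Ob :: "'o set"
  Ar :: "'m set"
  Dom :: "'m \<Rightarrow> 'o"
  Cod :: "'m \<Rightarrow> 'o"
  Idt :: "'o \<Rightarrow> 'm"
  cmp :: "'m \<Rightarrow> 'm \<Rightarrow> 'm"  (infixr "\<cdot>\<index>" 70)
  plus_ar :: "'m \<Rightarrow> 'm \<Rightarrow> 'm"
  zero_ar :: "'o \<Rightarrow> 'o \<Rightarrow> 'm"

definition Hom :: "('o, 'm) additive_cat \<Rightarrow> 'o \<Rightarrow> 'o \<Rightarrow> 'm set" where
  "Hom C A B = {f \<in> Ar C. Dom C f = A \<and> Cod C f = B}"

text \<open>The additive group of morphisms, in the multiplicative notation of HOL-Algebra.\<close>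
definition Hom_group :: "('o, 'm) additive_cat \<Rightarrow> 'o \<Rightarrow> 'o \<Rightarrow> 'm monoid" where
  "Hom_group C A B = \<lparr>carrier = Hom C A B, mult = plus_ar C, one = zero_ar C A B\<rparr>"

locale preadditive_category =
  fixes C :: "('o, 'm) additive_cat" (structure)
  assumes Dom_in_Ob: "f \<in> Ar C \<Longrightarrow> Dom C f \<in> Ob C"
    and Cod_in_Ob: "f \<in> Ar C \<Longrightarrow> Cod C f \<in> Ob C"
    and Idt_in_Hom: "A \<in> Ob C \<Longrightarrow> Idt C A \<in> Hom C A A"
    and cmp_in_Hom: "\<lbrakk>f \<in> Hom C X Y; g \<in> Hom C Y Z\<rbrakk> \<Longrightarrow> g \<cdot> f \<in> Hom C X Z"
    and cmp_Idt: "f \<in> Hom C X Y \<Longrightarrow> f \<cdot> Idt C X = f"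
    and Idt_cmp: "f \<in> Hom C X Y \<Longrightarrow> Idt C Y \<cdot> f = f"
    and cmp_assoc: "\<lbrakk>f \<in> Hom C X Y; g \<in> Hom C Y Z; h \<in> Hom C Z U\<rbrakk> \<Longrightarrow> (h \<cdot> g) \<cdot> f = h \<cdot> (g \<cdot> f)"
    and comm_group_Hom: "\<lbrakk>A \<in> Ob C; B \<in> Ob C\<rbrakk> \<Longrightarrow> comm_group (Hom_group C A B)"
    and cmp_plus_right: "\<lbrakk>f \<in> Hom C X Y; f' \<in> Hom C X Y; g \<in> Hom C Y Z\<rbrakk>
          \<Longrightarrow> g \<cdot> plus_ar C f f' = plus_ar C (g \<cdot> f) (g \<cdot> f')"
    and cmp_plus_left: "\<lbrakk>f \<in> Hom C X Y; g \<in> Hom C Y Z; g' \<in> Hom C Y Z\<rbrakk>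
          \<Longrightarrow> plus_ar C g g' \<cdot> f = plus_ar C (g \<cdot> f) (g' \<cdot> f)"

definition is_mono :: "('o, 'm) additive_cat \<Rightarrow> 'm \<Rightarrow> bool" where
  "is_mono C f \<longleftrightarrow> f \<in> Ar C \<and>
     (\<forall>A. \<forall>g\<in>Hom C A (Dom C f). \<forall>h\<in>Hom C A (Dom C f). f \<cdot>\<^bsub>C\<^esub> g = f \<cdot>\<^bsub>C\<^esub> h \<longrightarrow> g = h)"

definition is_epi :: "('o, 'm) additive_cat \<Rightarrow> 'm \<Rightarrow> bool" where
  "is_epi C f \<longleftrightarrow> f \<in> Ar C \<and>
     (\<forall>A. \<forall>g\<in>Hom C (Cod C f) A. \<forall>h\<in>Hom C (Cod C f) A. g \<cdot>\<^bsub>C\<^esub> f = h \<cdot>\<^bsub>C\<^esub> f \<longrightarrow> g = h)"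

definition is_kernel :: "('o, 'm) additive_cat \<Rightarrow> 'm \<Rightarrow> 'm \<Rightarrow> bool" where
  "is_kernel C k f \<longleftrightarrow> k \<in> Ar C \<and> f \<in> Ar C \<and> Cod C k = Dom C f \<and>
     f \<cdot>\<^bsub>C\<^esub> k = zero_ar C (Dom C k) (Cod C f) \<and>
     (\<forall>A. \<forall>h\<in>Hom C A (Dom C f). f \<cdot>\<^bsub>C\<^esub> h = zero_ar C A (Cod C f) \<longrightarrow>
        (\<exists>!u. u \<in> Hom C A (Dom C k) \<and> k \<cdot>\<^bsub>C\<^esub> u = h))"

definition is_cokernel :: "('o, 'm) additive_cat \<Rightarrow> 'm \<Rightarrow> 'm \<Rightarrow> bool" where
  "is_cokernel C c f \<longleftrightarrow> c \<in> Ar C \<and> f \<in> Ar C \<and> Dom C c = Cod C f \<and>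
     c \<cdot>\<^bsub>C\<^esub> f = zero_ar C (Dom C f) (Cod C c) \<and>
     (\<forall>A. \<forall>h\<in>Hom C (Cod C f) A. h \<cdot>\<^bsub>C\<^esub> f = zero_ar C (Dom C f) A \<longrightarrow>
        (\<exists>!u. u \<in> Hom C (Cod C c) A \<and> u \<cdot>\<^bsub>C\<^esub> c = h))"

locale abelian_category = preadditive_category +
  assumes zero_object: "\<exists>Z\<in>Ob C. \<forall>A\<in>Ob C. (\<exists>!f. f \<in> Hom C A Z) \<and> (\<exists>!f. f \<in> Hom C Z A)"
    and biproduct: "\<lbrakk>A \<in> Ob C; B \<in> Ob C\<rbrakk> \<Longrightarrow>
      \<exists>P\<in>Ob C. \<exists>i\<in>Hom C A P. \<exists>j\<in>Hom C B P. \<exists>p\<in>Hom C P A. \<exists>q\<in>Hom C P B.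
        p \<cdot> i = Idt C A \<and> q \<cdot> j = Idt C B \<and> p \<cdot> j = zero_ar C B A \<and> q \<cdot> i = zero_ar C A B \<and>
        plus_ar C (i \<cdot> p) (j \<cdot> q) = Idt C P"
    and has_kernel: "f \<in> Ar C \<Longrightarrow> \<exists>k. is_kernel C k f"
    and has_cokernel: "f \<in> Ar C \<Longrightarrow> \<exists>c. is_cokernel C c f"
    and mono_is_kernel: "is_mono C f \<Longrightarrow> \<exists>g. is_kernel C f g"
    and epi_is_cokernel: "is_epi C f \<Longrightarrow> \<exists>g. is_cokernel C f g"

text \<open>Exactness of \<open>f\<close> followed by \<open>g\<close>: the image of \<open>f\<close>, i.e. the kernel of its cokernel,
  is the kernel of \<open>g\<close>.\<close>
definition exact_at :: "('o, 'm) additive_cat \<Rightarrow> 'm \<Rightarrow> 'm \<Rightarrow> bool" where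
  "exact_at C f g \<longleftrightarrow> Cod C f = Dom C g \<and>
     (\<exists>c k. is_cokernel C c f \<and> is_kernel C k c \<and> is_kernel C k g)"

definition short_exact :: "('o, 'm) additive_cat \<Rightarrow> 'm \<Rightarrow> 'm \<Rightarrow> bool" where
  "short_exact C i p \<longleftrightarrow> is_kernel C i p \<and> is_cokernel C p i"

section \<open>Yoneda Ext and cotorsion pairs\<close>

text \<open>For \<open>n \<ge> 1\<close>, an \<open>n\<close>-extension \<open>0 \<rightarrow> Y \<rightarrow> E\<^sub>n \<rightarrow> \<dots> \<rightarrow> E\<^sub>1 \<rightarrow> X \<rightarrow> 0\<close> is
  the list of its \<open>n + 1\<close> morphisms, from left to right.\<close>
definition extensions :: "('o, 'm) additive_cat \<Rightarrow> nat \<Rightarrow> 'o \<Rightarrow> 'o \<Rightarrow> 'm list set" where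
  "extensions C n X Y = {ds. length ds = n + 1 \<and> Dom C (ds ! 0) = Y \<and> Cod C (ds ! n) = X \<and>
     is_mono C (ds ! 0) \<and> is_epi C (ds ! n) \<and> (\<forall>i<n. exact_at C (ds ! i) (ds ! Suc i))}"

text \<open>Pairs of extensions admitting a morphism \<open>h\<close> that is the identity on both ends.\<close>
definition extension_morphisms ::
    "('o, 'm) additive_cat \<Rightarrow> nat \<Rightarrow> 'o \<Rightarrow> 'o \<Rightarrow> ('m list \<times> 'm list) set" where
  "extension_morphisms C n X Y = {(ds, es). ds \<in> extensions C n X Y \<and> es \<in> extensions C n X Y \<and>
     (\<exists>h :: nat \<Rightarrow> 'm. h 0 = Idt C Y \<and> h (Suc n) = Idt C X \<and>
        (\<forall>i\<le>n. h i \<in> Hom C (Dom C (ds ! i)) (Dom C (es ! i)) \<and>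
               h (Suc i) \<in> Hom C (Cod C (ds ! i)) (Cod C (es ! i)) \<and>
               es ! i \<cdot>\<^bsub>C\<^esub> h i = h (Suc i) \<cdot>\<^bsub>C\<^esub> ds ! i))}"

text \<open>The underlying set of the Yoneda Ext group, for \<open>n \<ge> 1\<close>.\<close>
definition Yoneda_Ext :: "('o, 'm) additive_cat \<Rightarrow> nat \<Rightarrow> 'o \<Rightarrow> 'o \<Rightarrow> 'm list set set" where
  "Yoneda_Ext C n X Y =
     extensions C n X Y // (extension_morphisms C n X Y \<union> (extension_morphisms C n X Y)\<inverse>)\<^sup>*"

text \<open>Only the vanishing of Ext matters below, so the Baer sum is not needed: a group is zero iff
  it has exactly one element.\<close>
definition Ext_vanishes :: "('o, 'm) additive_cat \<Rightarrow> nat \<Rightarrow> 'o \<Rightarrow> 'o \<Rightarrow> bool" where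
  "Ext_vanishes C n X Y \<longleftrightarrow> is_singleton (Yoneda_Ext C n X Y)"

definition cotorsion_pair :: "('o, 'm) additive_cat \<Rightarrow> 'o set \<Rightarrow> 'o set \<Rightarrow> bool" where
  "cotorsion_pair C \<X> \<Y> \<longleftrightarrow> \<X> \<subseteq> Ob C \<and> \<Y> \<subseteq> Ob C \<and>
     \<Y> = {Y \<in> Ob C. \<forall>X\<in>\<X>. Ext_vanishes C 1 X Y} \<and>
     \<X> = {X \<in> Ob C. \<forall>Y\<in>\<Y>. Ext_vanishes C 1 X Y}"

definition complete_pair :: "('o, 'm) additive_cat \<Rightarrow> 'o set \<Rightarrow> 'o set \<Rightarrow> bool" where
  "complete_pair C \<X> \<Y> \<longleftrightarrow> (\<forall>A\<in>Ob C.
     (\<exists>i p. short_exact C i p \<and> Dom C i \<in> \<Y> \<and> Cod C i \<in> \<X> \<and> Cod C p = A) \<and>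
     (\<exists>i p. short_exact C i p \<and> Dom C i = A \<and> Cod C i \<in> \<Y> \<and> Cod C p \<in> \<X>))"

definition hereditary_pair :: "('o, 'm) additive_cat \<Rightarrow> 'o set \<Rightarrow> 'o set \<Rightarrow> bool" where
  "hereditary_pair C \<X> \<Y> \<longleftrightarrow> (\<forall>X\<in>\<X>. \<forall>Y\<in>\<Y>. \<forall>n\<ge>1. Ext_vanishes C n X Y)"

definition thick :: "('o, 'm) additive_cat \<Rightarrow> 'o set \<Rightarrow> bool" where
  "thick C \<W> \<longleftrightarrow> \<W> \<subseteq> Ob C \<and>
     (\<forall>i p. short_exact C i p \<longrightarrow>
        (Dom C i \<in> \<W> \<and> Cod C i \<in> \<W> \<longrightarrow> Cod C p \<in> \<W>) \<and>
        (Dom C i \<in> \<W> \<and> Cod C p \<in> \<W> \<longrightarrow> Cod C i \<in> \<W>) \<and>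
        (Cod C i \<in> \<W> \<and> Cod C p \<in> \<W> \<longrightarrow> Dom C i \<in> \<W>))"

section \<open>Hereditary abelian model structures\<close>

record 'o model_triple =
  cofibrant :: "'o set"
  trivial :: "'o set"
  fibrant :: "'o set"

definition trivially_cofibrant :: "'o model_triple \<Rightarrow> 'o set" where
  "trivially_cofibrant M = cofibrant M \<inter> trivial M"

definition trivially_fibrant :: "'o model_triple \<Rightarrow> 'o set" where
  "trivially_fibrant M = trivial M \<inter> fibrant M"

definition core :: "'o model_triple \<Rightarrow> 'o set" where
  "core M = cofibrant M \<inter> trivial M \<inter> fibrant M"

definition hereditary_abelian_model :: "('o, 'm) additive_cat \<Rightarrow> 'o model_triple \<Rightarrow> bool" where
  "hereditary_abelian_model C M \<longleftrightarrow> thick C (trivial M) \<and>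
     cotorsion_pair C (cofibrant M) (trivially_fibrant M) \<and>
     complete_pair C (cofibrant M) (trivially_fibrant M) \<and>
     hereditary_pair C (cofibrant M) (trivially_fibrant M) \<and>
     cotorsion_pair C (trivially_cofibrant M) (fibrant M) \<and>
     complete_pair C (trivially_cofibrant M) (fibrant M) \<and>
     hereditary_pair C (trivially_cofibrant M) (fibrant M)"

definition factors_through_core ::
    "('o, 'm) additive_cat \<Rightarrow> 'o model_triple \<Rightarrow> 'o \<Rightarrow> 'o \<Rightarrow> 'm set" where
  "factors_through_core C M A B =
     {h \<cdot>\<^bsub>C\<^esub> g | g h Z. Z \<in> core M \<and> g \<in> Hom C A Z \<and> h \<in> Hom C Z B}"

text \<open>The coset of \<open>f\<close> consists of the \<open>g\<close> such that \<open>g - f\<close> factors through an object of the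
  core.\<close>
definition stable_Hom :: "('o, 'm) additive_cat \<Rightarrow> 'o model_triple \<Rightarrow> 'o \<Rightarrow> 'o \<Rightarrow> 'm set monoid" where
  "stable_Hom C M A B = Hom_group C A B Mod factors_through_core C M A B"

definition stable_class ::
    "('o, 'm) additive_cat \<Rightarrow> 'o model_triple \<Rightarrow> 'o \<Rightarrow> 'o \<Rightarrow> 'm \<Rightarrow> 'm set" where
  "stable_class C M A B f = factors_through_core C M A B #>\<^bsub>Hom_group C A B\<^esub> f"

definition cofibrant_replacement ::
    "('o, 'm) additive_cat \<Rightarrow> 'o model_triple \<Rightarrow> 'o \<Rightarrow> 'm \<Rightarrow> bool" where
  "cofibrant_replacement C M A q \<longleftrightarrow> Cod C q = A \<and> Dom C q \<in> cofibrant M \<and>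
     (\<exists>k. short_exact C k q \<and> Dom C k \<in> trivially_fibrant M)"

definition fibrant_replacement ::
    "('o, 'm) additive_cat \<Rightarrow> 'o model_triple \<Rightarrow> 'o \<Rightarrow> 'm \<Rightarrow> bool" where
  "fibrant_replacement C M A r \<longleftrightarrow> Dom C r = A \<and> Cod C r \<in> fibrant M \<and>
     (\<exists>c. short_exact C r c \<and> Cod C c \<in> trivially_cofibrant M)"

text \<open>A resolution \<open>\<cdots> \<rightarrow> Q\<^sub>1 \<rightarrow> Q\<^sub>0 \<rightarrow> R\<^sub>-\<^sub>1 \<rightarrow> R\<^sub>-\<^sub>2 \<rightarrow> \<cdots>\<close> of \<open>A\<close>: \<open>diff i\<close> is the differential
  from degree \<open>i\<close> to degree \<open>i - 1\<close>, so the object in degree \<open>i\<close> is the domain of \<open>diff i\<close>.\<close>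
record 'm resolution =
  diff :: "int \<Rightarrow> 'm"
  aug :: 'm
  coaug :: 'm

definition cx_ob :: "('o, 'm) additive_cat \<Rightarrow> 'm resolution \<Rightarrow> int \<Rightarrow> 'o" where
  "cx_ob C W i = Dom C (diff W i)"

definition model_resolution ::
    "('o, 'm) additive_cat \<Rightarrow> 'o model_triple \<Rightarrow> 'o \<Rightarrow> 'm resolution \<Rightarrow> bool" where
  "model_resolution C M A W \<longleftrightarrow>
     (\<forall>i. exact_at C (diff W (i + 1)) (diff W i)) \<and>
     diff W 0 = coaug W \<cdot>\<^bsub>C\<^esub> aug W \<and>
     aug W \<in> Hom C (cx_ob C W 0) A \<and> is_epi C (aug W) \<and> exact_at C (diff W 1) (aug W) \<and>
     (\<forall>i\<ge>0. cx_ob C W i \<in> trivially_cofibrant M) \<and>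
     (\<forall>k. is_kernel C k (aug W) \<longrightarrow> Dom C k \<in> fibrant M) \<and>
     (\<forall>i\<ge>1. \<forall>k. is_kernel C k (diff W i) \<longrightarrow> Dom C k \<in> fibrant M) \<and>
     coaug W \<in> Hom C A (cx_ob C W (-1)) \<and> is_mono C (coaug W) \<and>
     exact_at C (coaug W) (diff W (-1)) \<and>
     (\<forall>i\<le>-1. cx_ob C W i \<in> trivially_fibrant M) \<and>
     (\<forall>c. is_cokernel C c (coaug W) \<longrightarrow> Cod C c \<in> cofibrant M) \<and>
     (\<forall>i\<le>-1. \<forall>c. is_cokernel C c (diff W i) \<longrightarrow> Cod C c \<in> cofibrant M)"

section \<open>The homotopy category\<close>

text \<open>Choices on which the homotopy category and its functors depend: replacements
  \<open>QA \<rightarrow> A\<close> and \<open>A \<rightarrow> RA\<close>, short exact sequences \<open>X \<rightarrow> W \<rightarrow> \<Sigma>X\<close> and \<open>\<Omega>X \<rightarrow> W \<rightarrow> X\<close> with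
  \<open>W\<close> trivial, and resolutions.\<close>
record ('o, 'm) model_choice =
  cof_map :: "'o \<Rightarrow> 'm"
  fib_map :: "'o \<Rightarrow> 'm"
  susp_seq :: "'o \<Rightarrow> 'm \<times> 'm"
  loop_seq :: "'o \<Rightarrow> 'm \<times> 'm"
  reso :: "'o \<Rightarrow> 'm resolution"

definition valid_choice ::
    "('o, 'm) additive_cat \<Rightarrow> 'o model_triple \<Rightarrow> ('o, 'm) model_choice \<Rightarrow> bool" where
  "valid_choice C M K \<longleftrightarrow>
     (\<forall>A\<in>Ob C. cofibrant_replacement C M A (cof_map K A)) \<and>
     (\<forall>A\<in>Ob C. fibrant_replacement C M A (fib_map K A)) \<and>
     (\<forall>X\<in>Ob C. \<exists>i p. susp_seq K X = (i, p) \<and> short_exact C i p \<and>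
        Dom C i = X \<and> Cod C i \<in> trivial M) \<and>
     (\<forall>X\<in>Ob C. \<exists>i p. loop_seq K X = (i, p) \<and> short_exact C i p \<and>
        Cod C p = X \<and> Cod C i \<in> trivial M) \<and>
     (\<forall>A\<in>cofibrant M. model_resolution C M A (reso K A))"

definition Q_ob :: "('o, 'm) additive_cat \<Rightarrow> ('o, 'm) model_choice \<Rightarrow> 'o \<Rightarrow> 'o" where
  "Q_ob C K A = Dom C (cof_map K A)"

definition RQ_ob :: "('o, 'm) additive_cat \<Rightarrow> ('o, 'm) model_choice \<Rightarrow> 'o \<Rightarrow> 'o" where
  "RQ_ob C K A = Cod C (fib_map K (Q_ob C K A))"

definition Ho :: "('o, 'm) additive_cat \<Rightarrow> 'o model_triple \<Rightarrow> ('o, 'm) model_choice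
    \<Rightarrow> 'o \<Rightarrow> 'o \<Rightarrow> 'm set monoid" where
  "Ho C M K A B = stable_Hom C M (RQ_ob C K A) (RQ_ob C K B)"

text \<open>Operations on classes are defined on representatives; as usual in HOL this is written as a
  union over all representatives, all of which give the same class.\<close>
definition Ho_cmp :: "('o, 'm) additive_cat \<Rightarrow> 'o model_triple \<Rightarrow> ('o, 'm) model_choice
    \<Rightarrow> 'o \<Rightarrow> 'o \<Rightarrow> 'm set \<Rightarrow> 'm set \<Rightarrow> 'm set" where
  "Ho_cmp C M K A B \<beta> \<alpha> =
     (\<Union>f\<in>\<alpha>. \<Union>g\<in>\<beta>. stable_class C M (RQ_ob C K A) (RQ_ob C K B) (g \<cdot>\<^bsub>C\<^esub> f))"

text \<open>\<open>(j, s)\<close> is a bifibrant replacement \<open>RQX \<rightarrow> RQW \<rightarrow> RQZ\<close> of the short exact sequence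
  \<open>(i, p)\<close> \<open>X \<rightarrow> W \<rightarrow> Z\<close>, relative to the chosen replacements of \<open>X\<close> and \<open>Z\<close>; the replacements
  \<open>q\<close>, \<open>r\<close> of the middle term need not be the chosen ones.\<close>
definition bifibrant_sequence :: "('o, 'm) additive_cat \<Rightarrow> 'o model_triple \<Rightarrow> ('o, 'm) model_choice
    \<Rightarrow> 'm \<times> 'm \<Rightarrow> 'm \<times> 'm \<Rightarrow> bool" where
  "bifibrant_sequence C M K = (\<lambda>(i, p) (j, s). let X = Dom C i; Z = Cod C p in
     short_exact C j s \<and> Cod C j \<in> core M \<and>
     Dom C j = RQ_ob C K X \<and> Cod C s = RQ_ob C K Z \<and>
     (\<exists>q r i' p'. cofibrant_replacement C M (Cod C i) q \<and>
        short_exact C i' p' \<and> Dom C i' = Q_ob C K X \<and> Cod C i' = Dom C q \<and> Cod C p' = Q_ob C K Z \<and>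
        q \<cdot>\<^bsub>C\<^esub> i' = i \<cdot>\<^bsub>C\<^esub> cof_map K X \<and> cof_map K Z \<cdot>\<^bsub>C\<^esub> p' = p \<cdot>\<^bsub>C\<^esub> q \<and>
        fibrant_replacement C M (Dom C q) r \<and> Cod C r = Cod C j \<and>
        r \<cdot>\<^bsub>C\<^esub> i' = j \<cdot>\<^bsub>C\<^esub> fib_map K (Q_ob C K X) \<and>
        s \<cdot>\<^bsub>C\<^esub> r = fib_map K (Q_ob C K Z) \<cdot>\<^bsub>C\<^esub> p'))"

definition ses_morphism ::
    "('o, 'm) additive_cat \<Rightarrow> 'm \<times> 'm \<Rightarrow> 'm \<times> 'm \<Rightarrow> 'm \<Rightarrow> 'm \<Rightarrow> 'm \<Rightarrow> bool" where
  "ses_morphism C = (\<lambda>(j, s) (j', s') a w c.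
     a \<in> Hom C (Dom C j) (Dom C j') \<and> w \<in> Hom C (Cod C j) (Cod C j') \<and>
     c \<in> Hom C (Cod C s) (Cod C s') \<and>
     w \<cdot>\<^bsub>C\<^esub> j = j' \<cdot>\<^bsub>C\<^esub> a \<and> c \<cdot>\<^bsub>C\<^esub> s = s' \<cdot>\<^bsub>C\<^esub> w)"

definition susp_ob :: "('o, 'm) additive_cat \<Rightarrow> ('o, 'm) model_choice \<Rightarrow> 'o \<Rightarrow> 'o" where
  "susp_ob C K X = Cod C (snd (susp_seq K X))"

definition loop_ob :: "('o, 'm) additive_cat \<Rightarrow> ('o, 'm) model_choice \<Rightarrow> 'o \<Rightarrow> 'o" where
  "loop_ob C K X = Dom C (fst (loop_seq K X))"

definition susp_map :: "('o, 'm) additive_cat \<Rightarrow> 'o model_triple \<Rightarrow> ('o, 'm) model_choice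
    \<Rightarrow> 'o \<Rightarrow> 'o \<Rightarrow> 'm set \<Rightarrow> 'm set" where
  "susp_map C M K X X' \<alpha> =
     \<Union>{stable_class C M (RQ_ob C K (susp_ob C K X)) (RQ_ob C K (susp_ob C K X')) c | S S' f w c.
        bifibrant_sequence C M K (susp_seq K X) S \<and> bifibrant_sequence C M K (susp_seq K X') S' \<and>
        f \<in> \<alpha> \<and> ses_morphism C S S' f w c}"

definition loop_map :: "('o, 'm) additive_cat \<Rightarrow> 'o model_triple \<Rightarrow> ('o, 'm) model_choice
    \<Rightarrow> 'o \<Rightarrow> 'o \<Rightarrow> 'm set \<Rightarrow> 'm set" where
  "loop_map C M K X X' \<alpha> =
     \<Union>{stable_class C M (RQ_ob C K (loop_ob C K X)) (RQ_ob C K (loop_ob C K X')) a | S S' f w a.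
        bifibrant_sequence C M K (loop_seq K X) S \<and> bifibrant_sequence C M K (loop_seq K X') S' \<and>
        f \<in> \<alpha> \<and> ses_morphism C S S' a w f}"

primrec susp_pow :: "('o, 'm) additive_cat \<Rightarrow> 'o model_triple \<Rightarrow> ('o, 'm) model_choice
    \<Rightarrow> nat \<Rightarrow> 'o \<Rightarrow> 'o \<Rightarrow> 'm set \<Rightarrow> 'm set" where
  "susp_pow C M K 0 X X' \<alpha> = \<alpha>"
| "susp_pow C M K (Suc n) X X' \<alpha> =
     susp_map C M K ((susp_ob C K ^^ n) X) ((susp_ob C K ^^ n) X') (susp_pow C M K n X X' \<alpha>)"

primrec loop_pow :: "('o, 'm) additive_cat \<Rightarrow> 'o model_triple \<Rightarrow> ('o, 'm) model_choice
    \<Rightarrow> nat \<Rightarrow> 'o \<Rightarrow> 'o \<Rightarrow> 'm set \<Rightarrow> 'm set" where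
  "loop_pow C M K 0 X X' \<alpha> = \<alpha>"
| "loop_pow C M K (Suc n) X X' \<alpha> =
     loop_map C M K ((loop_ob C K ^^ n) X) ((loop_ob C K ^^ n) X') (loop_pow C M K n X X' \<alpha>)"

definition Sigma_ob :: "('o, 'm) additive_cat \<Rightarrow> ('o, 'm) model_choice \<Rightarrow> int \<Rightarrow> 'o \<Rightarrow> 'o" where
  "Sigma_ob C K n X =
     (if n \<ge> 0 then (susp_ob C K ^^ nat n) X else (loop_ob C K ^^ nat (-n)) X)"

definition Sigma_map :: "('o, 'm) additive_cat \<Rightarrow> 'o model_triple \<Rightarrow> ('o, 'm) model_choice
    \<Rightarrow> int \<Rightarrow> 'o \<Rightarrow> 'o \<Rightarrow> 'm set \<Rightarrow> 'm set" where
  "Sigma_map C M K n X X' \<alpha> =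
     (if n \<ge> 0 then susp_pow C M K (nat n) X X' \<alpha> else loop_pow C M K (nat (-n)) X X' \<alpha>)"

definition Omega_ob :: "('o, 'm) additive_cat \<Rightarrow> ('o, 'm) model_choice \<Rightarrow> int \<Rightarrow> 'o \<Rightarrow> 'o" where
  "Omega_ob C K n X =
     (if n \<ge> 0 then (loop_ob C K ^^ nat n) X else (susp_ob C K ^^ nat (-n)) X)"

definition Omega_map :: "('o, 'm) additive_cat \<Rightarrow> 'o model_triple \<Rightarrow> ('o, 'm) model_choice
    \<Rightarrow> int \<Rightarrow> 'o \<Rightarrow> 'o \<Rightarrow> 'm set \<Rightarrow> 'm set" where
  "Omega_map C M K n X X' \<alpha> =
     (if n \<ge> 0 then loop_pow C M K (nat n) X X' \<alpha> else susp_pow C M K (nat (-n)) X X' \<alpha>)"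

section \<open>Ext groups of the model structure\<close>

text \<open>Cocycles and coboundaries in degree \<open>n\<close> of the cochain complex of morphisms from \<open>W\<close> to \<open>B\<close>.
  The object of \<open>W\<close> in degree \<open>n - 1\<close> is the codomain of \<open>diff W n\<close>.\<close>
definition cocycles ::
    "('o, 'm) additive_cat \<Rightarrow> 'm resolution \<Rightarrow> 'o \<Rightarrow> int \<Rightarrow> 'm set" where
  "cocycles C W B n = {f \<in> Hom C (cx_ob C W n) B.
     f \<cdot>\<^bsub>C\<^esub> diff W (n + 1) = zero_ar C (cx_ob C W (n + 1)) B}"

definition coboundaries ::
    "('o, 'm) additive_cat \<Rightarrow> 'm resolution \<Rightarrow> 'o \<Rightarrow> int \<Rightarrow> 'm set" where
  "coboundaries C W B n = {g \<cdot>\<^bsub>C\<^esub> diff W n | g. g \<in> Hom C (cx_ob C W (n - 1)) B}"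

definition Hom_cohomology ::
    "('o, 'm) additive_cat \<Rightarrow> 'm resolution \<Rightarrow> 'o \<Rightarrow> int \<Rightarrow> 'm set monoid" where
  "Hom_cohomology C W B n =
     (Hom_group C (cx_ob C W n) B)\<lparr>carrier := cocycles C W B n\<rparr> Mod coboundaries C W B n"

definition cohomology_class ::
    "('o, 'm) additive_cat \<Rightarrow> 'm resolution \<Rightarrow> 'o \<Rightarrow> int \<Rightarrow> 'm \<Rightarrow> 'm set" where
  "cohomology_class C W B n f = coboundaries C W B n #>\<^bsub>Hom_group C (cx_ob C W n) B\<^esub> f"

text \<open>For \<open>A\<close> cofibrant and \<open>B\<close> fibrant.\<close>
definition Ext_model :: "('o, 'm) additive_cat \<Rightarrow> ('o, 'm) model_choice
    \<Rightarrow> int \<Rightarrow> 'o \<Rightarrow> 'o \<Rightarrow> 'm set monoid" where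
  "Ext_model C K n A B = Hom_cohomology C (reso K A) B n"

definition Ext_Ho :: "('o, 'm) additive_cat \<Rightarrow> ('o, 'm) model_choice
    \<Rightarrow> int \<Rightarrow> 'o \<Rightarrow> 'o \<Rightarrow> 'm set monoid" where
  "Ext_Ho C K n A B = Ext_model C K n (RQ_ob C K A) (RQ_ob C K B)"

text \<open>\<open>t\<close> is a chain map between resolutions compatible with a morphism \<open>f\<close> of the resolved
  objects.\<close>
definition chain_lift ::
    "('o, 'm) additive_cat \<Rightarrow> 'm resolution \<Rightarrow> 'm resolution \<Rightarrow> 'm \<Rightarrow> (int \<Rightarrow> 'm) \<Rightarrow> bool" where
  "chain_lift C W W' f t \<longleftrightarrow>
     (\<forall>i. t i \<in> Hom C (cx_ob C W i) (cx_ob C W' i)) \<and>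
     (\<forall>i. diff W' i \<cdot>\<^bsub>C\<^esub> t i = t (i - 1) \<cdot>\<^bsub>C\<^esub> diff W i) \<and>
     aug W' \<cdot>\<^bsub>C\<^esub> t 0 = f \<cdot>\<^bsub>C\<^esub> aug W \<and>
     t (-1) \<cdot>\<^bsub>C\<^esub> coaug W = coaug W' \<cdot>\<^bsub>C\<^esub> f"

text \<open>The map from \<open>Ext\<^sup>n(A, B)\<close> to \<open>Ext\<^sup>n(A', B')\<close> induced by \<open>\<alpha> : A' \<rightarrow> A\<close> and \<open>\<beta> : B \<rightarrow> B'\<close> in
  the homotopy category.\<close>
definition Ext_Ho_map :: "('o, 'm) additive_cat \<Rightarrow> ('o, 'm) model_choice \<Rightarrow> int
    \<Rightarrow> 'o \<Rightarrow> 'o \<Rightarrow> 'o \<Rightarrow> 'o \<Rightarrow> 'm set \<Rightarrow> 'm set \<Rightarrow> 'm set \<Rightarrow> 'm set" where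
  "Ext_Ho_map C K n A A' B B' \<alpha> \<beta> \<xi> =
     \<Union>{cohomology_class C (reso K (RQ_ob C K A')) (RQ_ob C K B') n (b \<cdot>\<^bsub>C\<^esub> (x \<cdot>\<^bsub>C\<^esub> t n)) | a b t x.
        a \<in> \<alpha> \<and> b \<in> \<beta> \<and> x \<in> \<xi> \<and>
        chain_lift C (reso K (RQ_ob C K A')) (reso K (RQ_ob C K A)) a t}"

definition Ho_Omega_map :: "('o, 'm) additive_cat \<Rightarrow> 'o model_triple \<Rightarrow> ('o, 'm) model_choice \<Rightarrow> int
    \<Rightarrow> 'o \<Rightarrow> 'o \<Rightarrow> 'o \<Rightarrow> 'o \<Rightarrow> 'm set \<Rightarrow> 'm set \<Rightarrow> 'm set \<Rightarrow> 'm set" where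
  "Ho_Omega_map C M K n A A' B B' \<alpha> \<beta> x =
     Ho_cmp C M K (Omega_ob C K n A') B' \<beta>
       (Ho_cmp C M K (Omega_ob C K n A') B x (Omega_map C M K n A' A \<alpha>))"

definition Ho_Sigma_map :: "('o, 'm) additive_cat \<Rightarrow> 'o model_triple \<Rightarrow> ('o, 'm) model_choice \<Rightarrow> int
    \<Rightarrow> 'o \<Rightarrow> 'o \<Rightarrow> 'o \<Rightarrow> 'o \<Rightarrow> 'm set \<Rightarrow> 'm set \<Rightarrow> 'm set \<Rightarrow> 'm set" where
  "Ho_Sigma_map C M K n A A' B B' \<alpha> \<beta> x =
     Ho_cmp C M K A' (Sigma_ob C K n B') (Sigma_map C M K n B B' \<beta>)
       (Ho_cmp C M K A' (Sigma_ob C K n B) x \<alpha>)"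

text \<open>Natural isomorphisms of functors to groups, contravariant in the first and covariant in the
  second argument, on the homotopy category. \<open>F\<close> and \<open>G\<close> give the groups; \<open>Fm\<close> and \<open>Gm\<close> give the
  maps induced by \<open>\<alpha> : A' \<rightarrow> A\<close> and \<open>\<beta> : B \<rightarrow> B'\<close>.\<close>
definition natural_iso :: "('o, 'm) additive_cat \<Rightarrow> 'o model_triple \<Rightarrow> ('o, 'm) model_choice
    \<Rightarrow> ('o \<Rightarrow> 'o \<Rightarrow> 'a monoid)
    \<Rightarrow> ('o \<Rightarrow> 'o \<Rightarrow> 'o \<Rightarrow> 'o \<Rightarrow> 'm set \<Rightarrow> 'm set \<Rightarrow> 'a \<Rightarrow> 'a)
    \<Rightarrow> ('o \<Rightarrow> 'o \<Rightarrow> 'b monoid)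
    \<Rightarrow> ('o \<Rightarrow> 'o \<Rightarrow> 'o \<Rightarrow> 'o \<Rightarrow> 'm set \<Rightarrow> 'm set \<Rightarrow> 'b \<Rightarrow> 'b)
    \<Rightarrow> ('o \<Rightarrow> 'o \<Rightarrow> 'a \<Rightarrow> 'b) \<Rightarrow> bool" where
  "natural_iso C M K F Fm G Gm \<phi> \<longleftrightarrow>
     (\<forall>A\<in>Ob C. \<forall>B\<in>Ob C. \<phi> A B \<in> iso (F A B) (G A B)) \<and>
     (\<forall>A\<in>Ob C. \<forall>A'\<in>Ob C. \<forall>B\<in>Ob C. \<forall>B'\<in>Ob C.
        \<forall>\<alpha>\<in>carrier (Ho C M K A' A). \<forall>\<beta>\<in>carrier (Ho C M K B B'). \<forall>x\<in>carrier (F A B).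
          \<phi> A' B' (Fm A A' B B' \<alpha> \<beta> x) = Gm A A' B B' \<alpha> \<beta> (\<phi> A B x))"

end

theory Submission
  imports Defs
begin

text \<open>
  Call a sequence of short exact sequences \<open>X\<^sub>k\<^sub>+\<^sub>1 \<rightarrow> T\<^sub>k \<rightarrow> X\<^sub>k\<close>, \<open>k\<close> ranging over the integers, a tower if every
  \<open>X\<^sub>k\<close> is bifibrant and every \<open>T\<^sub>k\<close> is trivial. A morphism \<open>X\<^sub>l \<rightarrow> Y\<^sub>l\<close> between the terms of two towers extends to
  a morphism of towers, and whether its components factor through trivial objects does not depend on the
  index, so each component determines all the others up to stable equality. The cycles of a resolution
  of \<open>RQA\<close> form a tower \<open>X\<close> with \<open>X\<^sub>0 = RQA\<close>, and bifibrant replacements of the chosen suspension and loop sequences form a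
  tower \<open>RQ \<Omega>\<^sup>k A\<close>. A cocycle of degree \<open>n\<close> is the same as a morphism \<open>X\<^sub>n \<rightarrow> RQB\<close>, and it is a coboundary iff
  that morphism is stably zero. The identity of \<open>RQA\<close> extends to a stable isomorphism \<open>X\<^sub>n \<cong> RQ \<Omega>\<^sup>n A\<close>, which
  gives the first isomorphism; extending a morphism \<open>X\<^sub>0 \<rightarrow> RQ \<Sigma>\<^sup>n B\<close> to one from \<open>X\<close> to the shifted tower of \<open>B\<close>, with
  component \<open>X\<^sub>n \<rightarrow> RQB\<close> in degree \<open>n\<close>, gives the second.
\<close>

text \<open>The hereditary condition is stated as the vanishing of sets of zigzag classes of Yoneda
  extensions, where neither a group structure nor a long exact sequence is at hand. It is turned
  into two closure properties, of cofibrant objects under kernels of epimorphisms and of fibrant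
  objects under cokernels of monomorphisms, by attaching to a 2-extension a property that is
  invariant under zigzags. These closure properties make the cycles of a resolution bifibrant and
  make bifibrant replacements of short exact sequences exist. Suspension and loop of a class are
  unions over all such replacements, so two replacements of one sequence have to be compared by a
  morphism that is the identity on one end and stably the identity on the other. Extending morphisms
  along towers involves choices that matter only up to stable equality, so both isomorphisms are
  obtained from additive relations between representatives rather than from functions. Dual
  statements are read off from the opposite category, which exchanges \<open>Q\<close> and
  \<open>R\<close> and keeps \<open>W\<close>.\<close>

definition opp :: "('o, 'm) additive_cat \<Rightarrow> ('o, 'm) additive_cat" where
  "opp C = \<lparr>Ob = Ob C, Ar = Ar C, Dom = Cod C, Cod = Dom C, Idt = Idt C,
     cmp = (\<lambda>g f. f \<cdot>\<^bsub>C\<^esub> g), plus_ar = plus_ar C, zero_ar = (\<lambda>A B. zero_ar C B A)\<rparr>"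

lemma opp_simps [simp]:
  "Ob (opp C) = Ob C" "Ar (opp C) = Ar C" "Dom (opp C) = Cod C" "Cod (opp C) = Dom C"
  "Idt (opp C) = Idt C" "g \<cdot>\<^bsub>opp C\<^esub> f = f \<cdot>\<^bsub>C\<^esub> g" "plus_ar (opp C) = plus_ar C"
  "zero_ar (opp C) A B = zero_ar C B A"
  by (simp_all add: opp_def)

text \<open>With these as simp rules, a lemma instantiated at \<open>opp C\<close> simplifies to its
  dual over \<open>C\<close>. A short exact sequence is merely read backwards, so results on
  \<open>short_exact\<close> dualise without a separate notion.\<close>

lemma opp_derived [simp]:
  "Hom (opp C) A B = Hom C B A"
  "Hom_group (opp C) A B = Hom_group C B A"
  "is_mono (opp C) f = is_epi C f"
  "is_epi (opp C) f = is_mono C f"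
  "is_kernel (opp C) k f = is_cokernel C k f"
  "is_cokernel (opp C) k f = is_kernel C k f"
  "short_exact (opp C) p i = short_exact C i p"
proof -
  show H: "Hom (opp C) A B = Hom C B A" for A B by (auto simp: Hom_def)
  show "Hom_group (opp C) A B = Hom_group C B A" by (simp add: Hom_group_def H)
  show "is_mono (opp C) f = is_epi C f" by (simp add: is_mono_def is_epi_def H)
  show "is_epi (opp C) f = is_mono C f" by (simp add: is_mono_def is_epi_def H)
  show k: "is_kernel (opp C) k f = is_cokernel C k f" for k f
    unfolding is_kernel_def is_cokernel_def opp_simps H by metis
  show c: "is_cokernel (opp C) k f = is_kernel C k f" for k f
    unfolding is_kernel_def is_cokernel_def opp_simps H by metis
  show "short_exact (opp C) p i = short_exact C i p" by (auto simp: short_exact_def k c)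
qed

section \<open>Preadditive categories\<close>

context preadditive_category
begin

abbreviation zero_map ("\<zero>\<^bsub>_,_\<^esub>") where "zero_map A B \<equiv> zero_ar C A B"
abbreviation add_map (infixl "\<oplus>" 65) where "f \<oplus> g \<equiv> plus_ar C f g"
text \<open>Reading the hom-group off \<open>f\<close> keeps the two end objects out of the argument
  list, so that negation is a plain unary operation in rewriting.\<close>

definition neg where "neg f = inv\<^bsub>Hom_group C (Dom C f) (Cod C f)\<^esub> f"
abbreviation sub_map (infixl "\<ominus>" 65) where "f \<ominus> g \<equiv> plus_ar C f (neg g)"

lemma Hom_iff: "f \<in> Hom C X Y \<longleftrightarrow> f \<in> Ar C \<and> Dom C f = X \<and> Cod C f = Y"
  by (auto simp: Hom_def)

lemma Hom_self: "f \<in> Ar C \<Longrightarrow> f \<in> Hom C (Dom C f) (Cod C f)"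
  by (simp add: Hom_iff)

lemma ends_in_Ob [simp]: "f \<in> Ar C \<Longrightarrow> Dom C f \<in> Ob C" "f \<in> Ar C \<Longrightarrow> Cod C f \<in> Ob C"
  by (simp_all add: Dom_in_Ob Cod_in_Ob)

lemma cmp_Ar [simp]:
  assumes "f \<in> Ar C" "g \<in> Ar C" "Dom C g = Cod C f"
  shows "g \<cdot> f \<in> Ar C" "Dom C (g \<cdot> f) = Dom C f" "Cod C (g \<cdot> f) = Cod C g"
  using cmp_in_Hom[of f "Dom C f" "Cod C f" g "Cod C g"] assms by (auto simp: Hom_iff)

lemma Idt_Ar [simp]:
  assumes "A \<in> Ob C"
  shows "Idt C A \<in> Ar C" "Dom C (Idt C A) = A" "Cod C (Idt C A) = A"
  using Idt_in_Hom[OF assms] by (auto simp: Hom_iff)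

lemma cmp_Idt' [simp]: "f \<in> Ar C \<Longrightarrow> Dom C f = A \<Longrightarrow> f \<cdot> Idt C A = f"
  and Idt_cmp' [simp]: "f \<in> Ar C \<Longrightarrow> Cod C f = A \<Longrightarrow> Idt C A \<cdot> f = f"
  using cmp_Idt Idt_cmp Hom_self by metis+

lemma assoc [simp]:
  assumes "f \<in> Ar C" "g \<in> Ar C" "h \<in> Ar C" "Dom C g = Cod C f" "Dom C h = Cod C g"
  shows "(h \<cdot> g) \<cdot> f = h \<cdot> (g \<cdot> f)"
  using cmp_assoc[of f "Dom C f" "Cod C f" g "Cod C g" h "Cod C h"] assms by (auto simp: Hom_iff)

text \<open>The rule \<open>assoc\<close> nests composites to the right, which hides
  \<open>g \<cdot> f\<close> inside \<open>g \<cdot> (f \<cdot> x)\<close>. This form lets a known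
  equation act in front of a further factor \<open>x\<close>; \<open>cmp_reduce2\<close> serves
  equations whose right-hand side is itself a composite.\<close>

lemma cmp_reduce:
  assumes "g \<cdot> f = h" "x \<in> Ar C" "f \<in> Ar C" "g \<in> Ar C" "Dom C g = Cod C f" "Dom C f = Cod C x"
  shows "g \<cdot> (f \<cdot> x) = h \<cdot> x"
  using assoc[of x f g] assms by simp

lemma cmp_reduce2:
  assumes "g \<cdot> f = h \<cdot> k" "x \<in> Ar C" "f \<in> Ar C" "g \<in> Ar C" "Dom C g = Cod C f" "Dom C f = Cod C x"
    "k \<in> Ar C" "h \<in> Ar C" "Dom C h = Cod C k" "Dom C k = Cod C x"
  shows "g \<cdot> (f \<cdot> x) = h \<cdot> (k \<cdot> x)"
  using assoc[of x f g] assoc[of x k h] assms by simp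

lemma Hom_comm_group: "A \<in> Ob C \<Longrightarrow> B \<in> Ob C \<Longrightarrow> comm_group (Hom_group C A B)"
  by (rule comm_group_Hom)

lemma Hom_group_simps [simp]:
  "carrier (Hom_group C A B) = Hom C A B" "mult (Hom_group C A B) = plus_ar C"
  "one (Hom_group C A B) = zero_ar C A B"
  by (simp_all add: Hom_group_def)

lemma zero_Ar [simp]:
  assumes "A \<in> Ob C" "B \<in> Ob C"
  shows "\<zero>\<^bsub>A,B\<^esub> \<in> Ar C" "Dom C \<zero>\<^bsub>A,B\<^esub> = A" "Cod C \<zero>\<^bsub>A,B\<^esub> = B"
proof -
  interpret G: comm_group "Hom_group C A B" by (rule Hom_comm_group) fact+
  show "\<zero>\<^bsub>A,B\<^esub> \<in> Ar C" "Dom C \<zero>\<^bsub>A,B\<^esub> = A" "Cod C \<zero>\<^bsub>A,B\<^esub> = B"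
    using G.one_closed by (auto simp: Hom_iff)
qed

lemma plus_Ar [simp]:
  assumes "f \<in> Ar C" "g \<in> Ar C" "Dom C f = Dom C g" "Cod C f = Cod C g"
  shows "f \<oplus> g \<in> Ar C" "Dom C (f \<oplus> g) = Dom C g" "Cod C (f \<oplus> g) = Cod C g"
proof -
  interpret G: comm_group "Hom_group C (Dom C g) (Cod C g)" by (rule Hom_comm_group) (use assms in auto)
  show "f \<oplus> g \<in> Ar C" "Dom C (f \<oplus> g) = Dom C g" "Cod C (f \<oplus> g) = Cod C g"
    using G.m_closed[of f g] assms by (auto simp: Hom_iff)
qed

lemma neg_Ar [simp]:
  assumes "f \<in> Ar C"
  shows "neg f \<in> Ar C" "Dom C (neg f) = Dom C f" "Cod C (neg f) = Cod C f"
proof -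
  interpret G: comm_group "Hom_group C (Dom C f) (Cod C f)" by (rule Hom_comm_group) (use assms in auto)
  show "neg f \<in> Ar C" "Dom C (neg f) = Dom C f" "Cod C (neg f) = Cod C f"
    using G.inv_closed[of f] assms by (auto simp: Hom_iff neg_def)
qed

lemma plus_assoc [simp]:
  assumes "f \<in> Ar C" "g \<in> Ar C" "h \<in> Ar C" "Dom C f = Dom C g" "Cod C f = Cod C g"
    "Dom C h = Dom C g" "Cod C h = Cod C g"
  shows "(f \<oplus> g) \<oplus> h = f \<oplus> (g \<oplus> h)"
proof -
  interpret G: comm_group "Hom_group C (Dom C g) (Cod C g)" by (rule Hom_comm_group) (use assms in auto)
  show ?thesis using G.m_assoc[of f g h] assms by (simp add: Hom_iff)
qed

lemma plus_comm:
  assumes "f \<in> Ar C" "g \<in> Ar C" "Dom C f = Dom C g" "Cod C f = Cod C g"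
  shows "f \<oplus> g = g \<oplus> f"
proof -
  interpret G: comm_group "Hom_group C (Dom C g) (Cod C g)" by (rule Hom_comm_group) (use assms in auto)
  show ?thesis using G.m_comm[of f g] assms by (simp add: Hom_iff)
qed

lemma plus_lcomm:
  assumes "f \<in> Ar C" "g \<in> Ar C" "h \<in> Ar C" "Dom C f = Dom C g" "Cod C f = Cod C g"
    "Dom C h = Dom C g" "Cod C h = Cod C g"
  shows "f \<oplus> (g \<oplus> h) = g \<oplus> (f \<oplus> h)"
proof -
  have "f \<oplus> (g \<oplus> h) = (f \<oplus> g) \<oplus> h" using assms by simp
  also have "f \<oplus> g = g \<oplus> f" using assms by (intro plus_comm) simp_all
  also have "(g \<oplus> f) \<oplus> h = g \<oplus> (f \<oplus> h)" using assms by simp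
  finally show ?thesis .
qed

lemma plus_zero [simp]:
  assumes "f \<in> Ar C" "Dom C f = A" "Cod C f = B"
  shows "f \<oplus> \<zero>\<^bsub>A,B\<^esub> = f" "\<zero>\<^bsub>A,B\<^esub> \<oplus> f = f"
proof -
  interpret G: comm_group "Hom_group C (Dom C f) (Cod C f)" by (rule Hom_comm_group) (use assms in auto)
  show "f \<oplus> \<zero>\<^bsub>A,B\<^esub> = f" "\<zero>\<^bsub>A,B\<^esub> \<oplus> f = f"
    using G.r_one[of f] G.l_one[of f] assms by (auto simp: Hom_iff)
qed

lemma plus_neg [simp]:
  assumes "f \<in> Ar C"
  shows "f \<ominus> f = \<zero>\<^bsub>Dom C f,Cod C f\<^esub>" "neg f \<oplus> f = \<zero>\<^bsub>Dom C f,Cod C f\<^esub>"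
proof -
  interpret G: comm_group "Hom_group C (Dom C f) (Cod C f)" by (rule Hom_comm_group) (use assms in auto)
  show "f \<ominus> f = \<zero>\<^bsub>Dom C f,Cod C f\<^esub>" "neg f \<oplus> f = \<zero>\<^bsub>Dom C f,Cod C f\<^esub>"
    using G.r_inv[of f] G.l_inv[of f] assms by (auto simp: Hom_iff neg_def)
qed

lemma plus_neg_cancel [simp]:
  assumes "f \<in> Ar C" "g \<in> Ar C" "Dom C f = Dom C g" "Cod C f = Cod C g"
  shows "f \<oplus> (neg f \<oplus> g) = g" "neg f \<oplus> (f \<oplus> g) = g"
proof -
  have "f \<oplus> (neg f \<oplus> g) = (f \<ominus> f) \<oplus> g" "neg f \<oplus> (f \<oplus> g) = (neg f \<oplus> f) \<oplus> g"
    using assms by (simp_all only: plus_assoc neg_Ar)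
  then show "f \<oplus> (neg f \<oplus> g) = g" "neg f \<oplus> (f \<oplus> g) = g"
    using assms by (simp_all del: plus_assoc)
qed

lemma plus_left_cancel:
  assumes "h \<oplus> f = h \<oplus> g" "f \<in> Ar C" "g \<in> Ar C" "h \<in> Ar C"
    "Dom C f = Dom C h" "Cod C f = Cod C h" "Dom C g = Dom C h" "Cod C g = Cod C h"
  shows "f = g"
  using plus_neg_cancel(2)[of h f] plus_neg_cancel(2)[of h g] assms by metis

lemma neg_unique:
  assumes "f \<oplus> g = \<zero>\<^bsub>Dom C f,Cod C f\<^esub>" "f \<in> Ar C" "g \<in> Ar C" "Dom C f = Dom C g" "Cod C f = Cod C g"
  shows "g = neg f"
  by (rule plus_left_cancel[of f]) (use assms in simp_all)

lemma neg_neg [simp]: "f \<in> Ar C \<Longrightarrow> neg (neg f) = f"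
  by (rule neg_unique[symmetric]) simp_all

lemma neg_plus [simp]:
  assumes "f \<in> Ar C" "g \<in> Ar C" "Dom C f = Dom C g" "Cod C f = Cod C g"
  shows "neg (f \<oplus> g) = neg f \<oplus> neg g"
proof -
  have "(f \<oplus> g) \<oplus> (neg f \<oplus> neg g) = \<zero>\<^bsub>Dom C g,Cod C g\<^esub>"
    using assms plus_lcomm[of g "neg f" "neg g"] by simp
  then show ?thesis using assms by (intro neg_unique[symmetric]) simp_all
qed

lemma cmp_plus_r [simp]:
  assumes "f \<in> Ar C" "f' \<in> Ar C" "g \<in> Ar C" "Dom C f = Dom C f'" "Cod C f = Cod C f'"
    "Dom C g = Cod C f'"
  shows "g \<cdot> (f \<oplus> f') = (g \<cdot> f) \<oplus> (g \<cdot> f')"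
  using cmp_plus_right[of f "Dom C f'" "Cod C f'" f' g "Cod C g"] assms by (simp add: Hom_iff)

lemma cmp_plus_l [simp]:
  assumes "g \<in> Ar C" "g' \<in> Ar C" "f \<in> Ar C" "Dom C g = Dom C g'" "Cod C g = Cod C g'"
    "Dom C g' = Cod C f"
  shows "(g \<oplus> g') \<cdot> f = (g \<cdot> f) \<oplus> (g' \<cdot> f)"
  using cmp_plus_left[of f "Dom C f" "Cod C f" g "Cod C g'" g'] assms by (simp add: Hom_iff)

lemma plus_self_zero:
  assumes "f \<oplus> f = f" "f \<in> Ar C"
  shows "f = \<zero>\<^bsub>Dom C f,Cod C f\<^esub>"
  by (rule plus_left_cancel[of f]) (use assms in simp_all)

lemma cmp_zero [simp]:
  assumes "g \<in> Ar C" "Dom C g = B" "A \<in> Ob C"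
  shows "g \<cdot> \<zero>\<^bsub>A,B\<^esub> = \<zero>\<^bsub>A,Cod C g\<^esub>"
proof -
  have [simp]: "B \<in> Ob C" using assms ends_in_Ob by blast
  have "(g \<cdot> \<zero>\<^bsub>A,B\<^esub>) \<oplus> (g \<cdot> \<zero>\<^bsub>A,B\<^esub>) = g \<cdot> \<zero>\<^bsub>A,B\<^esub>"
    using cmp_plus_r[of "\<zero>\<^bsub>A,B\<^esub>" "\<zero>\<^bsub>A,B\<^esub>" g] assms by simp
  then show ?thesis using assms plus_self_zero[of "g \<cdot> \<zero>\<^bsub>A,B\<^esub>"] by simp
qed

lemma zero_cmp [simp]:
  assumes "f \<in> Ar C" "Cod C f = A" "B \<in> Ob C"
  shows "\<zero>\<^bsub>A,B\<^esub> \<cdot> f = \<zero>\<^bsub>Dom C f,B\<^esub>"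
proof -
  have [simp]: "A \<in> Ob C" using assms ends_in_Ob by blast
  have "(\<zero>\<^bsub>A,B\<^esub> \<cdot> f) \<oplus> (\<zero>\<^bsub>A,B\<^esub> \<cdot> f) = \<zero>\<^bsub>A,B\<^esub> \<cdot> f"
    using cmp_plus_l[of "\<zero>\<^bsub>A,B\<^esub>" "\<zero>\<^bsub>A,B\<^esub>" f] assms by simp
  then show ?thesis using assms plus_self_zero[of "\<zero>\<^bsub>A,B\<^esub> \<cdot> f"] by simp
qed

lemma cmp_neg [simp]:
  assumes "f \<in> Ar C" "g \<in> Ar C" "Dom C g = Cod C f"
  shows "g \<cdot> neg f = neg (g \<cdot> f)" "neg g \<cdot> f = neg (g \<cdot> f)"
proof -
  have "(g \<cdot> f) \<oplus> (g \<cdot> neg f) = g \<cdot> (f \<ominus> f)" "(g \<cdot> f) \<oplus> (neg g \<cdot> f) = (g \<ominus> g) \<cdot> f"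
    using assms by (simp_all del: plus_neg)
  then show "g \<cdot> neg f = neg (g \<cdot> f)" "neg g \<cdot> f = neg (g \<cdot> f)"
    using assms by (intro neg_unique; simp)+
qed

lemma neg_zero [simp]: "A \<in> Ob C \<Longrightarrow> B \<in> Ob C \<Longrightarrow> neg \<zero>\<^bsub>A,B\<^esub> = \<zero>\<^bsub>A,B\<^esub>"
  by (rule neg_unique[symmetric]) simp_all

lemma sub_eq_zero:
  assumes "f \<ominus> g = \<zero>\<^bsub>A,B\<^esub>" "f \<in> Ar C" "g \<in> Ar C" "Dom C f = Dom C g" "Cod C f = Cod C g"
    "Dom C g = A" "Cod C g = B"
  shows "f = g"
proof -
  have "neg g = neg f" using assms by (intro neg_unique) simp_all
  then show ?thesis using assms by (metis neg_neg)
qed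

lemma sub_eq_iff:
  assumes "f \<in> Ar C" "g \<in> Ar C" "h \<in> Ar C" "Dom C f = Dom C g" "Cod C f = Cod C g"
    "Dom C h = Dom C g" "Cod C h = Cod C g"
  shows "f \<ominus> g = h \<longleftrightarrow> f = g \<oplus> h"
proof
  assume "f \<ominus> g = h"
  then have "g \<oplus> h = g \<oplus> (f \<ominus> g)" by simp
  also have "\<dots> = f \<oplus> (g \<ominus> g)" using assms by (intro plus_lcomm) simp_all
  finally show "f = g \<oplus> h" using assms by simp
next
  assume "f = g \<oplus> h"
  then have "neg g \<oplus> f = neg g \<oplus> (g \<oplus> h)" by (rule arg_cong)
  moreover have "f \<ominus> g = neg g \<oplus> f" using assms by (intro plus_comm) simp_all
  ultimately show "f \<ominus> g = h" using assms by simp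
qed

end

lemma opp_preadditive:
  assumes "preadditive_category C"
  shows "preadditive_category (opp C)"
proof -
  interpret preadditive_category C by fact
  show ?thesis
    by (rule preadditive_category.intro) (auto simp: Hom_comm_group Hom_iff)
qed

lemma opp_abelian:
  assumes "abelian_category C"
  shows "abelian_category (opp C)"
proof -
  interpret abelian_category C by fact
  interpret O: preadditive_category "opp C"
    by (rule opp_preadditive) (rule preadditive_category_axioms)
  show ?thesis
  proof
    show "\<exists>Z\<in>Ob (opp C). \<forall>A\<in>Ob (opp C). (\<exists>!f. f \<in> Hom (opp C) A Z) \<and> (\<exists>!f. f \<in> Hom (opp C) Z A)"
      using zero_object by (simp add: conj_commute)
    fix A B assume "A \<in> Ob (opp C)" "B \<in> Ob (opp C)"
    then obtain P i j p q where "P \<in> Ob C" "i \<in> Hom C A P" "j \<in> Hom C B P" "p \<in> Hom C P A" "q \<in> Hom C P B"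
      "p \<cdot>\<^bsub>C\<^esub> i = Idt C A \<and> q \<cdot>\<^bsub>C\<^esub> j = Idt C B \<and> p \<cdot>\<^bsub>C\<^esub> j = zero_ar C B A \<and> q \<cdot>\<^bsub>C\<^esub> i = zero_ar C A B \<and>
        plus_ar C (i \<cdot>\<^bsub>C\<^esub> p) (j \<cdot>\<^bsub>C\<^esub> q) = Idt C P"
      using biproduct[of A B] by auto
    note P = this
    show "\<exists>P\<in>Ob (opp C). \<exists>i\<in>Hom (opp C) A P. \<exists>j\<in>Hom (opp C) B P. \<exists>p\<in>Hom (opp C) P A. \<exists>q\<in>Hom (opp C) P B.
        p \<cdot>\<^bsub>opp C\<^esub> i = Idt (opp C) A \<and> q \<cdot>\<^bsub>opp C\<^esub> j = Idt (opp C) B \<and>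
        p \<cdot>\<^bsub>opp C\<^esub> j = zero_ar (opp C) B A \<and> q \<cdot>\<^bsub>opp C\<^esub> i = zero_ar (opp C) A B \<and>
        plus_ar (opp C) (i \<cdot>\<^bsub>opp C\<^esub> p) (j \<cdot>\<^bsub>opp C\<^esub> q) = Idt (opp C) P"
      by (rule bexI[of _ P], rule bexI[of _ p], rule bexI[of _ q], rule bexI[of _ i], rule bexI[of _ j]) (use P in auto)
  qed (simp_all add: has_kernel has_cokernel mono_is_kernel epi_is_cokernel)
qed

section \<open>Abelian categories\<close>

context abelian_category
begin

abbreviation "ses \<equiv> short_exact C"

lemma dual: "abelian_category (opp C)"
  by (rule opp_abelian) (rule abelian_category_axioms)

lemma mono_Ar [simp]: "is_mono C f \<Longrightarrow> f \<in> Ar C"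
  and epi_Ar [simp]: "is_epi C f \<Longrightarrow> f \<in> Ar C"
  by (simp_all add: is_mono_def is_epi_def)

lemma mono_cancel:
  assumes "is_mono C f" "f \<cdot> x = f \<cdot> y" "x \<in> Ar C" "y \<in> Ar C" "Cod C x = Dom C f" "Cod C y = Dom C f"
  shows "x = y"
proof -
  have "Dom C x = Dom C y" using assms cmp_Ar(2)[of x f] cmp_Ar(2)[of y f] by simp
  then show ?thesis using assms unfolding is_mono_def by (auto simp: Hom_iff)
qed

lemma epi_cancel:
  assumes "is_epi C f" "x \<cdot> f = y \<cdot> f" "x \<in> Ar C" "y \<in> Ar C" "Dom C x = Cod C f" "Dom C y = Cod C f"
  shows "x = y"
  using abelian_category.mono_cancel[OF dual, of f x y] assms by simp

text \<open>By additivity, \<open>f \<cdot> g = f \<cdot> h\<close> says that \<open>f\<close> kills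
  \<open>g \<ominus> h\<close>, so it is enough to test against zero.\<close>

lemma monoI:
  assumes "f \<in> Ar C"
    and "\<And>x. x \<in> Ar C \<Longrightarrow> Cod C x = Dom C f \<Longrightarrow> f \<cdot> x = \<zero>\<^bsub>Dom C x,Cod C f\<^esub> \<Longrightarrow> x = \<zero>\<^bsub>Dom C x,Dom C f\<^esub>"
  shows "is_mono C f"
  unfolding is_mono_def
proof (intro conjI ballI allI impI)
  fix A g h assume gh: "g \<in> Hom C A (Dom C f)" "h \<in> Hom C A (Dom C f)" "f \<cdot> g = f \<cdot> h"
  then have "f \<cdot> (g \<ominus> h) = \<zero>\<^bsub>A,Cod C f\<^esub>" using assms(1) by (simp add: Hom_iff)
  then have "g \<ominus> h = \<zero>\<^bsub>A,Dom C f\<^esub>" using assms(2)[of "g \<ominus> h"] gh by (simp add: Hom_iff)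
  then show "g = h" by (rule sub_eq_zero) (use gh in \<open>simp_all add: Hom_iff\<close>)
qed (use assms in simp)

lemma epiI:
  assumes "f \<in> Ar C"
    and "\<And>x. x \<in> Ar C \<Longrightarrow> Dom C x = Cod C f \<Longrightarrow> x \<cdot> f = \<zero>\<^bsub>Dom C f,Cod C x\<^esub> \<Longrightarrow> x = \<zero>\<^bsub>Cod C f,Cod C x\<^esub>"
  shows "is_epi C f"
  using abelian_category.monoI[OF dual, of f] assms by simp

lemma mono_zero:
  assumes "is_mono C f" "f \<cdot> x = \<zero>\<^bsub>A,B\<^esub>" "x \<in> Ar C" "Cod C x = Dom C f" "A = Dom C x" "B = Cod C f"
  shows "x = \<zero>\<^bsub>Dom C x,Dom C f\<^esub>"
  by (rule mono_cancel[of f]) (use assms in simp_all)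

lemma epi_zero:
  assumes "is_epi C f" "x \<cdot> f = \<zero>\<^bsub>A,B\<^esub>" "x \<in> Ar C" "Dom C x = Cod C f" "A = Dom C f" "B = Cod C x"
  shows "x = \<zero>\<^bsub>Cod C f,Cod C x\<^esub>"
  by (rule epi_cancel[of f]) (use assms in simp_all)

lemma mono_cmp:
  assumes "is_mono C f" "is_mono C g" "Dom C g = Cod C f"
  shows "is_mono C (g \<cdot> f)"
proof (rule monoI)
  fix x assume x: "x \<in> Ar C" "Cod C x = Dom C (g \<cdot> f)" "(g \<cdot> f) \<cdot> x = \<zero>\<^bsub>Dom C x,Cod C (g \<cdot> f)\<^esub>"
  have "f \<cdot> x = \<zero>\<^bsub>Dom C (f \<cdot> x),Dom C g\<^esub>" by (rule mono_zero[of g]) (use x assms in simp_all)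
  then show "x = \<zero>\<^bsub>Dom C x,Dom C (g \<cdot> f)\<^esub>" using mono_zero[of f x] x assms by simp
qed (use assms in simp)

lemma epi_cmp: "is_epi C f \<Longrightarrow> is_epi C g \<Longrightarrow> Dom C g = Cod C f \<Longrightarrow> is_epi C (g \<cdot> f)"
  using abelian_category.mono_cmp[OF dual, of g f] by simp

lemma mono_factor:
  assumes "is_mono C (g \<cdot> f)" "f \<in> Ar C" "g \<in> Ar C" "Dom C g = Cod C f"
  shows "is_mono C f"
proof (rule monoI)
  fix x assume x: "x \<in> Ar C" "Cod C x = Dom C f" "f \<cdot> x = \<zero>\<^bsub>Dom C x,Cod C f\<^esub>"
  have "(g \<cdot> f) \<cdot> x = \<zero>\<^bsub>Dom C x,Cod C g\<^esub>" using x assms by simp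
  then show "x = \<zero>\<^bsub>Dom C x,Dom C f\<^esub>" using mono_zero[OF assms(1), of x] x assms by simp
qed fact

lemma epi_factor:
  assumes "is_epi C (g \<cdot> f)" "f \<in> Ar C" "g \<in> Ar C" "Dom C g = Cod C f"
  shows "is_epi C g"
  using abelian_category.mono_factor[OF dual, of f g] assms by simp

lemma Idt_mono: "A \<in> Ob C \<Longrightarrow> is_mono C (Idt C A)"
  by (rule monoI) auto

lemma Idt_epi: "A \<in> Ob C \<Longrightarrow> is_epi C (Idt C A)"
  by (rule epiI) auto

section \<open>Kernels, cokernels and short exact sequences\<close>

lemma kernelD:
  assumes "is_kernel C k f"
  shows "k \<in> Ar C" "f \<in> Ar C" "Dom C f = Cod C k" "f \<cdot> k = \<zero>\<^bsub>Dom C k,Cod C f\<^esub>" "is_mono C k"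
proof -
  show k: "k \<in> Ar C" "f \<in> Ar C" "Dom C f = Cod C k" "f \<cdot> k = \<zero>\<^bsub>Dom C k,Cod C f\<^esub>"
    using assms by (simp_all add: is_kernel_def)
  show "is_mono C k"
  proof (rule monoI)
    fix x assume x: "x \<in> Ar C" "Cod C x = Dom C k" "k \<cdot> x = \<zero>\<^bsub>Dom C x,Cod C k\<^esub>"
    have "\<exists>!u. u \<in> Hom C (Dom C x) (Dom C k) \<and> k \<cdot> u = \<zero>\<^bsub>Dom C x,Cod C k\<^esub>"
      using assms x k unfolding is_kernel_def by (auto simp: Hom_iff)
    moreover have "x \<in> Hom C (Dom C x) (Dom C k)" "\<zero>\<^bsub>Dom C x,Dom C k\<^esub> \<in> Hom C (Dom C x) (Dom C k)"
      using x k by (simp_all add: Hom_iff)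
    moreover have "k \<cdot> \<zero>\<^bsub>Dom C x,Dom C k\<^esub> = \<zero>\<^bsub>Dom C x,Cod C k\<^esub>" using x k by simp
    ultimately show "x = \<zero>\<^bsub>Dom C x,Dom C k\<^esub>" using x by metis
  qed (use k in simp)
qed

lemma kernel_lift:
  assumes "is_kernel C k f" "x \<in> Ar C" "Cod C x = Cod C k" "f \<cdot> x = \<zero>\<^bsub>Dom C x,Cod C f\<^esub>"
  obtains u where "u \<in> Ar C" "Dom C u = Dom C x" "Cod C u = Dom C k" "k \<cdot> u = x"
proof -
  have "\<exists>!u. u \<in> Hom C (Dom C x) (Dom C k) \<and> k \<cdot> u = x"
    using assms kernelD[OF assms(1)] unfolding is_kernel_def by (auto simp: Hom_iff)
  then show ?thesis using that by (auto simp: Hom_iff)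
qed

lemma kernelI:
  assumes "is_mono C k" "f \<in> Ar C" "Dom C f = Cod C k" "f \<cdot> k = \<zero>\<^bsub>Dom C k,Cod C f\<^esub>"
    and "\<And>x. x \<in> Ar C \<Longrightarrow> Cod C x = Cod C k \<Longrightarrow> f \<cdot> x = \<zero>\<^bsub>Dom C x,Cod C f\<^esub> \<Longrightarrow>
       \<exists>u\<in>Ar C. Dom C u = Dom C x \<and> Cod C u = Dom C k \<and> k \<cdot> u = x"
  shows "is_kernel C k f"
  unfolding is_kernel_def
proof (intro conjI allI ballI impI)
  fix A h assume h: "h \<in> Hom C A (Dom C f)" "f \<cdot> h = \<zero>\<^bsub>A,Cod C f\<^esub>"
  then obtain u where u: "u \<in> Ar C" "Dom C u = Dom C h" "Cod C u = Dom C k" "k \<cdot> u = h"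
    using assms(3) assms(5)[of h] by (auto simp: Hom_iff)
  show "\<exists>!u. u \<in> Hom C A (Dom C k) \<and> k \<cdot> u = h"
  proof
    show "u \<in> Hom C A (Dom C k) \<and> k \<cdot> u = h" using u h by (simp add: Hom_iff)
    fix v assume "v \<in> Hom C A (Dom C k) \<and> k \<cdot> v = h"
    then show "v = u" using u by (rule_tac mono_cancel[OF assms(1)]) (auto simp: Hom_iff)
  qed
qed (use assms in simp_all)

lemma cokernelD:
  assumes "is_cokernel C c f"
  shows "c \<in> Ar C" "f \<in> Ar C" "Dom C c = Cod C f" "c \<cdot> f = \<zero>\<^bsub>Dom C f,Cod C c\<^esub>" "is_epi C c"
  using abelian_category.kernelD[OF dual, of c f] assms by simp_all

lemma cokernel_lift:
  assumes "is_cokernel C c f" "x \<in> Ar C" "Dom C x = Dom C c" "x \<cdot> f = \<zero>\<^bsub>Dom C f,Cod C x\<^esub>"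
  obtains u where "u \<in> Ar C" "Cod C u = Cod C x" "Dom C u = Cod C c" "u \<cdot> c = x"
  using abelian_category.kernel_lift[OF dual, of c f x] assms by auto

lemma sesD:
  assumes "ses i p"
  shows "i \<in> Ar C" "p \<in> Ar C" "Dom C p = Cod C i" "p \<cdot> i = \<zero>\<^bsub>Dom C i,Cod C p\<^esub>"
    "is_mono C i" "is_epi C p"
  using assms kernelD[of i p] cokernelD[of p i] by (auto simp: short_exact_def)

lemma ses_lift:
  assumes "ses i p" "x \<in> Ar C" "Cod C x = Cod C i" "p \<cdot> x = \<zero>\<^bsub>Dom C x,Cod C p\<^esub>"
  obtains u where "u \<in> Ar C" "Dom C u = Dom C x" "Cod C u = Dom C i" "i \<cdot> u = x"
  using kernel_lift[of i p x] assms by (auto simp: short_exact_def)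

lemma ses_colift:
  assumes "ses i p" "x \<in> Ar C" "Dom C x = Cod C i" "x \<cdot> i = \<zero>\<^bsub>Dom C i,Cod C x\<^esub>"
  obtains u where "u \<in> Ar C" "Cod C u = Cod C x" "Dom C u = Cod C p" "u \<cdot> p = x"
  using abelian_category.ses_lift[OF dual, of p i x] assms sesD[OF assms(1)] by auto

text \<open>The difference \<open>x \<ominus> y\<close> is killed by \<open>p\<close> and so factors
  through the kernel \<open>i\<close>. Two lifts of one morphism are compared in this way
  below.\<close>

lemma ses_diff:
  assumes "ses i p" "p \<cdot> x = p \<cdot> y" "x \<in> Ar C" "y \<in> Ar C" "Cod C x = Cod C i" "Cod C y = Cod C i"
  obtains u where "u \<in> Ar C" "Dom C u = Dom C y" "Cod C u = Dom C i" "x = y \<oplus> i \<cdot> u"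
proof -
  note [simp] = sesD[OF assms(1)]
  have d: "Dom C x = Dom C y" using assms cmp_Ar(2)[of x p] cmp_Ar(2)[of y p] by simp
  have "p \<cdot> (x \<ominus> y) = \<zero>\<^bsub>Dom C y,Cod C p\<^esub>" using assms d by simp
  then obtain u where u: "u \<in> Ar C" "Dom C u = Dom C y" "Cod C u = Dom C i" "i \<cdot> u = x \<ominus> y"
    using ses_lift[OF assms(1), of "x \<ominus> y"] assms d by auto
  have "x = y \<oplus> i \<cdot> u" using u assms d sub_eq_iff[of x y "i \<cdot> u"] by simp
  then show ?thesis using that u by blast
qed

lemma ses_codiff:
  assumes "ses i p" "x \<cdot> i = y \<cdot> i" "x \<in> Ar C" "y \<in> Ar C" "Dom C x = Cod C i" "Dom C y = Cod C i"
  obtains u where "u \<in> Ar C" "Cod C u = Cod C y" "Dom C u = Cod C p" "x = y \<oplus> u \<cdot> p"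
  using abelian_category.ses_diff[OF dual, of p i x y] assms sesD[OF assms(1)] by auto

text \<open>A monomorphism is the kernel of some \<open>g\<close>, and \<open>g\<close> factors
  through the cokernel \<open>p\<close> of \<open>i\<close>. Whatever \<open>p\<close> kills is then
  killed by \<open>g\<close> and factors through \<open>i\<close>, so \<open>i\<close> is the kernel
  of its own cokernel.\<close>

lemma mono_ses:
  assumes "is_mono C i"
  obtains p where "ses i p"
proof -
  have [simp]: "i \<in> Ar C" using assms by simp
  obtain g where g: "is_kernel C i g" using mono_is_kernel assms by blast
  obtain p where p: "is_cokernel C p i" using has_cokernel by fastforce
  note [simp] = kernelD[OF g] cokernelD[OF p]
  have "is_kernel C i p"
  proof (rule kernelI)
    fix x assume x: "x \<in> Ar C" "Cod C x = Cod C i" "p \<cdot> x = \<zero>\<^bsub>Dom C x,Cod C p\<^esub>"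
    obtain u where u: "u \<in> Ar C" "Cod C u = Cod C g" "Dom C u = Cod C p" "u \<cdot> p = g"
      using cokernel_lift[OF p, of g] by auto
    have "g \<cdot> x = u \<cdot> (p \<cdot> x)" using u x assoc[of x p u] by simp
    also have "\<dots> = \<zero>\<^bsub>Dom C x,Cod C g\<^esub>" using u x by simp
    finally show "\<exists>u\<in>Ar C. Dom C u = Dom C x \<and> Cod C u = Dom C i \<and> i \<cdot> u = x"
      using kernel_lift[OF g, of x] x by metis
  qed simp_all
  then show ?thesis using that p by (simp add: short_exact_def)
qed

lemma epi_ses:
  assumes "is_epi C p"
  obtains i where "ses i p"
  using abelian_category.mono_ses[OF dual, of p] assms by auto

text \<open>The epimorphism \<open>p\<close> is the cokernel of some kernel \<open>i'\<close>, and
  \<open>i'\<close> factors through \<open>i\<close>. A morphism that vanishes on \<open>i\<close>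
  therefore vanishes on \<open>i'\<close> and factors through \<open>p\<close>.\<close>

lemma ses_kernelI:
  assumes "is_kernel C i p" "is_epi C p"
  shows "ses i p"
proof -
  note [simp] = kernelD[OF assms(1)]
  obtain i' where i': "ses i' p" using epi_ses assms by blast
  note [simp] = sesD[OF i']
  have ci: "Cod C i' = Cod C i" using kernelD(3)[OF assms(1)] sesD(3)[OF i'] by simp
  obtain u where u: "u \<in> Ar C" "Dom C u = Dom C i'" "Cod C u = Dom C i" "i \<cdot> u = i'"
    using kernel_lift[OF assms(1), of i'] ci by auto
  have "is_kernel (opp C) p i"
  proof (rule abelian_category.kernelI[OF dual], goal_cases)
    case (5 x)
    then have x: "x \<in> Ar C" "Dom C x = Cod C i" "x \<cdot> i = \<zero>\<^bsub>Dom C i,Cod C x\<^esub>" by simp_all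
    have "x \<cdot> i' = (x \<cdot> i) \<cdot> u" unfolding u(4)[symmetric] using u x(1,2) by (intro assoc[symmetric]) auto
    also have "\<dots> = \<zero>\<^bsub>Dom C i',Cod C x\<^esub>" using u x by simp
    finally show ?case using ses_colift[OF i', of x] x ci by (metis opp_simps(2,3,4,6))
  qed (use assms in simp_all)
  then show ?thesis using assms by (simp add: short_exact_def)
qed

lemma kernel_factor_mono:
  assumes "is_kernel C i (m \<cdot> p)" "is_mono C m" "p \<in> Ar C" "Dom C m = Cod C p"
  shows "is_kernel C i p"
proof -
  have "Dom C (m \<cdot> p) = Dom C p" using assms by simp
  then have [simp]: "Dom C p = Cod C i" using kernelD(3)[OF assms(1)] by simp
  note [simp] = kernelD[OF assms(1)]
  have "m \<cdot> (p \<cdot> i) = (m \<cdot> p) \<cdot> i" by (rule assoc[symmetric]) (use assms in simp_all)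
  also have "\<dots> = \<zero>\<^bsub>Dom C i,Cod C m\<^esub>" using assms by (simp del: assoc)
  finally have "p \<cdot> i = \<zero>\<^bsub>Dom C (p \<cdot> i),Dom C m\<^esub>"
    by (rule mono_zero[OF assms(2)]) (use assms in simp_all)
  then have "p \<cdot> i = \<zero>\<^bsub>Dom C i,Cod C p\<^esub>" using assms by simp
  then show ?thesis
  proof (rule kernelI[rotated 3])
    fix x assume x: "x \<in> Ar C" "Cod C x = Cod C i" "p \<cdot> x = \<zero>\<^bsub>Dom C x,Cod C p\<^esub>"
    then have "(m \<cdot> p) \<cdot> x = \<zero>\<^bsub>Dom C x,Cod C (m \<cdot> p)\<^esub>" using assms by simp
    then show "\<exists>u\<in>Ar C. Dom C u = Dom C x \<and> Cod C u = Dom C i \<and> i \<cdot> u = x"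
      using kernel_lift[OF assms(1), of x] x by metis
  qed (use assms in simp_all)
qed

lemma exact_factor:
  assumes "exact_at C f g"
  obtains k e where "is_kernel C k g" "is_epi C e" "Cod C e = Dom C k" "f = k \<cdot> e" "Dom C e = Dom C f"
proof -
  obtain c k where ck: "is_cokernel C c f" "is_kernel C k c" "is_kernel C k g"
    using assms by (auto simp: exact_at_def)
  note [simp] = cokernelD[OF ck(1)] kernelD[OF ck(2)] kernelD[OF ck(3)]
  have cf: "Cod C f = Cod C k" using kernelD(3)[OF ck(2)] cokernelD(3)[OF ck(1)] by simp
  obtain e where e: "e \<in> Ar C" "Dom C e = Dom C f" "Cod C e = Dom C k" "k \<cdot> e = f"
    using kernel_lift[OF ck(2), of f] cf by auto
  \<comment> \<open>Let \<open>l\<close> be the kernel of a \<open>u\<close> with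
    \<open>u \<cdot> e = 0\<close>. Then \<open>f\<close> factors through
    \<open>k \<cdot> l\<close>, so the cokernel \<open>c'\<close> of the latter kills
    \<open>f\<close>, factors through \<open>c\<close> and kills \<open>k\<close>. Hence
    \<open>k\<close> factors through \<open>k \<cdot> l\<close>, which makes \<open>l\<close> split
    epic and \<open>u\<close> zero.\<close>
  have "is_epi C e"
  proof (rule epiI)
    fix u assume u: "u \<in> Ar C" "Dom C u = Cod C e" "u \<cdot> e = \<zero>\<^bsub>Dom C e,Cod C u\<^esub>"
    obtain l where l: "is_kernel C l u" using has_kernel u by blast
    note [simp] = kernelD[OF l]
    have [simp]: "Cod C l = Dom C k" using kernelD(3)[OF l] u e by simp
    obtain e' where e': "e' \<in> Ar C" "Dom C e' = Dom C e" "Cod C e' = Dom C l" "l \<cdot> e' = e"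
      using kernel_lift[OF l, of e] e u by auto
    obtain c' where c': "ses (k \<cdot> l) c'" using mono_ses mono_cmp[of l k] by auto
    note [simp] = sesD[OF c']
    have [simp]: "Dom C c' = Cod C k" using sesD(3)[OF c'] by simp
    have cf0: "c' \<cdot> f = \<zero>\<^bsub>Dom C f,Cod C c'\<^esub>"
    proof -
      have "f = (k \<cdot> l) \<cdot> e'" using e e' by simp
      then have "c' \<cdot> f = c' \<cdot> ((k \<cdot> l) \<cdot> e')" by simp
      also have "\<dots> = (c' \<cdot> (k \<cdot> l)) \<cdot> e'" by (rule assoc[symmetric]) (use e' in simp_all)
      finally show ?thesis using e e' by simp
    qed
    obtain v where v: "v \<in> Ar C" "Cod C v = Cod C c'" "Dom C v = Cod C c" "v \<cdot> c = c'"
      using cokernel_lift[OF ck(1), of c'] cf0 cf by auto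
    have "c' \<cdot> k = (v \<cdot> c) \<cdot> k" using v by simp
    also have "\<dots> = v \<cdot> (c \<cdot> k)" by (rule assoc) (use v cf in simp_all)
    also have "\<dots> = \<zero>\<^bsub>Dom C k,Cod C c'\<^esub>" using v by simp
    finally obtain w where w: "w \<in> Ar C" "Dom C w = Dom C k" "Cod C w = Dom C l" "(k \<cdot> l) \<cdot> w = k"
      using ses_lift[OF c', of k] by auto
    have "l \<cdot> w = Idt C (Dom C k)" by (rule mono_cancel[of k]) (use w in simp_all)
    then have "u = u \<cdot> (l \<cdot> w)" using u e by simp
    also have "\<dots> = (u \<cdot> l) \<cdot> w" by (rule assoc[symmetric]) (use w u e in simp_all)
    also have "\<dots> = \<zero>\<^bsub>Cod C e,Cod C u\<^esub>" using w u e by simp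
    finally show "u = \<zero>\<^bsub>Cod C e,Cod C u\<^esub>" .
  qed (use e in simp)
  then show ?thesis using that ck e by metis
qed

text \<open>Pullback of \<open>f\<close> and \<open>g\<close>: the kernel of \<open>f p - g q\<close> on the biproduct of their domains.\<close>
lemma pullback:
  assumes "f \<in> Ar C" "g \<in> Ar C" "Cod C g = Cod C f"
  obtains a b where "a \<in> Ar C" "b \<in> Ar C" "Dom C b = Dom C a" "Cod C a = Dom C f" "Cod C b = Dom C g"
    "f \<cdot> a = g \<cdot> b"
    "\<And>x y. x \<in> Ar C \<Longrightarrow> y \<in> Ar C \<Longrightarrow> Cod C x = Dom C f \<Longrightarrow> Cod C y = Dom C g \<Longrightarrow> Dom C y = Dom C x \<Longrightarrow>
       f \<cdot> x = g \<cdot> y \<Longrightarrow> \<exists>u\<in>Ar C. Dom C u = Dom C x \<and> Cod C u = Dom C a \<and> a \<cdot> u = x \<and> b \<cdot> u = y"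
    "\<And>x. x \<in> Ar C \<Longrightarrow> Cod C x = Dom C a \<Longrightarrow> a \<cdot> x = \<zero>\<^bsub>Dom C x,Cod C a\<^esub> \<Longrightarrow> b \<cdot> x = \<zero>\<^bsub>Dom C x,Cod C b\<^esub> \<Longrightarrow>
       x = \<zero>\<^bsub>Dom C x,Dom C a\<^esub>"
    "is_epi C f \<Longrightarrow> is_epi C b"
proof -
  obtain P i j p q where ij: "P \<in> Ob C" "i \<in> Hom C (Dom C f) P" "j \<in> Hom C (Dom C g) P"
    "p \<in> Hom C P (Dom C f)" "q \<in> Hom C P (Dom C g)"
    "p \<cdot> i = Idt C (Dom C f)" "q \<cdot> j = Idt C (Dom C g)" "p \<cdot> j = \<zero>\<^bsub>Dom C g,Dom C f\<^esub>" "q \<cdot> i = \<zero>\<^bsub>Dom C f,Dom C g\<^esub>"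
    "i \<cdot> p \<oplus> j \<cdot> q = Idt C P"
    using biproduct[of "Dom C f" "Dom C g"] assms by auto
  note [simp] = assms ij[unfolded Hom_iff]
  define d where "d = f \<cdot> p \<ominus> g \<cdot> q"
  have d [simp]: "d \<in> Ar C" "Dom C d = P" "Cod C d = Cod C f" by (simp_all add: d_def)
  obtain k where k: "is_kernel C k d" using has_kernel d by blast
  note [simp] = kernelD[OF k]
  have [simp]: "Cod C k = P" using kernelD(3)[OF k] by simp
  define a b where "a = p \<cdot> k" and "b = q \<cdot> k"
  have ab: "a \<in> Ar C" "b \<in> Ar C" "Dom C b = Dom C a" "Cod C a = Dom C f" "Cod C b = Dom C g"
    and Da: "Dom C a = Dom C k"
    by (simp_all add: a_def b_def)
  have "d \<cdot> k = \<zero>\<^bsub>Dom C k,Cod C f\<^esub>" by simp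
  then have "f \<cdot> a \<ominus> g \<cdot> b = \<zero>\<^bsub>Dom C k,Cod C f\<^esub>" by (simp add: d_def a_def b_def)
  then have eq: "f \<cdot> a = g \<cdot> b" by (rule sub_eq_zero) (simp_all add: a_def b_def)
  have univ: "\<exists>u\<in>Ar C. Dom C u = Dom C x \<and> Cod C u = Dom C a \<and> a \<cdot> u = x \<and> b \<cdot> u = y"
    if xy: "x \<in> Ar C" "y \<in> Ar C" "Cod C x = Dom C f" "Cod C y = Dom C g" "Dom C y = Dom C x" "f \<cdot> x = g \<cdot> y" for x y
  proof -
    define z where "z = i \<cdot> x \<oplus> j \<cdot> y"
    have z: "z \<in> Ar C" "Dom C z = Dom C x" "Cod C z = P" using xy by (simp_all add: z_def)
    have pz: "p \<cdot> z = x" using xy cmp_reduce[OF ij(6), of x] cmp_reduce[OF ij(8), of y] by (simp add: z_def)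
    have qz: "q \<cdot> z = y" using xy cmp_reduce[OF ij(9), of x] cmp_reduce[OF ij(7), of y] by (simp add: z_def)
    have "d \<cdot> z = \<zero>\<^bsub>Dom C z,Cod C d\<^esub>" using z xy by (simp add: d_def pz qz)
    then obtain u where u: "u \<in> Ar C" "Dom C u = Dom C z" "Cod C u = Dom C k" "k \<cdot> u = z"
      using kernel_lift[OF k, of z] z by auto
    then show ?thesis using z xy pz qz by (intro bexI[of _ u]) (auto simp: a_def b_def)
  qed
  have joint: "x = \<zero>\<^bsub>Dom C x,Dom C a\<^esub>"
    if x: "x \<in> Ar C" "Cod C x = Dom C a" "a \<cdot> x = \<zero>\<^bsub>Dom C x,Cod C a\<^esub>" "b \<cdot> x = \<zero>\<^bsub>Dom C x,Cod C b\<^esub>" for x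
  proof -
    have kx: "Cod C x = Dom C k" "p \<cdot> (k \<cdot> x) = \<zero>\<^bsub>Dom C x,Dom C f\<^esub>" "q \<cdot> (k \<cdot> x) = \<zero>\<^bsub>Dom C x,Dom C g\<^esub>"
      using x by (simp_all add: a_def b_def)
    have "k \<cdot> x = (i \<cdot> p \<oplus> j \<cdot> q) \<cdot> (k \<cdot> x)" using x kx by (subst ij(10)) simp
    also have "\<dots> = i \<cdot> (p \<cdot> (k \<cdot> x)) \<oplus> j \<cdot> (q \<cdot> (k \<cdot> x))" using x kx(1) by (simp del: ij(10))
    also have "\<dots> = \<zero>\<^bsub>Dom C x,Cod C k\<^esub>" using x unfolding kx(2,3) by simp
    finally show ?thesis using mono_zero[of k x] x kx(1) Da by simp
  qed
  \<comment> \<open>If \<open>f\<close> is epic, so is \<open>d\<close>, because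
    \<open>d \<cdot> i = f\<close>; hence \<open>d\<close> is the cokernel of \<open>k\<close>. If
    \<open>u \<cdot> b = 0\<close>, then \<open>u \<cdot> q\<close> vanishes on \<open>k\<close> and
    factors as \<open>v \<cdot> d\<close>. Restricting to \<open>i\<close> gives
    \<open>v \<cdot> f = 0\<close>, so \<open>v\<close>, then \<open>u \<cdot> q\<close> and finally
    \<open>u\<close> vanish.\<close>
  have epi: "is_epi C b" if f: "is_epi C f"
  proof (rule epiI)
    fix u assume u: "u \<in> Ar C" "Dom C u = Cod C b" "u \<cdot> b = \<zero>\<^bsub>Dom C b,Cod C u\<^esub>"
    have du: "Dom C u = Dom C g" using u ab by simp
    have "is_epi C d"
    proof (rule epiI)
      fix x assume x: "x \<in> Ar C" "Dom C x = Cod C d" "x \<cdot> d = \<zero>\<^bsub>Dom C d,Cod C x\<^esub>"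
      have "d \<cdot> i = f" using cmp_reduce[OF ij(6)] by (simp add: d_def)
      then have "x \<cdot> f = x \<cdot> (d \<cdot> i)" by simp
      also have "\<dots> = (x \<cdot> d) \<cdot> i" by (rule assoc[symmetric]) (use x in simp_all)
      also have "\<dots> = \<zero>\<^bsub>Dom C f,Cod C x\<^esub>" using x by simp
      finally show "x = \<zero>\<^bsub>Cod C d,Cod C x\<^esub>" using epi_zero[OF f, of x] x by simp
    qed simp
    then have "ses k d" using ses_kernelI k by blast
    moreover have "(u \<cdot> q) \<cdot> k = \<zero>\<^bsub>Dom C k,Cod C u\<^esub>" using u du by (simp add: b_def)
    ultimately obtain v where v: "v \<in> Ar C" "Cod C v = Cod C u" "Dom C v = Cod C d" "v \<cdot> d = u \<cdot> q"
      using ses_colift[of k d "u \<cdot> q"] u du by auto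
    have "d \<cdot> i = f" using cmp_reduce[OF ij(6)] by (simp add: d_def)
    then have "v \<cdot> f = v \<cdot> (d \<cdot> i)" by simp
    also have "\<dots> = (v \<cdot> d) \<cdot> i" by (rule assoc[symmetric]) (use v in simp_all)
    also have "\<dots> = (u \<cdot> q) \<cdot> i" using v by simp
    also have "\<dots> = \<zero>\<^bsub>Dom C f,Cod C u\<^esub>" using u du by simp
    finally have "v = \<zero>\<^bsub>Cod C f,Cod C v\<^esub>" using epi_zero[OF f, of v] v by simp
    then have "u \<cdot> q = \<zero>\<^bsub>P,Cod C u\<^esub>" using v u by (metis d zero_cmp ends_in_Ob(2))
    then have "(u \<cdot> q) \<cdot> j = \<zero>\<^bsub>Dom C g,Cod C u\<^esub>" using u by simp
    then show "u = \<zero>\<^bsub>Cod C b,Cod C u\<^esub>" using u du ab by simp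
  qed (use ab in simp)
  show ?thesis using that[of a b] ab eq univ joint epi by blast
qed

text \<open>The substitute for choosing a preimage of \<open>x\<close> under \<open>g\<close>: the
  pullback of \<open>g\<close> along \<open>x\<close> is an epimorphism \<open>e\<close>, over which
  a lift exists. The diagram chases below work with such covers.\<close>

lemma lift_cover:
  assumes "is_epi C g" "x \<in> Ar C" "Cod C x = Cod C g"
  obtains e y where "is_epi C e" "y \<in> Ar C" "Cod C e = Dom C x" "Cod C y = Dom C g" "Dom C y = Dom C e"
    "g \<cdot> y = x \<cdot> e"
proof -
  obtain a b where "a \<in> Ar C" "b \<in> Ar C" "Dom C b = Dom C a" "Cod C a = Dom C g" "Cod C b = Dom C x"
    "g \<cdot> a = x \<cdot> b" "is_epi C b"
    by (rule pullback[of g x]) (use assms in auto)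
  then show ?thesis using that[of b a] by simp
qed

text \<open>If \<open>x \<cdot> e = i \<cdot> y\<close> with \<open>e\<close> epic, the cokernel of
  \<open>i\<close> kills \<open>x \<cdot> e\<close>, hence \<open>x\<close>, and so \<open>x\<close>
  factors through \<open>i\<close>. Exactness in the middle may thus be checked after a
  cover.\<close>

lemma sesI:
  assumes "is_mono C i" "is_epi C p" "Dom C p = Cod C i" "p \<cdot> i = \<zero>\<^bsub>Dom C i,Cod C p\<^esub>"
    and ex: "\<And>x. x \<in> Ar C \<Longrightarrow> Cod C x = Cod C i \<Longrightarrow> p \<cdot> x = \<zero>\<^bsub>Dom C x,Cod C p\<^esub> \<Longrightarrow>
       \<exists>e y. is_epi C e \<and> y \<in> Ar C \<and> Cod C e = Dom C x \<and> Dom C y = Dom C e \<and> Cod C y = Dom C i \<and> x \<cdot> e = i \<cdot> y"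
  shows "ses i p"
proof (rule ses_kernelI[OF kernelI])
  fix x assume x: "x \<in> Ar C" "Cod C x = Cod C i" "p \<cdot> x = \<zero>\<^bsub>Dom C x,Cod C p\<^esub>"
  then obtain e y where e: "is_epi C e" "y \<in> Ar C" "Cod C e = Dom C x" "Dom C y = Dom C e" "Cod C y = Dom C i" "x \<cdot> e = i \<cdot> y"
    using ex by blast
  obtain c where c: "ses i c" using mono_ses assms by blast
  note [simp] = sesD[OF c]
  have "(c \<cdot> x) \<cdot> e = c \<cdot> (i \<cdot> y)" using e x by simp
  also have "\<dots> = \<zero>\<^bsub>Dom C e,Cod C c\<^esub>" using e cmp_reduce[OF sesD(4)[OF c], of y] by simp
  finally have "c \<cdot> x = \<zero>\<^bsub>Dom C x,Cod C c\<^esub>" using epi_zero[OF e(1), of "c \<cdot> x"] x e by simp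
  then show "\<exists>u\<in>Ar C. Dom C u = Dom C x \<and> Cod C u = Dom C i \<and> i \<cdot> u = x"
    using ses_lift[OF c, of x] x by metis
qed (use assms in auto)

lemma biproduct_ses:
  assumes "A \<in> Ob C" "B \<in> Ob C"
  obtains i p j q where "ses i q" "ses j p" "Dom C i = A" "Dom C j = B" "Cod C j = Cod C i"
    "Cod C q = B" "Cod C p = A" "p \<cdot> i = Idt C A" "q \<cdot> j = Idt C B" "i \<cdot> p \<oplus> j \<cdot> q = Idt C (Cod C i)"
proof -
  have gen: "ses i q"
    if "i \<in> Hom C A P" "j \<in> Hom C B P" "p \<in> Hom C P A" "q \<in> Hom C P B" "p \<cdot> i = Idt C A" "q \<cdot> j = Idt C B"
      "q \<cdot> i = \<zero>\<^bsub>A,B\<^esub>" "i \<cdot> p \<oplus> j \<cdot> q = Idt C P" "A \<in> Ob C" "B \<in> Ob C" for A B P i j p q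
  proof (rule ses_kernelI[OF kernelI])
    note [simp] = that[unfolded Hom_iff]
    show "is_mono C i" by (rule mono_factor[of p]) (use Idt_mono in auto)
    show "is_epi C q" by (rule epi_factor[of _ j]) (use Idt_epi in auto)
    fix x assume x: "x \<in> Ar C" "Cod C x = Cod C i" "q \<cdot> x = \<zero>\<^bsub>Dom C x,Cod C q\<^esub>"
    have "x = (i \<cdot> p \<oplus> j \<cdot> q) \<cdot> x" using x by simp
    also have "\<dots> = i \<cdot> (p \<cdot> x)" using x by (simp del: that(8))
    finally show "\<exists>u\<in>Ar C. Dom C u = Dom C x \<and> Cod C u = Dom C i \<and> i \<cdot> u = x"
      using x by (intro bexI[of _ "p \<cdot> x"]) auto
  qed (use that in \<open>auto simp: Hom_iff\<close>)
  obtain P i j p q where P: "P \<in> Ob C" "i \<in> Hom C A P" "j \<in> Hom C B P" "p \<in> Hom C P A" "q \<in> Hom C P B"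
    "p \<cdot> i = Idt C A" "q \<cdot> j = Idt C B" "p \<cdot> j = \<zero>\<^bsub>B,A\<^esub>" "q \<cdot> i = \<zero>\<^bsub>A,B\<^esub>" "i \<cdot> p \<oplus> j \<cdot> q = Idt C P"
    using biproduct[OF assms] by auto
  note [simp] = P(1) P(2-)[unfolded Hom_iff]
  have "j \<cdot> q \<oplus> i \<cdot> p = Idt C P" using plus_comm[of "j \<cdot> q" "i \<cdot> p"] by simp
  then have "ses i q" "ses j p"
    using gen[of i A P j B p q] gen[of j B P i A q p] P assms by auto
  then show ?thesis using that[of i q j p] by simp
qed


section \<open>Pullbacks and pushouts of short exact sequences\<close>

lemma ses_pullback:
  assumes ses: "ses i p" and q: "q \<in> Ar C" "Cod C q = Cod C p"
  obtains i' p' q' where "ses i' p'" "Dom C i' = Dom C i" "Cod C p' = Dom C q"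
    "q' \<in> Ar C" "Dom C q' = Cod C i'" "Cod C q' = Cod C i" "q' \<cdot> i' = i" "p \<cdot> q' = q \<cdot> p'"
    "\<And>x y. x \<in> Ar C \<Longrightarrow> y \<in> Ar C \<Longrightarrow> Cod C x = Cod C i \<Longrightarrow> Cod C y = Dom C q \<Longrightarrow> Dom C y = Dom C x \<Longrightarrow>
       p \<cdot> x = q \<cdot> y \<Longrightarrow> \<exists>u\<in>Ar C. Dom C u = Dom C x \<and> Cod C u = Cod C i' \<and> q' \<cdot> u = x \<and> p' \<cdot> u = y"
    "\<And>x y. x \<in> Ar C \<Longrightarrow> y \<in> Ar C \<Longrightarrow> Cod C x = Cod C i' \<Longrightarrow> Cod C y = Cod C i' \<Longrightarrow>
       q' \<cdot> x = q' \<cdot> y \<Longrightarrow> p' \<cdot> x = p' \<cdot> y \<Longrightarrow> x = y"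
proof -
  note [simp] = sesD[OF ses] q
  obtain a b where ab: "a \<in> Ar C" "b \<in> Ar C" "Dom C b = Dom C a" "Cod C a = Cod C i" "Cod C b = Dom C q"
    and eq: "p \<cdot> a = q \<cdot> b"
    and univ: "\<And>x y. x \<in> Ar C \<Longrightarrow> y \<in> Ar C \<Longrightarrow> Cod C x = Cod C i \<Longrightarrow> Cod C y = Dom C q \<Longrightarrow> Dom C y = Dom C x \<Longrightarrow>
       p \<cdot> x = q \<cdot> y \<Longrightarrow> \<exists>u\<in>Ar C. Dom C u = Dom C x \<and> Cod C u = Dom C a \<and> a \<cdot> u = x \<and> b \<cdot> u = y"
    and joint: "\<And>x. x \<in> Ar C \<Longrightarrow> Cod C x = Dom C a \<Longrightarrow> a \<cdot> x = \<zero>\<^bsub>Dom C x,Cod C a\<^esub> \<Longrightarrow> b \<cdot> x = \<zero>\<^bsub>Dom C x,Cod C b\<^esub> \<Longrightarrow>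
       x = \<zero>\<^bsub>Dom C x,Dom C a\<^esub>"
    and epi: "is_epi C b"
    by (rule pullback[of p q]) auto
  note [simp] = ab
  have joint': "x = y" if "x \<in> Ar C" "y \<in> Ar C" "Cod C x = Dom C a" "Cod C y = Dom C a"
       "a \<cdot> x = a \<cdot> y" "b \<cdot> x = b \<cdot> y" for x y
  proof -
    have d: "Dom C x = Dom C y" using that cmp_Ar(2)[of x a] cmp_Ar(2)[of y a] by simp
    have "x \<ominus> y = \<zero>\<^bsub>Dom C (x \<ominus> y),Dom C a\<^esub>" by (rule joint) (use that d in simp_all)
    then show ?thesis using sub_eq_zero[of x y] that d by simp
  qed
  \<comment> \<open>The pair of \<open>i\<close> and zero is compatible because
    \<open>p \<cdot> i = 0\<close>. The map it induces is the kernel of \<open>b\<close>, so pulling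
    back does not change the kernel object.\<close>
  obtain j where j: "j \<in> Ar C" "Dom C j = Dom C i" "Cod C j = Dom C a" "a \<cdot> j = i" "b \<cdot> j = \<zero>\<^bsub>Dom C i,Dom C q\<^esub>"
    using univ[of i "\<zero>\<^bsub>Dom C i,Dom C q\<^esub>"] by auto
  have "ses j b"
  proof (rule ses_kernelI[OF kernelI])
    show "is_mono C j" by (rule mono_factor[of a]) (use j in simp_all)
    fix x assume x: "x \<in> Ar C" "Cod C x = Cod C j" "b \<cdot> x = \<zero>\<^bsub>Dom C x,Cod C b\<^esub>"
    have "p \<cdot> (a \<cdot> x) = q \<cdot> (b \<cdot> x)" using cmp_reduce2[OF eq, of x] x j by simp
    also have "\<dots> = \<zero>\<^bsub>Dom C x,Cod C p\<^esub>" using x by simp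
    finally obtain y where y: "y \<in> Ar C" "Dom C y = Dom C x" "Cod C y = Dom C i" "i \<cdot> y = a \<cdot> x"
      using ses_lift[OF ses, of "a \<cdot> x"] x j by auto
    have "j \<cdot> y = x"
      by (rule joint') (use x y j cmp_reduce[OF j(4), of y] cmp_reduce[OF j(5), of y] in simp_all)
    then show "\<exists>u\<in>Ar C. Dom C u = Dom C x \<and> Cod C u = Dom C j \<and> j \<cdot> u = x" using y j by auto
  qed (use j epi in simp_all)
  then show ?thesis
    using that[of j b a] j eq univ joint' by auto
qed

lemma ses_pushout:
  assumes ses: "ses i p" and g: "g \<in> Ar C" "Dom C g = Dom C i"
  obtains i' p' m where "ses i' p'" "Cod C p' = Cod C p" "Dom C i' = Cod C g"
    "m \<in> Ar C" "Cod C m = Cod C i'" "Dom C m = Cod C i" "p' \<cdot> m = p" "m \<cdot> i = i' \<cdot> g"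
    "\<And>x y. x \<in> Ar C \<Longrightarrow> y \<in> Ar C \<Longrightarrow> Dom C x = Cod C i \<Longrightarrow> Dom C y = Cod C g \<Longrightarrow> Cod C y = Cod C x \<Longrightarrow>
       x \<cdot> i = y \<cdot> g \<Longrightarrow> \<exists>u\<in>Ar C. Cod C u = Cod C x \<and> Dom C u = Cod C i' \<and> u \<cdot> m = x \<and> u \<cdot> i' = y"
    "\<And>x y. x \<in> Ar C \<Longrightarrow> y \<in> Ar C \<Longrightarrow> Dom C x = Cod C i' \<Longrightarrow> Dom C y = Cod C i' \<Longrightarrow>
       x \<cdot> m = y \<cdot> m \<Longrightarrow> x \<cdot> i' = y \<cdot> i' \<Longrightarrow> x = y"
proof -
  note s = sesD[OF ses]
  obtain p' i' m where r: "short_exact (opp C) p' i'" "Dom (opp C) p' = Dom (opp C) p" "Cod (opp C) i' = Dom (opp C) g"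
    "m \<in> Ar (opp C)" "Dom (opp C) m = Cod (opp C) p'" "Cod (opp C) m = Cod (opp C) p"
    "m \<cdot>\<^bsub>opp C\<^esub> p' = p" "i \<cdot>\<^bsub>opp C\<^esub> m = g \<cdot>\<^bsub>opp C\<^esub> i'"
    and u: "\<And>x y. x \<in> Ar (opp C) \<Longrightarrow> y \<in> Ar (opp C) \<Longrightarrow> Cod (opp C) x = Cod (opp C) p \<Longrightarrow> Cod (opp C) y = Dom (opp C) g \<Longrightarrow>
       Dom (opp C) y = Dom (opp C) x \<Longrightarrow> i \<cdot>\<^bsub>opp C\<^esub> x = g \<cdot>\<^bsub>opp C\<^esub> y \<Longrightarrow>
       \<exists>u\<in>Ar (opp C). Dom (opp C) u = Dom (opp C) x \<and> Cod (opp C) u = Cod (opp C) p' \<and> m \<cdot>\<^bsub>opp C\<^esub> u = x \<and> i' \<cdot>\<^bsub>opp C\<^esub> u = y"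
    and j: "\<And>x y. x \<in> Ar (opp C) \<Longrightarrow> y \<in> Ar (opp C) \<Longrightarrow> Cod (opp C) x = Cod (opp C) p' \<Longrightarrow> Cod (opp C) y = Cod (opp C) p' \<Longrightarrow>
       m \<cdot>\<^bsub>opp C\<^esub> x = m \<cdot>\<^bsub>opp C\<^esub> y \<Longrightarrow> i' \<cdot>\<^bsub>opp C\<^esub> x = i' \<cdot>\<^bsub>opp C\<^esub> y \<Longrightarrow> x = y"
    by (rule abelian_category.ses_pullback[OF dual, of p i g]) (use ses g in auto)
  have s': "ses i' p'" using r(1) by simp
  note s'' = sesD[OF s']
  show ?thesis
  proof (rule that[of i' p' m])
    show "\<exists>u\<in>Ar C. Cod C u = Cod C x \<and> Dom C u = Cod C i' \<and> u \<cdot> m = x \<and> u \<cdot> i' = y"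
      if "x \<in> Ar C" "y \<in> Ar C" "Dom C x = Cod C i" "Dom C y = Cod C g" "Cod C y = Cod C x" "x \<cdot> i = y \<cdot> g" for x y
      using u[of x y] that s s'' by simp
    show "x = y" if "x \<in> Ar C" "y \<in> Ar C" "Dom C x = Cod C i'" "Dom C y = Cod C i'"
       "x \<cdot> m = y \<cdot> m" "x \<cdot> i' = y \<cdot> i'" for x y
      by (rule j) (use that s s'' in simp_all)
  qed (use r s s'' s' in simp_all)
qed

text \<open>The kernel of the composite \<open>p \<cdot> g\<close> of two epimorphisms is the
  preimage under \<open>g\<close> of the kernel of \<open>p\<close>, hence an extension of that
  kernel by the kernel of \<open>g\<close>. The pair \<open>k'\<close>, \<open>h\<close> is this
  extension.\<close>

lemma ses_pullback_mono:
  assumes kg: "ses k g" and ip: "ses i p" and ends: "Cod C i = Cod C g"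
  obtains k' h m where "ses k' h" "Dom C k' = Dom C k" "Cod C h = Dom C i"
    "ses m (p \<cdot> g)" "Dom C m = Cod C k'" "Cod C m = Cod C k" "m \<cdot> k' = k" "g \<cdot> m = i \<cdot> h"
proof -
  note [simp] = sesD[OF kg] sesD[OF ip] ends
  obtain k' h m where r: "ses k' h" "Dom C k' = Dom C k" "Cod C h = Dom C i"
    "m \<in> Ar C" "Dom C m = Cod C k'" "Cod C m = Cod C k" "m \<cdot> k' = k" "g \<cdot> m = i \<cdot> h"
    and u: "\<And>x y. x \<in> Ar C \<Longrightarrow> y \<in> Ar C \<Longrightarrow> Cod C x = Cod C k \<Longrightarrow> Cod C y = Dom C i \<Longrightarrow> Dom C y = Dom C x \<Longrightarrow>
       g \<cdot> x = i \<cdot> y \<Longrightarrow> \<exists>u\<in>Ar C. Dom C u = Dom C x \<and> Cod C u = Cod C k' \<and> m \<cdot> u = x \<and> h \<cdot> u = y"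
    and j: "\<And>x y. x \<in> Ar C \<Longrightarrow> y \<in> Ar C \<Longrightarrow> Cod C x = Cod C k' \<Longrightarrow> Cod C y = Cod C k' \<Longrightarrow>
       m \<cdot> x = m \<cdot> y \<Longrightarrow> h \<cdot> x = h \<cdot> y \<Longrightarrow> x = y"
    by (rule ses_pullback[OF kg, of i]) auto
  note [simp] = sesD[OF r(1)] r(2-6)
  have "ses m (p \<cdot> g)"
  proof (rule ses_kernelI[OF kernelI])
    show "is_mono C m"
    proof (rule monoI)
      fix x assume x: "x \<in> Ar C" "Cod C x = Dom C m" "m \<cdot> x = \<zero>\<^bsub>Dom C x,Cod C m\<^esub>"
      have "i \<cdot> (h \<cdot> x) = g \<cdot> (m \<cdot> x)" using cmp_reduce2[OF r(8), of x] x by simp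
      also have "\<dots> = \<zero>\<^bsub>Dom C x,Cod C i\<^esub>" using x by simp
      finally have "h \<cdot> x = \<zero>\<^bsub>Dom C (h \<cdot> x),Dom C i\<^esub>" by (rule mono_zero[rotated]) (use x in simp_all)
      then show "x = \<zero>\<^bsub>Dom C x,Dom C m\<^esub>" by (rule_tac j) (use x in simp_all)
    qed simp
    show "is_epi C (p \<cdot> g)" by (rule epi_cmp) simp_all
    show "(p \<cdot> g) \<cdot> m = \<zero>\<^bsub>Dom C m,Cod C (p \<cdot> g)\<^esub>"
      using cmp_reduce[OF sesD(4)[OF ip], of h] r(8) by simp
    fix x assume x: "x \<in> Ar C" "Cod C x = Cod C m" "(p \<cdot> g) \<cdot> x = \<zero>\<^bsub>Dom C x,Cod C (p \<cdot> g)\<^esub>"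
    then obtain y where y: "y \<in> Ar C" "Dom C y = Dom C x" "Cod C y = Dom C i" "i \<cdot> y = g \<cdot> x"
      using ses_lift[OF ip, of "g \<cdot> x"] by auto
    then show "\<exists>u\<in>Ar C. Dom C u = Dom C x \<and> Cod C u = Dom C m \<and> m \<cdot> u = x"
      using u[of x y] x by auto
  qed simp_all
  then show ?thesis using that[of k' h m] r by auto
qed

text \<open>The difference of the identity and \<open>s \<cdot> p\<close> is killed by
  \<open>p\<close>, so it equals \<open>i \<cdot> r\<close>; composing with \<open>i\<close> and
  cancelling \<open>i\<close> shows that \<open>r\<close> is a retraction.\<close>

lemma section_retraction:
  assumes ses: "ses i p"
    and s: "s \<in> Ar C" "Dom C s = Cod C p" "Cod C s = Cod C i" "p \<cdot> s = Idt C (Cod C p)"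
  shows "\<exists>r\<in>Ar C. Dom C r = Cod C i \<and> Cod C r = Dom C i \<and> r \<cdot> i = Idt C (Dom C i)"
proof -
  note [simp] = sesD[OF ses] s(1,2,3)
  have "p \<cdot> Idt C (Cod C i) = p \<cdot> (s \<cdot> p)" using cmp_reduce[OF s(4), of p] by simp
  then obtain r where r: "r \<in> Ar C" "Dom C r = Cod C i" "Cod C r = Dom C i" "Idt C (Cod C i) = s \<cdot> p \<oplus> i \<cdot> r"
    using ses_diff[OF ses, of "Idt C (Cod C i)" "s \<cdot> p"] by auto
  have "i \<cdot> (r \<cdot> i) = (s \<cdot> p \<oplus> i \<cdot> r) \<cdot> i" using r(1,2,3) by simp
  also have "\<dots> = i \<cdot> Idt C (Dom C i)" unfolding r(4)[symmetric] by simp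
  finally have "r \<cdot> i = Idt C (Dom C i)" by (rule mono_cancel[rotated]) (use r(1,2,3) in simp_all)
  then show ?thesis using r by blast
qed

lemma splits_iff:
  assumes "ses i p"
  shows "(\<exists>s\<in>Ar C. Dom C s = Cod C p \<and> Cod C s = Cod C i \<and> p \<cdot> s = Idt C (Cod C p)) \<longleftrightarrow>
    (\<exists>r\<in>Ar C. Dom C r = Cod C i \<and> Cod C r = Dom C i \<and> r \<cdot> i = Idt C (Dom C i))"
  using section_retraction[OF assms] abelian_category.section_retraction[OF dual, of p i] assms sesD(3)[OF assms]
  by (auto simp del: assoc)

end

text \<open>The form in which vanishing of the first Ext is used: extensions of \<open>X\<close> by
  \<open>Y\<close> split. \<open>Ext_vanishes_1\<close> identifies it with the quotient of Yoneda
  extensions being a singleton.\<close>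

definition Ext1_zero :: "('o, 'm) additive_cat \<Rightarrow> 'o \<Rightarrow> 'o \<Rightarrow> bool" where
  "Ext1_zero C X Y \<longleftrightarrow> (\<forall>i p. short_exact C i p \<longrightarrow> Dom C i = Y \<longrightarrow> Cod C p = X \<longrightarrow>
     (\<exists>s\<in>Ar C. Dom C s = X \<and> Cod C s = Cod C i \<and> p \<cdot>\<^bsub>C\<^esub> s = Idt C X))"

context abelian_category
begin

lemma Ext1_zero_retraction:
  "Ext1_zero C X Y \<longleftrightarrow> (\<forall>i p. ses i p \<longrightarrow> Dom C i = Y \<longrightarrow> Cod C p = X \<longrightarrow>
     (\<exists>r\<in>Ar C. Dom C r = Cod C i \<and> Cod C r = Y \<and> r \<cdot> i = Idt C Y))"
proof -
  have eq: "(\<exists>s\<in>Ar C. Dom C s = X \<and> Cod C s = Cod C i \<and> p \<cdot> s = Idt C X) \<longleftrightarrow>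
    (\<exists>r\<in>Ar C. Dom C r = Cod C i \<and> Cod C r = Y \<and> r \<cdot> i = Idt C Y)"
    if "ses i p" "Dom C i = Y" "Cod C p = X" for i p
    using splits_iff[OF that(1)] unfolding that(2,3) .
  show ?thesis unfolding Ext1_zero_def
  proof (intro iffI allI impI, goal_cases)
    case (1 i p)
    then show ?case using eq[of i p] by simp
  next
    case (2 i p)
    then show ?case using eq[of i p] by simp
  qed
qed

lemma Ext1_zero_opp: "Ext1_zero (opp C) Y X = Ext1_zero C X Y"
proof -
  have eq: "(\<exists>s\<in>Ar C. Cod C s = Y \<and> Dom C s = Dom C p \<and> s \<cdot> i = Idt C Y) \<longleftrightarrow>
    (\<exists>r\<in>Ar C. Dom C r = Cod C i \<and> Cod C r = Y \<and> r \<cdot> i = Idt C Y)"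
    if "ses i p" for i p
    using sesD(3)[OF that] by auto
  show ?thesis unfolding Ext1_zero_retraction unfolding Ext1_zero_def opp_simps opp_derived
  proof (intro iffI allI impI, goal_cases)
    case (1 i p)
    then show ?case using eq[of i p] by simp
  next
    case (2 p i)
    then show ?case using eq[of i p] by simp
  qed
qed

text \<open>Pulling the sequence back along \<open>f\<close> gives an extension of \<open>X\<close>
  by \<open>Y\<close>; a section of it, followed by the projection \<open>m\<close>, is the
  lift.\<close>

lemma Ext1_zero_lift:
  assumes "Ext1_zero C X Y" "ses k g" "Dom C k = Y" "f \<in> Ar C" "Dom C f = X" "Cod C f = Cod C g"
  obtains u where "u \<in> Ar C" "Dom C u = X" "Cod C u = Cod C k" "g \<cdot> u = f"
proof -
  note [simp] = sesD[OF assms(2)] assms(4-)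
  obtain k' h m where r: "ses k' h" "Dom C k' = Dom C k" "Cod C h = X"
    "m \<in> Ar C" "Dom C m = Cod C k'" "Cod C m = Cod C k" "m \<cdot> k' = k" "g \<cdot> m = f \<cdot> h"
    by (rule ses_pullback[OF assms(2), of f]) auto
  note [simp] = sesD[OF r(1)] r(2-6)
  obtain s where s: "s \<in> Ar C" "Dom C s = X" "Cod C s = Cod C k'" "h \<cdot> s = Idt C X"
    using assms(1) r(1-3) assms(3) unfolding Ext1_zero_def by metis
  have "g \<cdot> (m \<cdot> s) = f" using s cmp_reduce2[OF r(8), of s] by simp
  then show ?thesis using that[of "m \<cdot> s"] s by simp
qed

lemma Ext1_zero_extend:
  assumes "Ext1_zero C X Y" "ses j c" "Cod C c = X" "f \<in> Ar C" "Cod C f = Y" "Dom C f = Dom C j"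
  obtains u where "u \<in> Ar C" "Cod C u = Y" "Dom C u = Cod C j" "u \<cdot> j = f"
  using abelian_category.Ext1_zero_lift[OF dual, of Y X c j f] assms Ext1_zero_opp sesD[OF assms(2)]
  by (metis opp_derived(7) opp_simps(2,3,4,6))

text \<open>This is a piece of the long exact sequence done by hand. An extension of
  \<open>Cod C i\<close> by \<open>Y\<close> restricts along \<open>i\<close> to an extension of
  \<open>X\<close> by \<open>Y\<close>, which has a retraction \<open>r1\<close>. The quotient of
  the whole extension by its restriction is \<open>Z\<close>, so \<open>r1\<close> extends.\<close>

lemma Ext1_zero_extension:
  assumes "Ext1_zero C X Y" "Ext1_zero C Z Y" "ses i p" "Dom C i = X" "Cod C p = Z"
  shows "Ext1_zero C (Cod C i) Y"
  unfolding Ext1_zero_retraction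
proof (intro allI impI)
  fix k g assume kg: "ses k g" "Dom C k = Y" "Cod C g = Cod C i"
  obtain k' h m where r: "ses k' h" "Dom C k' = Dom C k" "Cod C h = Dom C i"
    "ses m (p \<cdot> g)" "Dom C m = Cod C k'" "Cod C m = Cod C k" "m \<cdot> k' = k" "g \<cdot> m = i \<cdot> h"
    by (rule ses_pullback_mono[OF kg(1) assms(3)]) (use kg in auto)
  note [simp] = sesD[OF r(1)] sesD[OF r(4)] sesD[OF kg(1)] sesD[OF assms(3)]
  obtain r1 where r1: "r1 \<in> Ar C" "Dom C r1 = Cod C k'" "Cod C r1 = Y" "r1 \<cdot> k' = Idt C Y"
    using assms(1) r(1-3) kg assms(4) unfolding Ext1_zero_retraction by metis
  obtain r2 where r2: "r2 \<in> Ar C" "Cod C r2 = Y" "Dom C r2 = Cod C m" "r2 \<cdot> m = r1"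
    by (rule Ext1_zero_extend[OF assms(2) r(4), of r1]) (use assms kg r r1 in auto)
  have "r2 \<cdot> k = r2 \<cdot> (m \<cdot> k')" using r by simp
  also have "\<dots> = Idt C Y" using cmp_reduce[OF r2(4), of k'] r r1 r2 by simp
  finally show "\<exists>r\<in>Ar C. Dom C r = Cod C k \<and> Cod C r = Y \<and> r \<cdot> k = Idt C Y" using r2 r by auto
qed

section \<open>Vanishing of Yoneda Ext in degrees one and two\<close>

lemma cokernel_cmp_epi:
  assumes c: "ses k c" and e: "is_epi C e" "Cod C e = Dom C k"
  shows "is_cokernel C c (k \<cdot> e)"
proof -
  note [simp] = sesD[OF c] e
  have "is_kernel (opp C) c (k \<cdot> e)"
  proof (rule abelian_category.kernelI[OF dual], goal_cases)
    case 4
    then show ?case using cmp_reduce[OF sesD(4)[OF c], of e] by simp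
  next
    case (5 x)
    then have x: "x \<in> Ar C" "Dom C x = Cod C k" "x \<cdot> (k \<cdot> e) = \<zero>\<^bsub>Dom C e,Cod C x\<^esub>" by simp_all
    have "(x \<cdot> k) \<cdot> e = \<zero>\<^bsub>Dom C e,Cod C x\<^esub>" using x by simp
    then have "x \<cdot> k = \<zero>\<^bsub>Cod C e,Cod C (x \<cdot> k)\<^esub>" by (rule epi_zero[OF e(1)]) (use x in simp_all)
    then have "x \<cdot> k = \<zero>\<^bsub>Dom C k,Cod C x\<^esub>" using x by simp
    then obtain u where "u \<in> Ar C" "Cod C u = Cod C x" "Dom C u = Cod C c" "u \<cdot> c = x"
      using ses_colift[OF c, of x] x by auto
    then show ?case by auto
  qed simp_all
  then show ?thesis by simp
qed

lemma exact_atI: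
  assumes "is_kernel C k g" "is_epi C e" "Cod C e = Dom C k"
  shows "exact_at C (k \<cdot> e) g"
proof -
  obtain c where c: "ses k c" using mono_ses[OF kernelD(5)[OF assms(1)]] by blast
  have "Cod C (k \<cdot> e) = Cod C k" using kernelD(1)[OF assms(1)] assms(2,3) by simp
  then show ?thesis
    using cokernel_cmp_epi[OF c assms(2,3)] assms(1) c kernelD(3)[OF assms(1)]
    unfolding exact_at_def short_exact_def by auto
qed

lemma exact_atD:
  assumes "exact_at C f g"
  shows "f \<in> Ar C" "g \<in> Ar C" "Dom C g = Cod C f" "g \<cdot> f = \<zero>\<^bsub>Dom C f,Cod C g\<^esub>"
proof -
  obtain k e where ke: "is_kernel C k g" "is_epi C e" "Cod C e = Dom C k" "f = k \<cdot> e"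
    using exact_factor[OF assms] by metis
  note [simp] = kernelD[OF ke(1)] ke(2,3,4)
  show "f \<in> Ar C" "g \<in> Ar C" "Dom C g = Cod C f" by simp_all
  show "g \<cdot> f = \<zero>\<^bsub>Dom C f,Cod C g\<^esub>" using cmp_reduce[OF kernelD(4)[OF ke(1)], of e] by simp
qed

text \<open>Since \<open>f\<close> is an epimorphism onto the kernel of \<open>g\<close>, a
  generalised element of that kernel comes from the domain of \<open>f\<close> after passing to a
  cover. Chases use exactness in this form.\<close>

lemma exact_cover:
  assumes "exact_at C f g" "x \<in> Ar C" "Cod C x = Cod C f" "g \<cdot> x = \<zero>\<^bsub>Dom C x,Cod C g\<^esub>"
  obtains e y where "is_epi C e" "y \<in> Ar C" "Cod C e = Dom C x" "Dom C y = Dom C e" "Cod C y = Dom C f" "x \<cdot> e = f \<cdot> y"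
proof -
  obtain k e where ke: "is_kernel C k g" "is_epi C e" "Cod C e = Dom C k" "f = k \<cdot> e"
    using exact_factor[OF assms(1)] by metis
  note [simp] = kernelD[OF ke(1)] ke(2,3,4)
  obtain u where u: "u \<in> Ar C" "Dom C u = Dom C x" "Cod C u = Dom C k" "k \<cdot> u = x"
    by (rule kernel_lift[OF ke(1), of x]) (use assms in auto)
  obtain e' y where y: "is_epi C e'" "y \<in> Ar C" "Cod C e' = Dom C u" "Cod C y = Dom C e" "Dom C y = Dom C e'" "e \<cdot> y = u \<cdot> e'"
    by (rule lift_cover[OF ke(2), of u]) (use u in auto)
  have "x \<cdot> e' = k \<cdot> (u \<cdot> e')" using cmp_reduce[OF u(4), of e'] u y by simp
  also have "\<dots> = f \<cdot> y" using y by simp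
  finally show ?thesis using that[of e' y] y u by simp
qed

text \<open>If \<open>f = k \<cdot> e\<close> is monic, then \<open>e\<close> is monic and epic. Its
  cokernel is zero, so the identity factors through \<open>e\<close> by some \<open>v\<close>, and
  lifts along \<open>k\<close> become lifts along \<open>f\<close>.\<close>

lemma exact_mono_kernel:
  assumes "exact_at C f g" "is_mono C f"
  shows "is_kernel C f g"
proof -
  obtain k e where ke: "is_kernel C k g" "is_epi C e" "Cod C e = Dom C k" "f = k \<cdot> e"
    using exact_factor[OF assms(1)] by metis
  note k = kernelD[OF ke(1)]
  note [simp] = k(1,2) ke(2,3)
  have "is_mono C e" by (rule mono_factor[of k]) (use assms(2) ke in simp_all)
  then obtain c where c: "ses e c" using mono_ses by blast
  note [simp] = sesD[OF c]
  have "c = \<zero>\<^bsub>Cod C e,Cod C c\<^esub>" by (rule epi_zero[OF ke(2)]) simp_all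
  then have "c \<cdot> Idt C (Cod C e) = \<zero>\<^bsub>Cod C e,Cod C c\<^esub>" by simp
  then obtain v where v: "v \<in> Ar C" "Dom C v = Dom C k" "Cod C v = Dom C e" "e \<cdot> v = Idt C (Dom C k)"
    using ses_lift[OF c, of "Idt C (Cod C e)"] by auto
  show ?thesis
  proof (rule kernelI[OF assms(2) k(2)])
    show "Dom C g = Cod C f" "g \<cdot> f = \<zero>\<^bsub>Dom C f,Cod C g\<^esub>" using exact_atD[OF assms(1)] by simp_all
    fix x assume x: "x \<in> Ar C" "Cod C x = Cod C f" "g \<cdot> x = \<zero>\<^bsub>Dom C x,Cod C g\<^esub>"
    then obtain u where u: "u \<in> Ar C" "Dom C u = Dom C x" "Cod C u = Dom C k" "k \<cdot> u = x"
      using kernel_lift[OF ke(1), of x] ke(4) by auto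
    have "f \<cdot> (v \<cdot> u) = x" using cmp_reduce[OF v(4), of u] u v(1-3) ke(4) by simp
    then show "\<exists>u\<in>Ar C. Dom C u = Dom C x \<and> Cod C u = Dom C f \<and> f \<cdot> u = x"
      using u v(1-3) ke(4) by (intro bexI[of _ "v \<cdot> u"]) simp_all
  qed
qed

lemma exact_ses:
  assumes "exact_at C i p" "is_mono C i" "is_epi C p"
  shows "ses i p"
  by (rule sesI[OF assms(2,3) exact_atD(3,4)[OF assms(1)]]) (use exact_cover[OF assms(1)] in metis)

lemma ses_exact:
  assumes "ses i p"
  shows "exact_at C i p"
  using assms sesD[OF assms] by (auto simp: exact_at_def short_exact_def)

text \<open>A quotient with one element means that any two extensions are joined by a zigzag of
  morphisms, so a property that each morphism preserves and reflects holds for all extensions or for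
  none.\<close>

lemma Ext_vanishes_connect:
  assumes "Ext_vanishes C n X Y" "ds \<in> extensions C n X Y" "es \<in> extensions C n X Y"
    and "\<And>as bs. (as, bs) \<in> extension_morphisms C n X Y \<Longrightarrow> P as \<longleftrightarrow> P bs"
  shows "P ds \<longleftrightarrow> P es"
proof -
  let ?r = "(extension_morphisms C n X Y \<union> (extension_morphisms C n X Y)\<inverse>)\<^sup>*"
  obtain z where z: "extensions C n X Y // ?r = {z}"
    using assms(1) unfolding Ext_vanishes_def Yoneda_Ext_def is_singleton_def by blast
  have "?r `` {ds} \<in> {z}" "?r `` {es} \<in> {z}"
    using quotientI[OF assms(2), of ?r] quotientI[OF assms(3), of ?r] unfolding z by simp_all
  then have "?r `` {ds} = ?r `` {es}" by simp
  then have "(ds, es) \<in> ?r" by blast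
  then show ?thesis
    by (induction rule: rtrancl_induct) (use assms(4) in blast)+
qed

lemma extension1_iff:
  "ds \<in> extensions C 1 X Y \<longleftrightarrow> (\<exists>i p. ds = [i, p] \<and> ses i p \<and> Dom C i = Y \<and> Cod C p = X)"
proof
  assume ds: "ds \<in> extensions C 1 X Y"
  then obtain i p where "ds = [i, p]" by (auto simp: extensions_def length_Suc_conv)
  then show "\<exists>i p. ds = [i, p] \<and> ses i p \<and> Dom C i = Y \<and> Cod C p = X"
    using ds exact_ses by (auto simp: extensions_def)
qed (auto simp: extensions_def sesD ses_exact)

lemma extension1_morphism:
  "([i, p], [i', p']) \<in> extension_morphisms C 1 X Y \<longleftrightarrow>
    ses i p \<and> Dom C i = Y \<and> Cod C p = X \<and> ses i' p' \<and> Dom C i' = Y \<and> Cod C p' = X \<and>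
    (\<exists>h\<in>Ar C. Dom C h = Cod C i \<and> Cod C h = Cod C i' \<and> h \<cdot> i = i' \<and> p' \<cdot> h = p)" (is "?L \<longleftrightarrow> ?R")
proof
  assume ?L
  then obtain h :: "nat \<Rightarrow> 'b" where ex: "[i, p] \<in> extensions C 1 X Y" "[i', p'] \<in> extensions C 1 X Y"
    and h: "h 0 = Idt C Y" "h (Suc 1) = Idt C X"
    "\<forall>j\<le>1. h j \<in> Hom C (Dom C ([i, p] ! j)) (Dom C ([i', p'] ! j)) \<and>
       h (Suc j) \<in> Hom C (Cod C ([i, p] ! j)) (Cod C ([i', p'] ! j)) \<and> [i', p'] ! j \<cdot> h j = h (Suc j) \<cdot> [i, p] ! j"
    unfolding extension_morphisms_def by blast
  have e: "ses i p" "Dom C i = Y" "Cod C p = X" "ses i' p'" "Dom C i' = Y" "Cod C p' = X"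
    using ex by (auto simp: extension1_iff[simplified])
  note s = sesD[OF e(1)] sesD[OF e(4)]
  have "i' \<cdot> Idt C Y = h 1 \<cdot> i" "p' \<cdot> h 1 = Idt C X \<cdot> p" using h(3) unfolding h(1,2)[symmetric] by force+
  moreover have "i' \<cdot> Idt C Y = i'" "Idt C X \<cdot> p = p" using s e by simp_all
  moreover have "h 1 \<in> Hom C (Cod C i) (Cod C i')" using h(3) by force
  ultimately have "h 1 \<in> Ar C \<and> Dom C (h 1) = Cod C i \<and> Cod C (h 1) = Cod C i' \<and> h 1 \<cdot> i = i' \<and> p' \<cdot> h 1 = p"
    unfolding Hom_iff by metis
  then show ?R using e by blast
next
  assume ?R
  then obtain h where e: "ses i p" "Dom C i = Y" "Cod C p = X" "ses i' p'" "Dom C i' = Y" "Cod C p' = X"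
    and h: "h \<in> Ar C" "Dom C h = Cod C i" "Cod C h = Cod C i'" "h \<cdot> i = i'" "p' \<cdot> h = p" by blast
  note s = sesD[OF e(1)] sesD[OF e(4)]
  have "[i, p] \<in> extensions C 1 X Y" "[i', p'] \<in> extensions C 1 X Y" using e unfolding extension1_iff by auto
  moreover have ob: "Y \<in> Ob C" "X \<in> Ob C" using s(1) s(2) e(2,3) ends_in_Ob by blast+
  define H where "H n = (if n = 0 then Idt C Y else if n = 1 then h else Idt C X)" for n :: nat
  have "\<forall>j\<le>1. H j \<in> Hom C (Dom C ([i, p] ! j)) (Dom C ([i', p'] ! j)) \<and>
      H (Suc j) \<in> Hom C (Cod C ([i, p] ! j)) (Cod C ([i', p'] ! j)) \<and> [i', p'] ! j \<cdot> H j = H (Suc j) \<cdot> [i, p] ! j"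
  proof (intro allI impI)
    fix j :: nat assume "j \<le> 1"
    then consider "j = 0" | "j = 1" by linarith
    then show "H j \<in> Hom C (Dom C ([i, p] ! j)) (Dom C ([i', p'] ! j)) \<and>
      H (Suc j) \<in> Hom C (Cod C ([i, p] ! j)) (Cod C ([i', p'] ! j)) \<and> [i', p'] ! j \<cdot> H j = H (Suc j) \<cdot> [i, p] ! j"
      by cases (simp_all add: H_def Hom_iff s e h ob)
  qed
  moreover have "H 0 = Idt C Y" "H (Suc 1) = Idt C X" by (simp_all add: H_def)
  ultimately show ?L unfolding extension_morphisms_def by blast
qed

text \<open>Splitting is invariant along morphisms of extensions and holds for the biproduct, which
  gives one direction. Conversely, a retraction \<open>r\<close> and the projection \<open>p\<close>
  together define a morphism from the given extension to the biproduct, so there is only one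
  class.\<close>

lemma Ext_vanishes_1:
  assumes [simp]: "X \<in> Ob C" "Y \<in> Ob C"
  shows "Ext_vanishes C 1 X Y \<longleftrightarrow> Ext1_zero C X Y"
proof
  let ?r = "(extension_morphisms C 1 X Y \<union> (extension_morphisms C 1 X Y)\<inverse>)\<^sup>*"
  obtain i0 p0 j0 q0 where b: "ses i0 q0" "Dom C i0 = Y" "Dom C j0 = X" "Cod C j0 = Cod C i0"
    "Cod C q0 = X" "Cod C p0 = Y" "p0 \<cdot> i0 = Idt C Y" "q0 \<cdot> j0 = Idt C X" "ses j0 p0"
    by (rule biproduct_ses[OF assms(2,1)]) blast
  note [simp] = sesD[OF b(1)] sesD[OF b(9)] b(2-8)
  have triv: "[i0, q0] \<in> extensions C 1 X Y" unfolding extension1_iff using b by auto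
  {
    assume v: "Ext_vanishes C 1 X Y"
    define P where "P ds \<longleftrightarrow> (\<exists>s\<in>Ar C. Dom C s = X \<and> Cod C s = Cod C (ds ! 0) \<and> ds ! 1 \<cdot> s = Idt C X)" for ds
    have inv: "P as \<longleftrightarrow> P bs" if m: "(as, bs) \<in> extension_morphisms C 1 X Y" for as bs
    proof -
      have "as \<in> extensions C 1 X Y" "bs \<in> extensions C 1 X Y" using m by (auto simp: extension_morphisms_def)
      then obtain i p i' p' where ab: "as = [i, p]" "bs = [i', p']" unfolding extension1_iff by blast
      obtain h where h: "h \<in> Ar C" "Dom C h = Cod C i" "Cod C h = Cod C i'" "h \<cdot> i = i'" "p' \<cdot> h = p"
        and e: "ses i p" "Dom C i = Y" "Cod C p = X" "ses i' p'" "Dom C i' = Y" "Cod C p' = X"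
        using m unfolding ab extension1_morphism by blast
      note [simp] = sesD[OF e(1)] sesD[OF e(4)]
      show ?thesis
      proof
        assume "P as"
        then obtain s where s: "s \<in> Ar C" "Dom C s = X" "Cod C s = Cod C i" "p \<cdot> s = Idt C X" by (auto simp: P_def ab)
        then have "p' \<cdot> (h \<cdot> s) = Idt C X" using cmp_reduce[OF h(5), of s] h e by simp
        then show "P bs" using s h unfolding P_def ab by (intro bexI[of _ "h \<cdot> s"]) simp_all
      next
        \<comment> \<open>A section does not pull back along \<open>h\<close>, but a retraction
          does, so the splitting is passed through its other form.\<close>
        assume "P bs"
        then have "\<exists>s\<in>Ar C. Dom C s = Cod C p' \<and> Cod C s = Cod C i' \<and> p' \<cdot> s = Idt C (Cod C p')"
          using e by (simp add: P_def ab)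
        then obtain r where r: "r \<in> Ar C" "Dom C r = Cod C i'" "Cod C r = Dom C i'" "r \<cdot> i' = Idt C (Dom C i')"
          using splits_iff[OF e(4)] by blast
        then have "(r \<cdot> h) \<cdot> i = Idt C (Dom C i)" using h e by simp
        then have "\<exists>r\<in>Ar C. Dom C r = Cod C i \<and> Cod C r = Dom C i \<and> r \<cdot> i = Idt C (Dom C i)"
          using r h e by (intro bexI[of _ "r \<cdot> h"]) simp_all
        then show "P as" using splits_iff[OF e(1)] e by (simp add: P_def ab)
      qed
    qed
    have P0: "P [i0, q0]" unfolding P_def by (intro bexI[of _ j0]) simp_all
    show "Ext1_zero C X Y" unfolding Ext1_zero_def
    proof (intro allI impI)
      fix i p assume e: "ses i p" "Dom C i = Y" "Cod C p = X"
      then have "[i, p] \<in> extensions C 1 X Y" unfolding extension1_iff by auto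
      then have "P [i, p]" using Ext_vanishes_connect[OF v triv, of "[i, p]" P] inv P0 by blast
      then show "\<exists>s\<in>Ar C. Dom C s = X \<and> Cod C s = Cod C i \<and> p \<cdot> s = Idt C X" by (simp add: P_def)
    qed
  next
    assume z: "Ext1_zero C X Y"
    have sym: "sym ?r" by (intro sym_rtrancl sym_Un_converse)
    have rel: "(ds, [i0, q0]) \<in> ?r" if m: "ds \<in> extensions C 1 X Y" for ds
    proof -
      obtain i p where ds: "ds = [i, p]" and e: "ses i p" "Dom C i = Y" "Cod C p = X"
        using m unfolding extension1_iff by blast
      note [simp] = sesD[OF e(1)] e(2,3)
      obtain r where r: "r \<in> Ar C" "Dom C r = Cod C i" "Cod C r = Y" "r \<cdot> i = Idt C Y"
        using z e unfolding Ext1_zero_retraction by blast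
      have "(i0 \<cdot> r \<oplus> j0 \<cdot> p) \<cdot> i = i0" "q0 \<cdot> (i0 \<cdot> r \<oplus> j0 \<cdot> p) = p"
        using r cmp_reduce[OF sesD(4)[OF b(1)], of r] cmp_reduce[OF b(8), of p] by simp_all
      then have "([i, p], [i0, q0]) \<in> extension_morphisms C 1 X Y"
        unfolding extension1_morphism using b e r by (auto intro!: bexI[of _ "i0 \<cdot> r \<oplus> j0 \<cdot> p"])
      then show ?thesis unfolding ds by blast
    qed
    have cl: "?r `` {ds} = ?r `` {[i0, q0]}" if "ds \<in> extensions C 1 X Y" for ds
      using rel[OF that] symD[OF sym rel[OF that]] by (blast intro: rtrancl_trans)
    have "z = ?r `` {[i0, q0]}" if "z \<in> extensions C 1 X Y // ?r" for z
      using that cl by (elim quotientE) blast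
    then have "Yoneda_Ext C 1 X Y = {?r `` {[i0, q0]}}"
      unfolding Yoneda_Ext_def using quotientI[OF triv, of ?r] by blast
    then show "Ext_vanishes C 1 X Y" by (simp add: Ext_vanishes_def)
  }
qed


text \<open>\<open>gluable\<close> says that the two halves of the 2-extension \<open>Y \<rightarrow> E\<^sub>2 \<rightarrow> E\<^sub>1 \<rightarrow> X\<close> are glued by an object with a
  filtration by \<open>Y\<close>, the middle image and \<open>X\<close>, which is what it means for the class of the extension
  to vanish. Of the two equivalent exactness conditions the first passes to pullbacks along \<open>E\<^sub>1\<close> and the second to
  pushouts along \<open>E\<^sub>2\<close>, so the property is invariant under the zigzags defining Yoneda Ext.\<close>
definition gluable :: "'b list \<Rightarrow> bool" where
  "gluable ds \<longleftrightarrow> (\<exists>a\<in>Ar C. \<exists>b\<in>Ar C. Dom C a = Cod C (ds ! 0) \<and> Dom C b = Cod C a \<and> Cod C b = Cod C (ds ! 1) \<and>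
     b \<cdot> a = ds ! 1 \<and> ses (a \<cdot> ds ! 0) b \<and> ses a (ds ! 2 \<cdot> b))"

section \<open>Gluing of 2-extensions\<close>

lemma extension2_iff:
  "ds \<in> extensions C 2 X Y \<longleftrightarrow> (\<exists>i d p. ds = [i, d, p] \<and> is_mono C i \<and> is_epi C p \<and>
     exact_at C i d \<and> exact_at C d p \<and> Dom C i = Y \<and> Cod C p = X)"
proof
  assume ds: "ds \<in> extensions C 2 X Y"
  then obtain i d p where "ds = [i, d, p]" by (auto simp: extensions_def length_Suc_conv numeral_eq_Suc)
  then show "\<exists>i d p. ds = [i, d, p] \<and> is_mono C i \<and> is_epi C p \<and>
     exact_at C i d \<and> exact_at C d p \<and> Dom C i = Y \<and> Cod C p = X"
    using ds by (auto simp: extensions_def less_Suc_eq numeral_eq_Suc)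
qed (auto simp: extensions_def less_Suc_eq numeral_eq_Suc)

text \<open>Let \<open>i\<close>, \<open>d\<close>, \<open>p\<close> run through \<open>Y\<close>,
  \<open>E2\<close>, \<open>E1\<close>, \<open>X\<close>. Both sides describe a filtration of
  \<open>Cod C a\<close> by \<open>Y\<close> and \<open>E2\<close>: the left one exhibits
  \<open>E1\<close> as the quotient by \<open>Y\<close>, the right one \<open>X\<close> as the
  quotient by \<open>E2\<close>. Both directions are chases with covers.\<close>

lemma glue_iff:
  assumes i: "is_mono C i" and p: "is_epi C p" and id: "exact_at C i d" and dp: "exact_at C d p"
    and ab: "a \<in> Ar C" "b \<in> Ar C" "Dom C a = Cod C i" "Dom C b = Cod C a" "Cod C b = Cod C d" "b \<cdot> a = d"
  shows "ses (a \<cdot> i) b \<longleftrightarrow> ses a (p \<cdot> b)"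
proof
  note e1 = exact_atD[OF id] and e2 = exact_atD[OF dp]
  note [simp] = i p e1 e2 ab(1-5)
  {
    assume s: "ses (a \<cdot> i) b"
    note [simp] = sesD(5,6)[OF s]
    show "ses a (p \<cdot> b)"
    proof (rule sesI)
      show "is_mono C a"
      proof (rule monoI)
        fix x assume x: "x \<in> Ar C" "Cod C x = Dom C a" "a \<cdot> x = \<zero>\<^bsub>Dom C x,Cod C a\<^esub>"
        have "d \<cdot> x = b \<cdot> (a \<cdot> x)" using cmp_reduce[OF ab(6), of x] x by simp
        also have "\<dots> = \<zero>\<^bsub>Dom C x,Cod C d\<^esub>" using x by simp
        finally obtain e y where y: "is_epi C e" "y \<in> Ar C" "Cod C e = Dom C x" "Dom C y = Dom C e" "Cod C y = Dom C i" "x \<cdot> e = i \<cdot> y"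
          using exact_cover[OF id, of x] x by auto
        have "(a \<cdot> i) \<cdot> y = a \<cdot> (x \<cdot> e)" using y by simp
        also have "\<dots> = \<zero>\<^bsub>Dom C y,Cod C a\<^esub>" using cmp_reduce[OF x(3), of e] x(1,2) y(1-4) by simp
        finally have ay: "(a \<cdot> i) \<cdot> y = \<zero>\<^bsub>Dom C y,Cod C a\<^esub>" .
        have "y = \<zero>\<^bsub>Dom C e,Dom C i\<^esub>"
          by (rule mono_cancel[OF sesD(5)[OF s]]) (use ay y(1-5) in simp_all)
        then have "x \<cdot> e = \<zero>\<^bsub>Dom C e,Cod C x\<^esub>" using y(1-5) x(2) unfolding y(6) by simp
        then show "x = \<zero>\<^bsub>Dom C x,Dom C a\<^esub>" using epi_zero[OF y(1), of x] x y(1-4) by simp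
      qed simp
      show "is_epi C (p \<cdot> b)" by (rule epi_cmp) simp_all
      show "(p \<cdot> b) \<cdot> a = \<zero>\<^bsub>Dom C a,Cod C (p \<cdot> b)\<^esub>" using ab(6) by simp
      fix x assume x: "x \<in> Ar C" "Cod C x = Cod C a" "(p \<cdot> b) \<cdot> x = \<zero>\<^bsub>Dom C x,Cod C (p \<cdot> b)\<^esub>"
      then obtain e y where y: "is_epi C e" "y \<in> Ar C" "Cod C e = Dom C x" "Dom C y = Dom C e" "Cod C y = Dom C d" "(b \<cdot> x) \<cdot> e = d \<cdot> y"
        using exact_cover[OF dp, of "b \<cdot> x"] by auto
      have "b \<cdot> (x \<cdot> e) = b \<cdot> (a \<cdot> y)" using cmp_reduce[OF ab(6), of y] x y by simp
      then obtain z where z: "z \<in> Ar C" "Dom C z = Dom C (a \<cdot> y)" "Cod C z = Dom C (a \<cdot> i)" "x \<cdot> e = (a \<cdot> y) \<oplus> (a \<cdot> i) \<cdot> z"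
        using ses_diff[OF s, of "x \<cdot> e" "a \<cdot> y"] x y by auto
      have "x \<cdot> e = a \<cdot> (y \<oplus> i \<cdot> z)" using z y by simp
      then show "\<exists>e y. is_epi C e \<and> y \<in> Ar C \<and> Cod C e = Dom C x \<and> Dom C y = Dom C e \<and> Cod C y = Dom C a \<and> x \<cdot> e = a \<cdot> y"
        using y z by (intro exI[of _ e] exI[of _ "y \<oplus> i \<cdot> z"]) simp
    qed simp
  next
    assume s: "ses a (p \<cdot> b)"
    note [simp] = sesD(5,6)[OF s]
    show "ses (a \<cdot> i) b"
    proof (rule sesI)
      show "is_mono C (a \<cdot> i)" by (rule mono_cmp) simp_all
      \<comment> \<open>An epimorphism is factored through \<open>b\<close> in two corrections. Over
        a cover \<open>e\<close> of \<open>E1\<close>, the map \<open>p\<close> lifts along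
        \<open>p \<cdot> b\<close> to \<open>m\<close>; the remainder
        \<open>e \<ominus> b \<cdot> m\<close> is killed by \<open>p\<close>, so after a further
        cover it comes from \<open>d = b \<cdot> a\<close>.\<close>
      show "is_epi C b"
      proof -
        obtain e m where m: "is_epi C e" "m \<in> Ar C" "Cod C e = Cod C d" "Cod C m = Dom C (p \<cdot> b)" "Dom C m = Dom C e" "(p \<cdot> b) \<cdot> m = p \<cdot> e"
          using lift_cover[OF sesD(6)[OF s], of p] by auto
        have "p \<cdot> (e \<ominus> b \<cdot> m) = \<zero>\<^bsub>Dom C e,Cod C p\<^esub>" using m by simp
        then obtain e' y where y: "is_epi C e'" "y \<in> Ar C" "Cod C e' = Dom C e" "Dom C y = Dom C e'" "Cod C y = Dom C d" "(e \<ominus> b \<cdot> m) \<cdot> e' = d \<cdot> y"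
          using exact_cover[OF dp, of "e \<ominus> b \<cdot> m"] m by auto
        have "(e \<ominus> b \<cdot> m) \<cdot> e' = e \<cdot> e' \<ominus> b \<cdot> (m \<cdot> e')" using m(1-5) y(1-3) by simp
        then have "e \<cdot> e' \<ominus> b \<cdot> (m \<cdot> e') = b \<cdot> (a \<cdot> y)" using y(2-6) cmp_reduce[OF ab(6), of y] by simp
        then have "e \<cdot> e' = b \<cdot> (m \<cdot> e') \<oplus> b \<cdot> (a \<cdot> y)"
          using sub_eq_iff[of "e \<cdot> e'" "b \<cdot> (m \<cdot> e')" "b \<cdot> (a \<cdot> y)"] m(1-5) y(1-5) by simp
        also have "\<dots> = b \<cdot> (m \<cdot> e' \<oplus> a \<cdot> y)" using m(1-5) y(1-5) by simp
        finally have "is_epi C (b \<cdot> (m \<cdot> e' \<oplus> a \<cdot> y))" using epi_cmp[OF y(1) m(1)] y(3) by simp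
        then show ?thesis by (rule epi_factor) (use m(1-5) y(1-5) in simp_all)
      qed
      show "b \<cdot> (a \<cdot> i) = \<zero>\<^bsub>Dom C (a \<cdot> i),Cod C b\<^esub>" using cmp_reduce[OF ab(6), of i] by simp
      fix x assume x: "x \<in> Ar C" "Cod C x = Cod C (a \<cdot> i)" "b \<cdot> x = \<zero>\<^bsub>Dom C x,Cod C b\<^esub>"
      then obtain y where y: "y \<in> Ar C" "Dom C y = Dom C x" "Cod C y = Dom C a" "a \<cdot> y = x"
        using ses_lift[OF s, of x] by auto
      have "d \<cdot> y = \<zero>\<^bsub>Dom C y,Cod C d\<^esub>" using cmp_reduce[OF ab(6), of y] x y by simp
      then obtain e z where z: "is_epi C e" "z \<in> Ar C" "Cod C e = Dom C y" "Dom C z = Dom C e" "Cod C z = Dom C i" "y \<cdot> e = i \<cdot> z"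
        using exact_cover[OF id, of y] y by auto
      have "x \<cdot> e = (a \<cdot> i) \<cdot> z" using cmp_reduce[OF y(4), of e] y z by simp
      then show "\<exists>e y. is_epi C e \<and> y \<in> Ar C \<and> Cod C e = Dom C x \<and> Dom C y = Dom C e \<and> Cod C y = Dom C (a \<cdot> i) \<and> x \<cdot> e = (a \<cdot> i) \<cdot> y"
        using y z by (intro exI[of _ e] exI[of _ z]) simp
    qed simp_all
  }
qed

lemma gluable_invariant:
  assumes "(as, bs) \<in> extension_morphisms C 2 X Y"
  shows "gluable as \<longleftrightarrow> gluable bs"
proof -
  obtain h :: "nat \<Rightarrow> 'b" where ex: "as \<in> extensions C 2 X Y" "bs \<in> extensions C 2 X Y"
    and h: "h 0 = Idt C Y" "h (Suc 2) = Idt C X"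
    "\<And>j. j \<le> 2 \<Longrightarrow> h j \<in> Hom C (Dom C (as ! j)) (Dom C (bs ! j)) \<and>
       h (Suc j) \<in> Hom C (Cod C (as ! j)) (Cod C (bs ! j)) \<and> bs ! j \<cdot> h j = h (Suc j) \<cdot> as ! j"
    using assms unfolding extension_morphisms_def by blast
  obtain i d p i' d' p' where as: "as = [i, d, p]" "is_mono C i" "is_epi C p" "exact_at C i d" "exact_at C d p" "Dom C i = Y" "Cod C p = X"
    and bs: "bs = [i', d', p']" "is_mono C i'" "is_epi C p'" "exact_at C i' d'" "exact_at C d' p'" "Dom C i' = Y" "Cod C p' = X"
    using ex unfolding extension2_iff by blast
  note e = exact_atD[OF as(4)] exact_atD[OF as(5)] exact_atD[OF bs(4)] exact_atD[OF bs(5)] as(6,7) bs(6,7)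
  have XY: "X \<in> Ob C" "Y \<in> Ob C" using e ends_in_Ob by metis+
  define u v where "u = h 1" and "v = h 2"
  have uv: "u \<in> Ar C" "v \<in> Ar C" "Dom C u = Cod C i" "Cod C u = Cod C i'" "Dom C v = Cod C d" "Cod C v = Cod C d'"
    using h(3)[of 0] h(3)[of 1] unfolding as bs u_def v_def by (auto simp: Hom_iff numeral_2_eq_2)
  have "i' \<cdot> h 0 = u \<cdot> i" "d' \<cdot> u = v \<cdot> d" "p' \<cdot> v = h (Suc 2) \<cdot> p"
    using h(3)[of 0] h(3)[of 1] h(3)[of 2] unfolding as bs u_def v_def by (auto simp: Hom_iff numeral_2_eq_2)
  then have sq: "u \<cdot> i = i'" "d' \<cdot> u = v \<cdot> d" "p' \<cdot> v = p" unfolding h(1,2) using e XY by simp_all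
  have g: "gluable [i, d, p] \<longleftrightarrow> (\<exists>a\<in>Ar C. \<exists>b\<in>Ar C. Dom C a = Cod C i \<and> Dom C b = Cod C a \<and> Cod C b = Cod C d \<and>
     b \<cdot> a = d \<and> ses (a \<cdot> i) b \<and> ses a (p \<cdot> b))" for i d p
    by (simp add: gluable_def)
  show ?thesis unfolding as(1) bs(1)
  proof
    note [simp] = e uv
    {
      assume "gluable [i', d', p']"
      then obtain a b where ab: "a \<in> Ar C" "b \<in> Ar C" "Dom C a = Cod C i'" "Dom C b = Cod C a" "Cod C b = Cod C d'"
        "b \<cdot> a = d'" "ses (a \<cdot> i') b" unfolding g by blast
      note [simp] = ab(1-5)
      \<comment> \<open>The glued object is pulled back along \<open>v\<close>, which keeps the
        kernel \<open>Y\<close>; the maps \<open>a \<cdot> u\<close> and \<open>d\<close> induce the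
        new \<open>a'\<close>.\<close>
      obtain j c w where r: "ses j c" "Dom C j = Dom C (a \<cdot> i')" "Cod C c = Dom C v"
        "w \<in> Ar C" "Dom C w = Cod C j" "Cod C w = Cod C (a \<cdot> i')" "w \<cdot> j = a \<cdot> i'" "b \<cdot> w = v \<cdot> c"
        and un: "\<And>x y. x \<in> Ar C \<Longrightarrow> y \<in> Ar C \<Longrightarrow> Cod C x = Cod C (a \<cdot> i') \<Longrightarrow> Cod C y = Dom C v \<Longrightarrow> Dom C y = Dom C x \<Longrightarrow>
          b \<cdot> x = v \<cdot> y \<Longrightarrow> \<exists>u\<in>Ar C. Dom C u = Dom C x \<and> Cod C u = Cod C j \<and> w \<cdot> u = x \<and> c \<cdot> u = y"
        and jo: "\<And>x y. x \<in> Ar C \<Longrightarrow> y \<in> Ar C \<Longrightarrow> Cod C x = Cod C j \<Longrightarrow> Cod C y = Cod C j \<Longrightarrow>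
          w \<cdot> x = w \<cdot> y \<Longrightarrow> c \<cdot> x = c \<cdot> y \<Longrightarrow> x = y"
        by (rule ses_pullback[OF ab(7), of v]) auto
      note [simp] = sesD[OF r(1)] r(2-6)
      have "b \<cdot> (a \<cdot> u) = v \<cdot> d" using cmp_reduce[OF ab(6), of u] sq by simp
      then obtain a' where a': "a' \<in> Ar C" "Dom C a' = Cod C i" "Cod C a' = Cod C j" "w \<cdot> a' = a \<cdot> u" "c \<cdot> a' = d"
        using un[of "a \<cdot> u" d] by auto
      have "a' \<cdot> i = j"
        by (rule jo) (use a' r sq cmp_reduce2[OF a'(4), of i] cmp_reduce[OF a'(5), of i] in simp_all)
      then have s: "ses (a' \<cdot> i) c" using r by simp
      then have t: "ses a' (p \<cdot> c)" using glue_iff[OF as(2-5), of a' c] a' by simp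
      have "Dom C c = Cod C a'" "Cod C c = Cod C d" using a'(3) by simp_all
      then show "gluable [i, d, p]" unfolding g using a'(1,2,5) s t sesD(2)[OF r(1)] by blast
    next
      assume "gluable [i, d, p]"
      then obtain a b where ab: "a \<in> Ar C" "b \<in> Ar C" "Dom C a = Cod C i" "Dom C b = Cod C a" "Cod C b = Cod C d"
        "b \<cdot> a = d" "ses a (p \<cdot> b)" unfolding g by blast
      note [simp] = ab(1-5)
      \<comment> \<open>Dually, the glued object is pushed out along \<open>u\<close>, which keeps
        the cokernel \<open>X\<close>; the maps \<open>v \<cdot> b\<close> and \<open>d'\<close>
        induce the new \<open>b'\<close>.\<close>
      obtain a' q w where r: "ses a' q" "Cod C q = Cod C (p \<cdot> b)" "Dom C a' = Cod C u"
        "w \<in> Ar C" "Cod C w = Cod C a'" "Dom C w = Cod C a" "q \<cdot> w = p \<cdot> b" "w \<cdot> a = a' \<cdot> u"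
        and un: "\<And>x y. x \<in> Ar C \<Longrightarrow> y \<in> Ar C \<Longrightarrow> Dom C x = Cod C a \<Longrightarrow> Dom C y = Cod C u \<Longrightarrow> Cod C y = Cod C x \<Longrightarrow>
          x \<cdot> a = y \<cdot> u \<Longrightarrow> \<exists>z\<in>Ar C. Cod C z = Cod C x \<and> Dom C z = Cod C a' \<and> z \<cdot> w = x \<and> z \<cdot> a' = y"
        and jo: "\<And>x y. x \<in> Ar C \<Longrightarrow> y \<in> Ar C \<Longrightarrow> Dom C x = Cod C a' \<Longrightarrow> Dom C y = Cod C a' \<Longrightarrow>
          x \<cdot> w = y \<cdot> w \<Longrightarrow> x \<cdot> a' = y \<cdot> a' \<Longrightarrow> x = y"
        by (rule ses_pushout[OF ab(7), of u]) auto
      note [simp] = sesD[OF r(1)] r(2-6)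
      have "(v \<cdot> b) \<cdot> a = d' \<cdot> u" using ab(6) sq by simp
      then obtain b' where b': "b' \<in> Ar C" "Cod C b' = Cod C d'" "Dom C b' = Cod C a'" "b' \<cdot> w = v \<cdot> b" "b' \<cdot> a' = d'"
        using un[of "v \<cdot> b" d'] by auto
      have "p' \<cdot> b' = q"
        by (rule jo) (use b' r sq(3) cmp_reduce[OF sq(3), of b] in simp_all)
      then have s: "ses a' (p' \<cdot> b')" using r by simp
      then have t: "ses (a' \<cdot> i') b'" using glue_iff[OF bs(2-5), of a' b'] b' by simp
      have "Dom C a' = Cod C i'" by simp
      then show "gluable [i', d', p']" unfolding g using b'(1,2,3,5) s t sesD(1)[OF r(1)] by blast
    }
  qed
qed

text \<open>By invariance under zigzags it is enough to glue one 2-extension with the same ends.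
  Replacing the left half by a split sequence gives one with middle terms the biproduct of
  \<open>Y\<close> and \<open>Dom C k\<close>, and \<open>Cod C k\<close>; it is glued by the
  biproduct of \<open>Y\<close> and \<open>Cod C k\<close>.\<close>

lemma Ext2_glue:
  assumes v: "Ext_vanishes C 2 X Y" and ie: "ses i e" "Dom C i = Y"
    and kp: "ses k p" "Cod C p = X" "Cod C e = Dom C k"
  obtains a b where "a \<in> Ar C" "b \<in> Ar C" "Dom C a = Cod C i" "Dom C b = Cod C a" "Cod C b = Cod C k" "b \<cdot> a = k \<cdot> e"
    "ses (a \<cdot> i) b" "ses a (p \<cdot> b)"
proof -
  note [simp] = sesD[OF ie(1)] sesD[OF kp(1)] ie(2) kp(2-3)
  have Y [simp]: "Y \<in> Ob C" using ends_in_Ob(1)[of i] by simp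
  have exact: "exact_at C (k \<cdot> e') p" if "is_epi C e'" "Cod C e' = Dom C k" for e'
    by (rule exact_atI) (use kp that in \<open>auto simp: short_exact_def\<close>)
  have exact': "exact_at C i' (k \<cdot> e')" if ses: "ses i' e'" and [simp]: "Cod C e' = Dom C k" for i' e'
  proof -
    note [simp] = sesD[OF ses]
    have "is_kernel C i' (k \<cdot> e')"
    proof (rule kernelI)
      fix x assume x: "x \<in> Ar C" "Cod C x = Cod C i'" "(k \<cdot> e') \<cdot> x = \<zero>\<^bsub>Dom C x,Cod C (k \<cdot> e')\<^esub>"
      then have "k \<cdot> (e' \<cdot> x) = \<zero>\<^bsub>Dom C x,Cod C k\<^esub>" by simp
      then have "e' \<cdot> x = \<zero>\<^bsub>Dom C (e' \<cdot> x),Dom C k\<^esub>" by (rule mono_zero[rotated]) (use x in simp_all)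
      then show "\<exists>u\<in>Ar C. Dom C u = Dom C x \<and> Cod C u = Dom C i' \<and> i' \<cdot> u = x"
        using ses_lift[OF ses, of x] x by simp metis
    qed simp_all
    then have "exact_at C (i' \<cdot> Idt C (Dom C i')) (k \<cdot> e')" by (rule exact_atI) (simp_all add: Idt_epi)
    then show ?thesis by simp
  qed
  have "[i, k \<cdot> e, p] \<in> extensions C 2 X Y"
    unfolding extension2_iff using exact[of e] exact'[OF ie(1)] by simp
  moreover
  obtain i0 p0 j0 q0 where b0: "ses i0 q0" "Dom C i0 = Y" "Dom C j0 = Dom C k" "Cod C j0 = Cod C i0"
    "Cod C q0 = Dom C k" "Cod C p0 = Y" "p0 \<cdot> i0 = Idt C Y" "q0 \<cdot> j0 = Idt C (Dom C k)" "ses j0 p0"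
    by (rule biproduct_ses[of Y "Dom C k"]) (use Y in auto)
  obtain i1 p1 j1 q1 where b1: "ses i1 q1" "Dom C i1 = Y" "Dom C j1 = Cod C k" "Cod C j1 = Cod C i1"
    "Cod C q1 = Cod C k" "Cod C p1 = Y" "p1 \<cdot> i1 = Idt C Y" "q1 \<cdot> j1 = Idt C (Cod C k)" "ses j1 p1"
    by (rule biproduct_ses[of Y "Cod C k"]) (use Y in auto)
  note [simp] = sesD[OF b0(1)] sesD[OF b0(9)] b0(2-8) sesD[OF b1(1)] sesD[OF b1(9)] b1(2-8)
  have m0: "is_mono C i0" "is_epi C p" "exact_at C i0 (k \<cdot> q0)" "exact_at C (k \<cdot> q0) p"
    using exact[of q0] exact'[OF b0(1)] by simp_all
  then have "[i0, k \<cdot> q0, p] \<in> extensions C 2 X Y" unfolding extension2_iff by simp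
  ultimately have iff: "gluable [i, k \<cdot> e, p] \<longleftrightarrow> gluable [i0, k \<cdot> q0, p]"
    by (rule Ext_vanishes_connect[OF v _ _ gluable_invariant])
  \<comment> \<open>The identity of \<open>Y\<close> together with \<open>k\<close>, as a map
    between the two biproducts.\<close>
  define a where "a = i1 \<cdot> p0 \<oplus> j1 \<cdot> (k \<cdot> q0)"
  have a: "a \<in> Ar C" "Dom C a = Cod C i0" "Cod C a = Cod C i1" by (simp_all add: a_def)
  have qa: "q1 \<cdot> a = k \<cdot> q0"
    using cmp_reduce[OF sesD(4)[OF b1(1)], of p0] cmp_reduce[OF b1(8), of "k \<cdot> q0"] by (simp add: a_def)
  have "a \<cdot> i0 = i1" by (simp add: a_def)
  then have s: "ses (a \<cdot> i0) q1" using b1 by simp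
  moreover have "ses a (p \<cdot> q1)" using glue_iff[OF m0, of a q1] a qa s by simp
  ultimately have "gluable [i0, k \<cdot> q0, p]" unfolding gluable_def using a qa
    by (intro bexI[of _ a] bexI[of _ q1]) simp_all
  then have "gluable [i, k \<cdot> e, p]" using iff by simp
  then show ?thesis using that unfolding gluable_def by auto
qed

text \<open>In the long exact sequence, the first Ext of the kernel sits between the first Ext of
  the middle term and the second Ext of the quotient. Concretely, an extension of
  \<open>Dom C k\<close> by \<open>Y\<close> is spliced with \<open>k\<close>, \<open>p\<close> and
  glued to an extension of \<open>Cod C k\<close> by \<open>Y\<close>; a retraction of the latter
  restricts along \<open>a\<close>.\<close>

lemma Ext1_zero_kernel:
  assumes "Ext_vanishes C 2 (Cod C p) Y" "Ext1_zero C (Cod C k) Y" "ses k p"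
  shows "Ext1_zero C (Dom C k) Y"
  unfolding Ext1_zero_retraction
proof (intro allI impI)
  fix i e assume ie: "ses i e" "Dom C i = Y" "Cod C e = Dom C k"
  obtain a b where ab: "a \<in> Ar C" "b \<in> Ar C" "Dom C a = Cod C i" "Dom C b = Cod C a" "Cod C b = Cod C k"
    "ses (a \<cdot> i) b"
    by (rule Ext2_glue[OF assms(1) ie(1,2) assms(3) refl ie(3)])
  note [simp] = sesD[OF ie(1)] ab(1-5) ie(2)
  obtain r where r: "r \<in> Ar C" "Dom C r = Cod C (a \<cdot> i)" "Cod C r = Y" "r \<cdot> (a \<cdot> i) = Idt C Y"
    using assms(2) ab(5,6) unfolding Ext1_zero_retraction by fastforce
  then show "\<exists>r\<in>Ar C. Dom C r = Cod C i \<and> Cod C r = Y \<and> r \<cdot> i = Idt C Y"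
    by (intro bexI[of _ "r \<cdot> a"]) simp_all
qed

text \<open>The same glued object is read as an extension of \<open>X\<close> by
  \<open>Cod C i\<close>; a section of it, followed by \<open>b\<close>, splits the given
  extension.\<close>

lemma Ext1_zero_cokernel:
  assumes "Ext_vanishes C 2 X (Dom C i)" "Ext1_zero C X (Cod C i)" "ses i e"
  shows "Ext1_zero C X (Cod C e)"
  unfolding Ext1_zero_def
proof (intro allI impI)
  fix k p assume kp: "ses k p" "Dom C k = Cod C e" "Cod C p = X"
  obtain a b where ab: "a \<in> Ar C" "b \<in> Ar C" "Dom C a = Cod C i" "Dom C b = Cod C a" "Cod C b = Cod C k"
    "ses a (p \<cdot> b)"
    by (rule Ext2_glue[OF assms(1,3) refl kp(1,3) kp(2)[symmetric]])
  note [simp] = sesD[OF kp(1)] ab(1-5) kp(3)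
  have "\<exists>s\<in>Ar C. Dom C s = X \<and> Cod C s = Cod C a \<and> (p \<cdot> b) \<cdot> s = Idt C X"
    using assms(2) ab(6) unfolding Ext1_zero_def by fastforce
  then obtain s where "s \<in> Ar C" "Dom C s = X" "Cod C s = Cod C a" "(p \<cdot> b) \<cdot> s = Idt C X" by blast
  then show "\<exists>s\<in>Ar C. Dom C s = X \<and> Cod C s = Cod C k \<and> p \<cdot> s = Idt C X"
    by (intro bexI[of _ "b \<cdot> s"]) simp_all
qed

end

section \<open>Hereditary abelian model structures\<close>

text \<open>The hereditary condition appears as closure of \<open>Q\<close> under kernels of
  epimorphisms and of \<open>R\<close> under cokernels of monomorphisms, the complete cotorsion
  pairs as orthogonality, membership tests and replacements. In this form the axioms are self-dual
  under exchanging \<open>Q\<close> and \<open>R\<close>.\<close>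

locale model = abelian_category C
  for C :: "('o, 'm) additive_cat" (structure) +
  fixes Q W R :: "'o set"
  assumes QR_Ob: "Q \<subseteq> Ob C" "R \<subseteq> Ob C"
    and W_thick: "thick C W"
    and orth_trivially_fibrant: "X \<in> Q \<Longrightarrow> Y \<in> R \<Longrightarrow> Y \<in> W \<Longrightarrow> Ext1_zero C X Y"
    and orth_trivially_cofibrant: "X \<in> Q \<Longrightarrow> Y \<in> R \<Longrightarrow> X \<in> W \<Longrightarrow> Ext1_zero C X Y"
    and cofibrantI: "X \<in> Ob C \<Longrightarrow> (\<And>Y. Y \<in> R \<Longrightarrow> Y \<in> W \<Longrightarrow> Ext1_zero C X Y) \<Longrightarrow> X \<in> Q"
    and fibrantI: "Y \<in> Ob C \<Longrightarrow> (\<And>X. X \<in> Q \<Longrightarrow> X \<in> W \<Longrightarrow> Ext1_zero C X Y) \<Longrightarrow> Y \<in> R"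
    and cofibrant_cover: "A \<in> Ob C \<Longrightarrow> \<exists>i p. short_exact C i p \<and> Dom C i \<in> R \<and> Dom C i \<in> W \<and> Cod C i \<in> Q \<and> Cod C p = A"
    and fibrant_hull: "A \<in> Ob C \<Longrightarrow> \<exists>i p. short_exact C i p \<and> Cod C p \<in> Q \<and> Cod C p \<in> W \<and> Cod C i \<in> R \<and> Dom C i = A"
    and cofibrant_kernel: "short_exact C i p \<Longrightarrow> Cod C i \<in> Q \<Longrightarrow> Cod C p \<in> Q \<Longrightarrow> Dom C i \<in> Q"
    and fibrant_cokernel: "short_exact C i p \<Longrightarrow> Dom C i \<in> R \<Longrightarrow> Cod C i \<in> R \<Longrightarrow> Cod C p \<in> R"
begin

lemma model_dual: "model (opp C) R W Q"
proof (rule model.intro[OF dual])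
  show "model_axioms (opp C) R W Q"
  proof
    show "thick (opp C) W"
      unfolding thick_def opp_derived opp_simps
    proof (intro conjI allI impI; (elim conjE)?)
      show "W \<subseteq> Ob C" using W_thick by (simp add: thick_def)
      fix i p assume ses: "short_exact C p i"
      note t = W_thick[unfolded thick_def, THEN conjunct2, rule_format, OF ses]
      note m = sesD(3)[OF ses]
      show "Dom C p \<in> W" if "Cod C i \<in> W" "Dom C i \<in> W" using t that m by simp
      show "Dom C i \<in> W" if "Cod C i \<in> W" "Dom C p \<in> W" using t that m by simp
      show "Cod C i \<in> W" if "Dom C i \<in> W" "Dom C p \<in> W" using t that m by simp
    qed
  next
    fix A assume "A \<in> Ob (opp C)"
    then show "\<exists>i p. short_exact (opp C) i p \<and> Dom (opp C) i \<in> Q \<and> Dom (opp C) i \<in> W \<and> Cod (opp C) i \<in> R \<and> Cod (opp C) p = A"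
      "\<exists>i p. short_exact (opp C) i p \<and> Cod (opp C) p \<in> R \<and> Cod (opp C) p \<in> W \<and> Cod (opp C) i \<in> Q \<and> Dom (opp C) i = A"
      using fibrant_hull[of A] cofibrant_cover[of A] sesD(3) by (simp, metis)+
  next
    fix i p assume "short_exact (opp C) i p" "Cod (opp C) i \<in> R" "Cod (opp C) p \<in> R"
    then show "Dom (opp C) i \<in> R" using fibrant_cokernel[of p i] sesD(3)[of p i] by simp
  next
    fix i p assume "short_exact (opp C) i p" "Dom (opp C) i \<in> Q" "Cod (opp C) i \<in> Q"
    then show "Cod (opp C) p \<in> Q" using cofibrant_kernel[of p i] sesD(3)[of p i] by simp
  qed (use QR_Ob in \<open>auto simp: Ext1_zero_opp orth_trivially_fibrant orth_trivially_cofibrant intro: cofibrantI fibrantI\<close>)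
qed

lemma W_Ob: "W \<subseteq> Ob C" using W_thick by (simp add: thick_def)

lemma W_closed:
  assumes "short_exact C i p"
  shows "Dom C i \<in> W \<Longrightarrow> Cod C i \<in> W \<Longrightarrow> Cod C p \<in> W"
    and "Dom C i \<in> W \<Longrightarrow> Cod C p \<in> W \<Longrightarrow> Cod C i \<in> W"
    and "Cod C i \<in> W \<Longrightarrow> Cod C p \<in> W \<Longrightarrow> Dom C i \<in> W"
  using W_thick assms unfolding thick_def by blast+

lemma cofibrant_extension:
  assumes "short_exact C i p" "Dom C i \<in> Q" "Cod C p \<in> Q"
  shows "Cod C i \<in> Q"
  using Ext1_zero_extension[OF _ _ assms(1) refl refl] orth_trivially_fibrant assms
  by (intro cofibrantI) (auto simp: sesD(1))

lemma fibrant_extension: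
  assumes "short_exact C i p" "Dom C i \<in> R" "Cod C p \<in> R"
  shows "Cod C i \<in> R"
  using model.cofibrant_extension[OF model_dual, of p i] assms sesD(3)[OF assms(1)] by simp

end

text \<open>The two closure properties come from vanishing of Ext in degrees one and two; membership
  in the classes is then recognised by the orthogonality that defines a cotorsion pair.\<close>

lemma hereditary_abelian_model_model:
  assumes "abelian_category C" and h: "hereditary_abelian_model C M"
  shows "model C (cofibrant M) (trivial M) (fibrant M)"
proof -
  interpret abelian_category C by fact
  have th: "thick C (trivial M)"
    and ct: "cotorsion_pair C (cofibrant M) (trivially_fibrant M)" "cotorsion_pair C (trivially_cofibrant M) (fibrant M)"
    and cp: "complete_pair C (cofibrant M) (trivially_fibrant M)" "complete_pair C (trivially_cofibrant M) (fibrant M)"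
    and hp: "hereditary_pair C (cofibrant M) (trivially_fibrant M)" "hereditary_pair C (trivially_cofibrant M) (fibrant M)"
    using h unfolding hereditary_abelian_model_def by blast+
  have sub: "cofibrant M \<subseteq> Ob C" "trivially_fibrant M \<subseteq> Ob C" "trivially_cofibrant M \<subseteq> Ob C" "fibrant M \<subseteq> Ob C"
    using ct unfolding cotorsion_pair_def by blast+
  have v3: "Ext_vanishes C n X Y" if "X \<in> cofibrant M" "Y \<in> trivially_fibrant M" "n \<ge> 1" for X Y n
    using that hp(1) unfolding hereditary_pair_def by blast
  have v4: "Ext_vanishes C n X Y" if "X \<in> trivially_cofibrant M" "Y \<in> fibrant M" "n \<ge> 1" for X Y n
    using that hp(2) unfolding hereditary_pair_def by blast
  have v1: "Ext1_zero C X Y" if "X \<in> cofibrant M" "Y \<in> trivially_fibrant M" for X Y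
    using v3[OF that, of 1] Ext_vanishes_1[of X Y] sub that by blast
  have v2: "Ext1_zero C X Y" if "X \<in> trivially_cofibrant M" "Y \<in> fibrant M" for X Y
    using v4[OF that, of 1] Ext_vanishes_1[of X Y] sub that by blast
  have c1: "X \<in> cofibrant M" if "X \<in> Ob C" "\<And>Y. Y \<in> trivially_fibrant M \<Longrightarrow> Ext1_zero C X Y" for X
  proof -
    have "cofibrant M = {X \<in> Ob C. \<forall>Y\<in>trivially_fibrant M. Ext_vanishes C 1 X Y}"
      using ct(1) unfolding cotorsion_pair_def by blast
    moreover have "\<forall>Y\<in>trivially_fibrant M. Ext_vanishes C 1 X Y"
      using that Ext_vanishes_1[of X] sub by blast
    ultimately show ?thesis using that(1) by blast
  qed
  have c2: "Y \<in> fibrant M" if "Y \<in> Ob C" "\<And>X. X \<in> trivially_cofibrant M \<Longrightarrow> Ext1_zero C X Y" for Y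
  proof -
    have "fibrant M = {Y \<in> Ob C. \<forall>X\<in>trivially_cofibrant M. Ext_vanishes C 1 X Y}"
      using ct(2) unfolding cotorsion_pair_def by blast
    moreover have "\<forall>X\<in>trivially_cofibrant M. Ext_vanishes C 1 X Y"
      using that Ext_vanishes_1[of _ Y] sub by blast
    ultimately show ?thesis using that(1) by blast
  qed
  show ?thesis
  proof
    fix i p assume s: "short_exact C i p"
    show "Dom C i \<in> cofibrant M" if "Cod C i \<in> cofibrant M" "Cod C p \<in> cofibrant M"
    proof (rule c1)
      fix Y assume Y: "Y \<in> trivially_fibrant M"
      show "Ext1_zero C (Dom C i) Y" by (rule Ext1_zero_kernel[OF v3[OF that(2) Y] v1[OF that(1) Y] s]) simp
    qed (use sesD[OF s] in simp)
    show "Cod C p \<in> fibrant M" if "Dom C i \<in> fibrant M" "Cod C i \<in> fibrant M"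
    proof (rule c2)
      fix X assume X: "X \<in> trivially_cofibrant M"
      show "Ext1_zero C X (Cod C p)" by (rule Ext1_zero_cokernel[OF v4[OF X that(1)] v2[OF X that(2)] s]) simp
    qed (use sesD[OF s] in simp)
  next
    fix A assume A: "A \<in> Ob C"
    show "\<exists>i p. short_exact C i p \<and> Dom C i \<in> fibrant M \<and> Dom C i \<in> trivial M \<and> Cod C i \<in> cofibrant M \<and> Cod C p = A"
      using cp(1) A unfolding complete_pair_def trivially_fibrant_def by blast
    show "\<exists>i p. short_exact C i p \<and> Cod C p \<in> cofibrant M \<and> Cod C p \<in> trivial M \<and> Cod C i \<in> fibrant M \<and> Dom C i = A"
      using cp(2) A unfolding complete_pair_def trivially_cofibrant_def by blast
  next
    show "cofibrant M \<subseteq> Ob C" "fibrant M \<subseteq> Ob C" "thick C (trivial M)" by (fact sub th)+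
    show "Ext1_zero C X Y" if "X \<in> cofibrant M" "Y \<in> fibrant M" "Y \<in> trivial M" for X Y
      by (rule v1) (use that in \<open>simp_all add: trivially_fibrant_def\<close>)
    show "Ext1_zero C X Y" if "X \<in> cofibrant M" "Y \<in> fibrant M" "X \<in> trivial M" for X Y
      by (rule v2) (use that in \<open>simp_all add: trivially_cofibrant_def\<close>)
    show "X \<in> cofibrant M"
      if "X \<in> Ob C" "\<And>Y. Y \<in> fibrant M \<Longrightarrow> Y \<in> trivial M \<Longrightarrow> Ext1_zero C X Y" for X
      by (rule c1) (use that in \<open>auto simp: trivially_fibrant_def\<close>)
    show "Y \<in> fibrant M"
      if "Y \<in> Ob C" "\<And>X. X \<in> cofibrant M \<Longrightarrow> X \<in> trivial M \<Longrightarrow> Ext1_zero C X Y" for Y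
      by (rule c2) (use that in \<open>auto simp: trivially_cofibrant_def\<close>)
  qed
qed

section \<open>Stably trivial morphisms\<close>

text \<open>Factorisation through any trivial object, instead of one in the core, is stable under
  composition, sums and duality for arbitrary ends. From a cofibrant to a fibrant object the two
  notions agree by \<open>null_through_core\<close>.\<close>

definition null_map :: "('o, 'm) additive_cat \<Rightarrow> 'o set \<Rightarrow> 'm \<Rightarrow> bool" where
  "null_map C W f \<longleftrightarrow> (\<exists>u\<in>Ar C. \<exists>v\<in>Ar C. Dom C v = Cod C u \<and> Cod C u \<in> W \<and> f = v \<cdot>\<^bsub>C\<^esub> u)"

lemma null_map_opp [simp]: "null_map (opp C) W f = null_map C W f"
  unfolding null_map_def opp_simps by metis

definition trivial_ses :: "('o, 'm) additive_cat \<Rightarrow> 'o set \<Rightarrow> 'o set \<Rightarrow> 'o set \<Rightarrow> 'm \<Rightarrow> 'm \<Rightarrow> bool" where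
  "trivial_ses C Q W R j s \<longleftrightarrow> short_exact C j s \<and> Dom C j \<in> Q \<inter> R \<and> Cod C j \<in> W \<and> Cod C s \<in> Q \<inter> R"

definition cofibrant_map :: "('o, 'm) additive_cat \<Rightarrow> 'o set \<Rightarrow> 'o set \<Rightarrow> 'o set \<Rightarrow> 'm \<Rightarrow> bool" where
  "cofibrant_map C Q W R q \<longleftrightarrow> Dom C q \<in> Q \<and> (\<exists>k. short_exact C k q \<and> Dom C k \<in> R \<and> Dom C k \<in> W)"

definition fibrant_map :: "('o, 'm) additive_cat \<Rightarrow> 'o set \<Rightarrow> 'o set \<Rightarrow> 'o set \<Rightarrow> 'm \<Rightarrow> bool" where
  "fibrant_map C Q W R r \<longleftrightarrow> Cod C r \<in> R \<and> (\<exists>c. short_exact C r c \<and> Cod C c \<in> Q \<and> Cod C c \<in> W)"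

context model
begin

abbreviation "null \<equiv> null_map C W"
abbreviation "tri \<equiv> trivial_ses C Q W R"
abbreviation "cof_repl \<equiv> cofibrant_map C Q W R"
abbreviation "fib_repl \<equiv> fibrant_map C Q W R"

definition stably_eq (infix "\<approx>" 50) where
  "f \<approx> g \<longleftrightarrow> f \<in> Ar C \<and> g \<in> Ar C \<and> Dom C f = Dom C g \<and> Cod C f = Cod C g \<and> null (f \<ominus> g)"

lemma nullI: "u \<in> Ar C \<Longrightarrow> v \<in> Ar C \<Longrightarrow> Dom C v = Cod C u \<Longrightarrow> Cod C u \<in> W \<Longrightarrow> null (v \<cdot> u)"
  unfolding null_map_def by blast

lemma null_Ar: "null f \<Longrightarrow> f \<in> Ar C"
  unfolding null_map_def by auto

lemma null_zero: "A \<in> Ob C \<Longrightarrow> B \<in> Ob C \<Longrightarrow> null \<zero>\<^bsub>A,B\<^esub>"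
proof -
  assume AB [simp]: "A \<in> Ob C" "B \<in> Ob C"
  obtain V where V: "V \<in> W" using cofibrant_cover[OF AB(1)] by blast
  have [simp]: "V \<in> Ob C" using V W_Ob by blast
  show ?thesis using nullI[of "\<zero>\<^bsub>A,V\<^esub>" "\<zero>\<^bsub>V,B\<^esub>"] V by simp
qed

lemma null_cmp_left:
  assumes "null f" "g \<in> Ar C" "Dom C g = Cod C f"
  shows "null (g \<cdot> f)"
proof -
  obtain u v where uv: "u \<in> Ar C" "v \<in> Ar C" "Dom C v = Cod C u" "Cod C u \<in> W" "f = v \<cdot> u"
    using assms(1) unfolding null_map_def by blast
  then show ?thesis using nullI[of u "g \<cdot> v"] assms by simp
qed

lemma null_cmp_right:
  assumes "null f" "h \<in> Ar C" "Dom C f = Cod C h"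
  shows "null (f \<cdot> h)"
proof -
  obtain u v where uv: "u \<in> Ar C" "v \<in> Ar C" "Dom C v = Cod C u" "Cod C u \<in> W" "f = v \<cdot> u"
    using assms(1) unfolding null_map_def by blast
  then show ?thesis using nullI[of "u \<cdot> h" v] assms by simp
qed

lemma null_neg:
  assumes "null f"
  shows "null (neg f)"
proof -
  obtain u v where uv: "u \<in> Ar C" "v \<in> Ar C" "Dom C v = Cod C u" "Cod C u \<in> W" "f = v \<cdot> u"
    using assms(1) unfolding null_map_def by blast
  then show ?thesis using nullI[of u "neg v"] assms by simp
qed

text \<open>The two factorisations are combined through the biproduct of their middle objects, which
  is trivial as an extension of trivial objects.\<close>

lemma null_plus:
  assumes "null f" "null g" "Dom C f = Dom C g" "Cod C f = Cod C g"
  shows "null (f \<oplus> g)"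
proof -
  obtain u v where uv: "u \<in> Ar C" "v \<in> Ar C" "Dom C v = Cod C u" "Cod C u \<in> W" "f = v \<cdot> u"
    using assms(1) unfolding null_map_def by blast
  obtain u' v' where uv': "u' \<in> Ar C" "v' \<in> Ar C" "Dom C v' = Cod C u'" "Cod C u' \<in> W" "g = v' \<cdot> u'"
    using assms(2) unfolding null_map_def by blast
  obtain i p j q where b: "ses i q" "Dom C i = Cod C u" "Dom C j = Cod C u'" "Cod C j = Cod C i"
    "Cod C q = Cod C u'" "Cod C p = Cod C u" "p \<cdot> i = Idt C (Cod C u)" "q \<cdot> j = Idt C (Cod C u')" "ses j p"
    by (rule biproduct_ses[of "Cod C u" "Cod C u'"]) (use uv uv' in auto)
  note [simp] = sesD[OF b(1)] sesD[OF b(9)] b(2-8) uv(1-3) uv'(1-3)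
  have d: "Dom C u' = Dom C u" "Cod C v' = Cod C v" using assms(3,4) uv uv' by simp_all
  define x y where "x = i \<cdot> u \<oplus> j \<cdot> u'" and "y = v \<cdot> p \<oplus> v' \<cdot> q"
  have xy: "x \<in> Ar C" "y \<in> Ar C" "Cod C x = Cod C i" "Dom C x = Dom C u" "Dom C y = Cod C i"
    using d by (simp_all add: x_def y_def)
  have "p \<cdot> x = u" "q \<cdot> x = u'"
    using d cmp_reduce[OF b(7), of u] cmp_reduce[OF b(8), of u'] cmp_reduce[OF sesD(4)[OF b(1)], of u]
      cmp_reduce[OF sesD(4)[OF b(9)], of u'] by (simp_all add: x_def)
  then have "y \<cdot> x = f \<oplus> g" using xy d uv(5) uv'(5) by (simp add: y_def)
  moreover have "Cod C x \<in> W" using W_closed(2)[OF b(1)] uv(4) uv'(4) xy by simp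
  ultimately show ?thesis using nullI[of x y] xy by simp
qed

lemma stD:
  assumes "f \<approx> g"
  shows "f \<in> Ar C" "g \<in> Ar C" "Dom C f = Dom C g" "Cod C f = Cod C g" "null (f \<ominus> g)"
  using assms by (simp_all add: stably_eq_def)

lemma st_refl: "f \<in> Ar C \<Longrightarrow> f \<approx> f"
  by (simp add: stably_eq_def null_zero)

lemma st_sym:
  assumes "f \<approx> g"
  shows "g \<approx> f"
proof -
  note d = stD[OF assms]
  have "neg (f \<ominus> g) = g \<ominus> f" using d(1-4) plus_comm[of "neg f" g] by simp
  then show ?thesis using null_neg[OF d(5)] d by (simp add: stably_eq_def)
qed

lemma st_trans [trans]:
  assumes "f \<approx> g" "g \<approx> h"
  shows "f \<approx> h"
proof -
  note d = stD[OF assms(1)] stD[OF assms(2)]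
  have "(f \<ominus> g) \<oplus> (g \<ominus> h) = f \<ominus> h" using d(1-4,6-9) by simp
  moreover have "null ((f \<ominus> g) \<oplus> (g \<ominus> h))" by (rule null_plus[OF d(5,10)]) (use d in simp_all)
  ultimately show ?thesis using d by (simp add: stably_eq_def)
qed

lemma st_cmp:
  assumes "f \<approx> f'" "g \<approx> g'" "Dom C g' = Cod C f'"
  shows "g \<cdot> f \<approx> g' \<cdot> f'"
proof -
  note d = stD(1-4)[OF assms(1)] stD(1-4)[OF assms(2)]
  have "g \<cdot> f \<approx> g \<cdot> f'"
    using null_cmp_left[OF stD(5)[OF assms(1)], of g] d assms(3) by (simp add: stably_eq_def)
  also have "g \<cdot> f' \<approx> g' \<cdot> f'"
    using null_cmp_right[OF stD(5)[OF assms(2)], of f'] d assms(3) by (simp add: stably_eq_def)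
  finally show ?thesis .
qed

lemma st_null: "f \<approx> g \<Longrightarrow> null g \<Longrightarrow> null f"
proof -
  assume a: "f \<approx> g" "null g"
  note d = stD[OF a(1)]
  have "g \<oplus> (f \<ominus> g) = f \<oplus> (g \<ominus> g)" by (rule plus_lcomm) (use d in simp_all)
  also have "\<dots> = f" using d by simp
  finally have "g \<oplus> (f \<ominus> g) = f" .
  moreover have "null (g \<oplus> (f \<ominus> g))" by (rule null_plus[OF a(2) d(5)]) (use d(1-4) in simp_all)
  ultimately show "null f" by (simp only:)
qed

lemma st_plus_null:
  assumes "f \<in> Ar C" "null h" "Dom C h = Dom C f" "Cod C h = Cod C f"
  shows "f \<oplus> h \<approx> f"
proof -
  have h: "h \<in> Ar C" using null_Ar assms by blast
  have "(f \<oplus> h) \<ominus> f = h" using sub_eq_iff[of "f \<oplus> h" f h] h assms by simp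
  then show ?thesis using assms h by (simp add: stably_eq_def)
qed

lemma st_plus:
  assumes "f \<approx> f'" "g \<approx> g'" "Dom C g' = Dom C f'" "Cod C g' = Cod C f'"
  shows "f \<oplus> g \<approx> f' \<oplus> g'"
proof -
  note d = stD(1-4)[OF assms(1)] stD(1-4)[OF assms(2)] assms(3,4)
  have "(f \<oplus> g) \<ominus> (f' \<oplus> g') = (f \<ominus> f') \<oplus> (g \<ominus> g')"
    using d plus_lcomm[of g "neg f'" "neg g'"] by simp
  then show ?thesis using null_plus[OF stD(5)[OF assms(1)] stD(5)[OF assms(2)]] d by (simp add: stably_eq_def)
qed

text \<open>Either of the two cotorsion pairs may supply the orthogonality; the disjunction records
  whether the source or the kernel is the trivial object.\<close>

lemma lift_cofibrant:
  assumes "X \<in> Q" "ses k g" "Dom C k \<in> R" "X \<in> W \<or> Dom C k \<in> W" "f \<in> Ar C" "Dom C f = X" "Cod C f = Cod C g"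
  obtains u where "u \<in> Ar C" "Dom C u = X" "Cod C u = Cod C k" "g \<cdot> u = f"
  using Ext1_zero_lift[OF _ assms(2) refl assms(5,6,7)] orth_trivially_fibrant orth_trivially_cofibrant assms(1,3,4)
  by metis

lemma extend_fibrant:
  assumes "Y \<in> R" "ses j c" "Cod C c \<in> Q" "Y \<in> W \<or> Cod C c \<in> W" "f \<in> Ar C" "Cod C f = Y" "Dom C f = Dom C j"
  obtains u where "u \<in> Ar C" "Cod C u = Y" "Dom C u = Cod C j" "u \<cdot> j = f"
  using Ext1_zero_extend[OF _ assms(2) refl assms(5,6,7)] orth_trivially_fibrant orth_trivially_cofibrant assms(1,3,4)
  by metis

text \<open>The trivial middle object is covered by a cofibrant one, through which the first factor
  lifts because its source is cofibrant; this is embedded in a fibrant one, to which the second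
  factor extends because its target is fibrant. The kernel and cokernel involved are trivial, and
  the cokernel is cofibrant, so the final object lies in the core.\<close>

lemma null_through_core:
  assumes "null f" "Dom C f \<in> Q" "Cod C f \<in> R"
  obtains u v where "u \<in> Ar C" "v \<in> Ar C" "Dom C v = Cod C u" "Cod C u \<in> Q" "Cod C u \<in> W" "Cod C u \<in> R" "f = v \<cdot> u"
proof -
  obtain u v where uv: "u \<in> Ar C" "v \<in> Ar C" "Dom C v = Cod C u" "Cod C u \<in> W" "f = v \<cdot> u"
    using assms(1) unfolding null_map_def by blast
  obtain k q where q: "ses k q" "Dom C k \<in> R" "Dom C k \<in> W" "Cod C k \<in> Q" "Cod C q = Cod C u"
    using cofibrant_cover[of "Cod C u"] uv by auto
  note [simp] = sesD[OF q(1)] uv(1-3)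
  have qW: "Cod C k \<in> W" using W_closed(2)[OF q(1)] q uv by simp
  obtain u1 where u1: "u1 \<in> Ar C" "Dom C u1 = Dom C u" "Cod C u1 = Cod C k" "q \<cdot> u1 = u"
    by (rule lift_cofibrant[OF _ q(1,2) _ uv(1) refl]) (use assms uv q in auto)
  obtain r c where r: "ses r c" "Cod C c \<in> Q" "Cod C c \<in> W" "Cod C r \<in> R" "Dom C r = Cod C k"
    using fibrant_hull[of "Cod C k"] by auto
  note [simp] = sesD[OF r(1)]
  obtain v1 where v1: "v1 \<in> Ar C" "Cod C v1 = Cod C v" "Dom C v1 = Cod C r" "v1 \<cdot> r = v \<cdot> q"
    by (rule extend_fibrant[OF _ r(1,2), of "Cod C v" "v \<cdot> q"]) (use assms uv q r in auto)
  have "v1 \<cdot> (r \<cdot> u1) = f" using cmp_reduce2[OF v1(4), of u1] u1 v1 r q uv(5) by simp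
  moreover have "Cod C r \<in> Q" "Cod C r \<in> W"
    using cofibrant_extension[OF r(1)] W_closed(2)[OF r(1)] r q qW by simp_all
  ultimately show ?thesis using that[of "r \<cdot> u1" v1] u1 v1 r by simp
qed

section \<open>Short exact sequences with bifibrant ends and trivial middle term\<close>

lemma ses_morphism_iff:
  "ses_morphism C (j, s) (j', s') a w c \<longleftrightarrow> a \<in> Ar C \<and> Dom C a = Dom C j \<and> Cod C a = Dom C j' \<and>
     w \<in> Ar C \<and> Dom C w = Cod C j \<and> Cod C w = Cod C j' \<and> c \<in> Ar C \<and> Dom C c = Cod C s \<and> Cod C c = Cod C s' \<and>
     w \<cdot> j = j' \<cdot> a \<and> c \<cdot> s = s' \<cdot> w"
  by (auto simp: ses_morphism_def Hom_iff)

lemma ses_morphism_opp: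
  assumes "ses j s" "ses j' s'"
  shows "ses_morphism (opp C) (s', j') (s, j) c w a \<longleftrightarrow> ses_morphism C (j, s) (j', s') a w c"
  using sesD(3)[OF assms(1)] sesD(3)[OF assms(2)] by (auto simp: ses_morphism_def Hom_iff)

lemma triD:
  assumes "tri j s"
  shows "ses j s" "Dom C j \<in> Q" "Dom C j \<in> R" "Cod C j \<in> W" "Cod C s \<in> Q" "Cod C s \<in> R"
    "Cod C j \<in> Q" "Cod C j \<in> R"
proof -
  show t: "ses j s" "Dom C j \<in> Q" "Dom C j \<in> R" "Cod C j \<in> W" "Cod C s \<in> Q" "Cod C s \<in> R"
    using assms by (auto simp: trivial_ses_def)
  show "Cod C j \<in> Q" "Cod C j \<in> R" using t cofibrant_extension fibrant_extension by blast+
qed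

lemma tri_opp: "trivial_ses (opp C) R W Q s j \<longleftrightarrow> tri j s"
  using sesD(3) by (auto simp: trivial_ses_def)

text \<open>The middle term of the target is fibrant and trivial and \<open>Cod C s\<close> is
  cofibrant, so \<open>j' \<cdot> f\<close> extends along \<open>j\<close>; the map of cokernels
  follows.\<close>

lemma tri_extend:
  assumes t: "tri j s" "tri j' s'" and f: "f \<in> Ar C" "Dom C f = Dom C j" "Cod C f = Dom C j'"
  shows "\<exists>w c. ses_morphism C (j, s) (j', s') f w c"
proof -
  note d = triD[OF t(1)] and d' = triD[OF t(2)]
  note [simp] = sesD[OF d(1)] sesD[OF d'(1)] f
  obtain w where w: "w \<in> Ar C" "Cod C w = Cod C j'" "Dom C w = Cod C j" "w \<cdot> j = j' \<cdot> f"
    by (rule extend_fibrant[OF _ d(1,5), of "Cod C j'" "j' \<cdot> f"]) (use d d' in auto)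
  have "s' \<cdot> (w \<cdot> j) = \<zero>\<^bsub>Dom C j,Cod C s'\<^esub>" unfolding w(4) using cmp_reduce[OF sesD(4)[OF d'(1)], of f] by simp
  then obtain c where c: "c \<in> Ar C" "Cod C c = Cod C s'" "Dom C c = Cod C s" "c \<cdot> s = s' \<cdot> w"
    using ses_colift[OF d(1), of "s' \<cdot> w"] w by auto
  then show ?thesis unfolding ses_morphism_iff using w by auto
qed

lemma tri_lift:
  assumes t: "tri j s" "tri j' s'" and f: "f \<in> Ar C" "Dom C f = Cod C s" "Cod C f = Cod C s'"
  shows "\<exists>a w. ses_morphism C (j, s) (j', s') a w f"
proof -
  note d = sesD(3)[OF triD(1)[OF t(1)]] sesD(3)[OF triD(1)[OF t(2)]]
  have "\<exists>w c. ses_morphism (opp C) (s', j') (s, j) f w c"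
    using model.tri_extend[OF model_dual, of s' j' s j f] t f d by (simp add: tri_opp)
  then show ?thesis using ses_morphism_opp triD(1) t by metis
qed

text \<open>Let \<open>a = v \<cdot> u\<close> factor through the core, and extend \<open>u\<close>
  along \<open>j\<close> to \<open>u1\<close>. The difference of \<open>w\<close> and
  \<open>j' \<cdot> (v \<cdot> u1)\<close> vanishes on \<open>j\<close>, so it is
  \<open>h \<cdot> s\<close>, and on cokernels only \<open>c = s' \<cdot> h\<close> remains, a
  factorisation through the trivial middle term.\<close>

lemma tri_null_right:
  assumes t: "tri j s" "tri j' s'" and m: "ses_morphism C (j, s) (j', s') a w c" and a: "null a"
  shows "null c"
proof -
  note d = triD[OF t(1)] and d' = triD[OF t(2)]
  note m' = m[unfolded ses_morphism_iff]
  note [simp] = sesD[OF d(1)] sesD[OF d'(1)]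
  obtain u v where uv: "u \<in> Ar C" "v \<in> Ar C" "Dom C v = Cod C u" "Cod C u \<in> Q" "Cod C u \<in> W" "Cod C u \<in> R" "a = v \<cdot> u"
    using null_through_core[OF a] m' d d' by metis
  have du: "Dom C u = Dom C j" "Cod C v = Dom C j'" using m' uv by auto
  obtain u1 where u1: "u1 \<in> Ar C" "Cod C u1 = Cod C u" "Dom C u1 = Cod C j" "u1 \<cdot> j = u"
    by (rule extend_fibrant[OF _ d(1,5), of "Cod C u" u]) (use uv du in auto)
  have "(j' \<cdot> (v \<cdot> u1)) \<cdot> j = w \<cdot> j" using m' u1 uv du by simp
  then obtain h where h: "h \<in> Ar C" "Cod C h = Cod C j'" "Dom C h = Cod C s" "w = (j' \<cdot> (v \<cdot> u1)) \<oplus> (h \<cdot> s)"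
    using ses_codiff[OF d(1), of w "j' \<cdot> (v \<cdot> u1)"] m' uv du u1 by auto
  have "c \<cdot> s = s' \<cdot> w" using m' by simp
  also have "\<dots> = (s' \<cdot> h) \<cdot> s"
    unfolding h(4) using h(1-3) uv(1-3) du u1(1-3) cmp_reduce[OF sesD(4)[OF d'(1)], of "v \<cdot> u1"] by simp
  finally have "c = s' \<cdot> h" by (rule epi_cancel[OF sesD(6)[OF d(1)]]) (use m' h in auto)
  then show ?thesis using nullI[of h s'] h d'(4) by simp
qed

lemma tri_null_iff:
  assumes t: "tri j s" "tri j' s'" and m: "ses_morphism C (j, s) (j', s') a w c"
  shows "null a \<longleftrightarrow> null c"
  using tri_null_right[OF t m] model.tri_null_right[OF model_dual, of s' j' s j c w a] t m
    ses_morphism_opp[OF triD(1)[OF t(1)] triD(1)[OF t(2)]] by (auto simp: tri_opp)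

lemma ses_morphism_sub:
  assumes ses: "ses j s" "ses j' s'"
    and m: "ses_morphism C (j, s) (j', s') a w c" "ses_morphism C (j, s) (j', s') a' w' c'"
  shows "ses_morphism C (j, s) (j', s') (a \<ominus> a') (w \<ominus> w') (c \<ominus> c')"
  using m sesD[OF ses(1)] sesD[OF ses(2)] unfolding ses_morphism_iff by auto

lemma ses_morphism_plus:
  assumes ses: "ses j s" "ses j' s'"
    and m: "ses_morphism C (j, s) (j', s') a w c" "ses_morphism C (j, s) (j', s') a' w' c'"
  shows "ses_morphism C (j, s) (j', s') (a \<oplus> a') (w \<oplus> w') (c \<oplus> c')"
  using m sesD[OF ses(1)] sesD[OF ses(2)] unfolding ses_morphism_iff by auto

lemma ses_morphism_cmp:
  assumes ses: "ses j s" "ses j' s'" "ses j'' s''"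
    and m: "ses_morphism C (j, s) (j', s') a w c" "ses_morphism C (j', s') (j'', s'') a' w' c'"
  shows "ses_morphism C (j, s) (j'', s'') (a' \<cdot> a) (w' \<cdot> w) (c' \<cdot> c)"
proof -
  note [simp] = sesD[OF ses(1)] sesD[OF ses(2)] sesD[OF ses(3)]
  note m1 = m(1)[unfolded ses_morphism_iff] and m2 = m(2)[unfolded ses_morphism_iff]
  have "w' \<cdot> (w \<cdot> j) = j'' \<cdot> (a' \<cdot> a)" using m1 m2 cmp_reduce2[of w' j' j'' a' a] by simp
  moreover have "c' \<cdot> (c \<cdot> s) = s'' \<cdot> (w' \<cdot> w)" using m1 m2 cmp_reduce2[of c' s' s'' w' w] by simp
  ultimately show ?thesis using m1 m2 unfolding ses_morphism_iff by simp
qed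

lemma ses_morphism_Idt:
  assumes "ses j s"
  shows "ses_morphism C (j, s) (j, s) (Idt C (Dom C j)) (Idt C (Cod C j)) (Idt C (Cod C s))"
  using sesD[OF assms] unfolding ses_morphism_iff by simp

text \<open>Nullity of one end of the difference of the two morphisms is nullity of the other, so
  each end of a morphism of such sequences determines the other stably.\<close>

lemma tri_st_iff:
  assumes t: "tri j s" "tri j' s'"
    and m: "ses_morphism C (j, s) (j', s') a w c" "ses_morphism C (j, s) (j', s') a' w' c'"
  shows "a \<approx> a' \<longleftrightarrow> c \<approx> c'"
  using tri_null_iff[OF t ses_morphism_sub[OF triD(1)[OF t(1)] triD(1)[OF t(2)] m]] m
  unfolding ses_morphism_iff stably_eq_def by auto

section \<open>Bifibrant replacements of short exact sequences\<close>

lemma cofibrant_map_opp [simp]: "cofibrant_map (opp C) R W Q r \<longleftrightarrow> fib_repl r"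
  by (auto simp: cofibrant_map_def fibrant_map_def)

text \<open>Let \<open>P\<close> be the pullback of \<open>W \<rightarrow> Z\<close> and \<open>QZ \<rightarrow> Z\<close>, and \<open>QP \<rightarrow> P\<close> a cofibrant replacement. The kernel of
  \<open>QP \<rightarrow> QZ\<close> is cofibrant because the model structure is hereditary, so its map to \<open>X\<close> lifts to \<open>QX\<close>; pushing
  \<open>QP\<close> out along this lift gives the middle term.\<close>
lemma cofibrant_ses:
  assumes ses: "ses i p" and qX: "cof_repl qX" "Cod C qX = Dom C i"
    and qZ: "cof_repl qZ" "Cod C qZ = Cod C p"
  shows "\<exists>q i' p'. cof_repl q \<and> Cod C q = Cod C i \<and> ses i' p' \<and> Dom C i' = Dom C qX \<and>
    Cod C i' = Dom C q \<and> Cod C p' = Dom C qZ \<and> q \<cdot> i' = i \<cdot> qX \<and> qZ \<cdot> p' = p \<cdot> q"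
proof -
  obtain kX where kX: "ses kX qX" "Dom C kX \<in> R" "Dom C kX \<in> W" "Dom C qX \<in> Q"
    using qX by (auto simp: cofibrant_map_def)
  obtain kZ where kZ: "ses kZ qZ" "Dom C kZ \<in> R" "Dom C kZ \<in> W" "Dom C qZ \<in> Q"
    using qZ by (auto simp: cofibrant_map_def)
  note [simp] = sesD[OF ses] qX(2) qZ(2)
  have [simp]: "qX \<in> Ar C" "is_epi C qX" "qZ \<in> Ar C" "is_epi C qZ" using sesD[OF kX(1)] sesD[OF kZ(1)] by simp_all
  obtain kZ' p1 q1 where P: "ses kZ' q1" "Dom C kZ' = Dom C kZ" "Cod C q1 = Cod C i" 
     "p1 \<in> Ar C" "Dom C p1 = Cod C kZ'" "Cod C p1 = Cod C kZ" "p1 \<cdot> kZ' = kZ" "qZ \<cdot> p1 = p \<cdot> q1"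
    and un: "\<And>x y. x \<in> Ar C \<Longrightarrow> y \<in> Ar C \<Longrightarrow> Cod C x = Cod C kZ \<Longrightarrow> Cod C y = Dom C p \<Longrightarrow> Dom C y = Dom C x \<Longrightarrow>
       qZ \<cdot> x = p \<cdot> y \<Longrightarrow> \<exists>u\<in>Ar C. Dom C u = Dom C x \<and> Cod C u = Cod C kZ' \<and> p1 \<cdot> u = x \<and> q1 \<cdot> u = y"
    and jo: "\<And>x y. x \<in> Ar C \<Longrightarrow> y \<in> Ar C \<Longrightarrow> Cod C x = Cod C kZ' \<Longrightarrow> Cod C y = Cod C kZ' \<Longrightarrow>
       p1 \<cdot> x = p1 \<cdot> y \<Longrightarrow> q1 \<cdot> x = q1 \<cdot> y \<Longrightarrow> x = y"
    by (rule ses_pullback[OF kZ(1), of p]) auto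
  note [simp] = sesD[OF P(1)] P(2-6)
  have kZc: "Cod C kZ = Dom C qZ" using sesD(3)[OF kZ(1)] by simp
  obtain i1 where i1: "i1 \<in> Ar C" "Dom C i1 = Dom C i" "Cod C i1 = Cod C kZ'" "p1 \<cdot> i1 = \<zero>\<^bsub>Dom C i,Dom C qZ\<^esub>" "q1 \<cdot> i1 = i"
    using un[of "\<zero>\<^bsub>Dom C i,Dom C qZ\<^esub>" i] kZc by auto
  note [simp] = i1(1-3)
  have p1e: "is_epi C p1"
  proof -
    obtain e y where y: "is_epi C e" "y \<in> Ar C" "Cod C e = Dom C qZ" "Cod C y = Dom C p" "Dom C y = Dom C e" "p \<cdot> y = qZ \<cdot> e"
      by (rule lift_cover[of p qZ]) auto
    then obtain u where "u \<in> Ar C" "Cod C u = Cod C kZ'" "p1 \<cdot> u = e" using un[of e y] kZc by auto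
    then show ?thesis using epi_factor[of p1 u] y(1) by simp
  qed
  have s1: "ses i1 p1"
  proof (rule ses_kernelI[OF kernelI p1e])
    show "is_mono C i1" by (rule mono_factor[of q1]) (simp_all add: i1(5))
    fix x assume x: "x \<in> Ar C" "Cod C x = Cod C i1" "p1 \<cdot> x = \<zero>\<^bsub>Dom C x,Cod C p1\<^esub>"
    have "p \<cdot> (q1 \<cdot> x) = qZ \<cdot> (p1 \<cdot> x)" using cmp_reduce2[OF P(8), of x] x(1,2) kZc by simp
    also have "\<dots> = \<zero>\<^bsub>Dom C x,Cod C p\<^esub>" using x kZc by simp
    finally obtain y where y: "y \<in> Ar C" "Dom C y = Dom C x" "Cod C y = Dom C i" "i \<cdot> y = q1 \<cdot> x"
      using ses_lift[OF ses, of "q1 \<cdot> x"] x by auto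
    have "i1 \<cdot> y = x"
      by (rule jo) (use x y kZc cmp_reduce[OF i1(4), of y] cmp_reduce[OF i1(5), of y] in simp_all)
    then show "\<exists>u\<in>Ar C. Dom C u = Dom C x \<and> Cod C u = Dom C i1 \<and> i1 \<cdot> u = x" using y by auto
  qed (use i1(4) kZc in simp_all)
  obtain k2 q2 where q2: "ses k2 q2" "Dom C k2 \<in> R" "Dom C k2 \<in> W" "Cod C k2 \<in> Q" "Cod C q2 = Cod C kZ'"
    using cofibrant_cover[of "Cod C kZ'"] by auto
  note [simp] = sesD[OF q2(1)] q2(5)
  have "is_epi C (p1 \<cdot> q2)" by (rule epi_cmp[OF _ p1e]) simp_all
  then obtain k where k: "ses k (p1 \<cdot> q2)" using epi_ses by blast
  note [simp] = sesD(1,5,6)[OF k]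
  have dk [simp]: "Cod C k = Cod C k2" using sesD(3)[OF k] by simp
  have pqk: "p1 \<cdot> (q2 \<cdot> k) = \<zero>\<^bsub>Dom C k,Dom C qZ\<^esub>" using sesD(4)[OF k] kZc by simp
  have kQ: "Dom C k \<in> Q" using cofibrant_kernel[OF k] q2(4) kZ(4) kZc by simp
  obtain e where e: "e \<in> Ar C" "Dom C e = Dom C k" "Cod C e = Dom C i" "i1 \<cdot> e = q2 \<cdot> k"
    using ses_lift[OF s1, of "q2 \<cdot> k"] pqk kZc by auto
  obtain g where g: "g \<in> Ar C" "Dom C g = Dom C k" "Cod C g = Cod C kX" "qX \<cdot> g = e"
    by (rule lift_cofibrant[OF kQ kX(1,2) _ e(1,2)]) (use kX e in auto)
  note [simp] = e(1-3) g(1-3)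
  have kXc [simp]: "Cod C kX = Dom C qX" using sesD(3)[OF kX(1)] by simp
  obtain i' p' m where E: "ses i' p'" "Cod C p' = Cod C (p1 \<cdot> q2)" "Dom C i' = Cod C g"
    "m \<in> Ar C" "Cod C m = Cod C i'" "Dom C m = Cod C k" "p' \<cdot> m = p1 \<cdot> q2" "m \<cdot> k = i' \<cdot> g"
    and eu: "\<And>x y. x \<in> Ar C \<Longrightarrow> y \<in> Ar C \<Longrightarrow> Dom C x = Cod C k \<Longrightarrow> Dom C y = Cod C g \<Longrightarrow> Cod C y = Cod C x \<Longrightarrow>
       x \<cdot> k = y \<cdot> g \<Longrightarrow> \<exists>u\<in>Ar C. Cod C u = Cod C x \<and> Dom C u = Cod C i' \<and> u \<cdot> m = x \<and> u \<cdot> i' = y"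
    and ej: "\<And>x y. x \<in> Ar C \<Longrightarrow> y \<in> Ar C \<Longrightarrow> Dom C x = Cod C i' \<Longrightarrow> Dom C y = Cod C i' \<Longrightarrow>
       x \<cdot> m = y \<cdot> m \<Longrightarrow> x \<cdot> i' = y \<cdot> i' \<Longrightarrow> x = y"
    by (rule ses_pushout[OF k, of g]) auto
  note [simp] = sesD[OF E(1)] E(2-6)
  have "q2 \<cdot> k = (i1 \<cdot> qX) \<cdot> g" using e(4) g(4) by simp
  then obtain t where t: "t \<in> Ar C" "Cod C t = Cod C kZ'" "Dom C t = Cod C i'" "t \<cdot> m = q2" "t \<cdot> i' = i1 \<cdot> qX"
    using eu[of q2 "i1 \<cdot> qX"] by auto
  note [simp] = t(1-3)
  have p1t: "p1 \<cdot> t = p'"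
  proof (rule ej)
    show "(p1 \<cdot> t) \<cdot> m = p' \<cdot> m" using t(4) E(7) by simp
    show "(p1 \<cdot> t) \<cdot> i' = p' \<cdot> i'" using t(5) cmp_reduce[OF i1(4), of qX] kZc by simp
  qed simp_all
  have te: "is_epi C t" by (rule epi_factor[of t m]) (simp_all add: t(4))
  \<comment> \<open>The map \<open>t\<close> from the pushout to the pullback restricts to
    \<open>i1 \<cdot> qX\<close> on \<open>i'\<close> and covers the identity of the quotient, so
    its kernel is that of \<open>qX\<close>.\<close>
  have st: "ses (i' \<cdot> kX) t"
  proof (rule ses_kernelI[OF kernelI te])
    show "is_mono C (i' \<cdot> kX)" by (rule mono_cmp) (use sesD(1,2,4,5)[OF kX(1)] in simp_all)
    show "t \<cdot> (i' \<cdot> kX) = \<zero>\<^bsub>Dom C (i' \<cdot> kX),Cod C t\<^esub>"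
    proof -
      have [simp]: "kX \<in> Ar C" by (rule sesD(1)[OF kX(1)])
      have "t \<cdot> (i' \<cdot> kX) = i1 \<cdot> (qX \<cdot> kX)" by (rule cmp_reduce2[OF t(5)]) simp_all
      also have "qX \<cdot> kX = \<zero>\<^bsub>Dom C kX,Cod C qX\<^esub>" by (rule sesD(4)[OF kX(1)])
      also have "i1 \<cdot> \<zero>\<^bsub>Dom C kX,Cod C qX\<^esub> = \<zero>\<^bsub>Dom C kX,Cod C i1\<^esub>" by simp
      finally show ?thesis by simp
    qed
    fix x assume x: "x \<in> Ar C" "Cod C x = Cod C (i' \<cdot> kX)" "t \<cdot> x = \<zero>\<^bsub>Dom C x,Cod C t\<^esub>"
    have xc [simp]: "Cod C x = Cod C i'" using x sesD(1,2,4,5)[OF kX(1)] by simp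
    have "p' \<cdot> x = \<zero>\<^bsub>Dom C x,Cod C p'\<^esub>" using cmp_reduce[OF p1t, of x] x(1,3) by simp
    then obtain y where y: "y \<in> Ar C" "Dom C y = Dom C x" "Cod C y = Dom C i'" "i' \<cdot> y = x"
      using ses_lift[OF E(1), of x] x(1) by auto
    have "i1 \<cdot> (qX \<cdot> y) = t \<cdot> (i' \<cdot> y)" by (rule cmp_reduce2[OF t(5), symmetric]) (simp_all add: y(1-3))
    also have "\<dots> = \<zero>\<^bsub>Dom C x,Cod C t\<^esub>" unfolding y(4) by (rule x(3))
    also have "\<dots> = i1 \<cdot> \<zero>\<^bsub>Dom C y,Dom C i\<^esub>" using x(1) y(2) by simp
    finally have "qX \<cdot> y = \<zero>\<^bsub>Dom C y,Dom C i\<^esub>"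
      by (rule mono_cancel[OF sesD(5)[OF s1]]) (use x(1) y(1-3) in simp_all)
    then obtain z where "z \<in> Ar C" "Dom C z = Dom C y" "Cod C z = Dom C kX" "kX \<cdot> z = y"
      using ses_lift[OF kX(1), of y] y(1-3) by auto
    then show "\<exists>u\<in>Ar C. Dom C u = Dom C x \<and> Cod C u = Dom C (i' \<cdot> kX) \<and> (i' \<cdot> kX) \<cdot> u = x"
      using y sesD(1)[OF kX(1)] by (intro bexI[of _ z]) auto
  qed (use sesD(1,2,4,5)[OF kX(1)] in simp_all)
  \<comment> \<open>The replacement of the middle term is \<open>q1 \<cdot> t\<close>. Its kernel is
    an extension of the kernel of \<open>qZ\<close> by that of \<open>qX\<close>, hence fibrant and
    trivial.\<close>
  obtain k' h l where l: "ses k' h" "Dom C k' = Dom C (i' \<cdot> kX)" "Cod C h = Dom C kZ'"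
    "ses l (q1 \<cdot> t)" "Dom C l = Cod C k'"
    by (rule ses_pullback_mono[OF st P(1)]) simp_all
  have dd: "Dom C k' = Dom C kX" using l(2) sesD(1)[OF kX(1)] by simp
  have "Dom C l \<in> R" "Dom C l \<in> W"
    using fibrant_extension[OF l(1)] W_closed(2)[OF l(1)] l(3,5) dd kX kZ by simp_all
  moreover have "Cod C i' \<in> Q" using cofibrant_extension[OF E(1)] kX(4) kZ(4) kZc by simp
  ultimately have "cof_repl (q1 \<cdot> t)" unfolding cofibrant_map_def using l(4) by auto
  moreover have "(q1 \<cdot> t) \<cdot> i' = i \<cdot> qX" using t(5) cmp_reduce[OF i1(5), of qX] by simp
  moreover have "qZ \<cdot> p' = p \<cdot> (q1 \<cdot> t)" using p1t[symmetric] cmp_reduce2[OF P(8), of t] kZc by simp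
  ultimately show ?thesis using E(1) kZc by (intro exI[of _ "q1 \<cdot> t"] exI[of _ i'] exI[of _ p']) simp
qed

lemma fibrant_ses:
  assumes ses: "ses i p" and rX: "fib_repl rX" "Dom C rX = Dom C i"
    and rZ: "fib_repl rZ" "Dom C rZ = Cod C p"
  shows "\<exists>r j s. fib_repl r \<and> Dom C r = Cod C i \<and> ses j s \<and> Dom C j = Cod C rX \<and>
    Cod C j = Cod C r \<and> Cod C s = Cod C rZ \<and> r \<cdot> i = j \<cdot> rX \<and> s \<cdot> r = rZ \<cdot> p"
proof -
  obtain q i' p' where "cofibrant_map (opp C) R W Q q" "Cod (opp C) q = Cod (opp C) p" "short_exact (opp C) i' p'"
    "Dom (opp C) i' = Dom (opp C) rZ" "Cod (opp C) i' = Dom (opp C) q" "Cod (opp C) p' = Dom (opp C) rX"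
    "q \<cdot>\<^bsub>opp C\<^esub> i' = p \<cdot>\<^bsub>opp C\<^esub> rZ" "rX \<cdot>\<^bsub>opp C\<^esub> p' = i \<cdot>\<^bsub>opp C\<^esub> q"
    using model.cofibrant_ses[OF model_dual, of p i rZ rX] assms by auto
  then show ?thesis using sesD(3)[OF ses] sesD(3)[of p' i'] by (intro exI[of _ q] exI[of _ p'] exI[of _ i']) simp
qed

text \<open>A core factorisation of \<open>f \<cdot> r\<close> extends along \<open>r\<close>, whose
  cokernel is cofibrant; the difference from \<open>f\<close> vanishes on \<open>r\<close> and
  therefore factors through that cokernel, which is trivial.\<close>

lemma null_fibrant_map:
  assumes r: "fib_repl r" "Dom C r \<in> Q" and f: "f \<in> Ar C" "Dom C f = Cod C r" "Cod C f \<in> R" and n: "null (f \<cdot> r)"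
  shows "null f"
proof -
  obtain c where c: "ses r c" "Cod C c \<in> Q" "Cod C c \<in> W" using r by (auto simp: fibrant_map_def)
  note [simp] = sesD[OF c(1)] f(1,2)
  obtain u v where uv: "u \<in> Ar C" "v \<in> Ar C" "Dom C v = Cod C u" "Cod C u \<in> Q" "Cod C u \<in> W" "Cod C u \<in> R" "f \<cdot> r = v \<cdot> u"
    by (rule null_through_core[OF n]) (use r f in auto)
  note [simp] = uv(1-3)
  have d: "Dom C u = Dom C r" "Cod C v = Cod C f"
    using cmp_Ar(2,3)[of r f] cmp_Ar(2,3)[of u v] unfolding uv(7) by simp_all
  obtain u1 where u1: "u1 \<in> Ar C" "Cod C u1 = Cod C u" "Dom C u1 = Cod C r" "u1 \<cdot> r = u"
    by (rule extend_fibrant[OF uv(6) c(1,2) _ uv(1)]) (use c d in auto)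
  have eq: "f \<cdot> r = (v \<cdot> u1) \<cdot> r" using u1 uv(7) by simp
  have vu: "v \<cdot> u1 \<in> Ar C" "Dom C (v \<cdot> u1) = Cod C r" "Cod C (v \<cdot> u1) = Cod C f" using u1 d by simp_all
  obtain t where t: "t \<in> Ar C" "Cod C t = Cod C (v \<cdot> u1)" "Dom C t = Cod C c" "f = v \<cdot> u1 \<oplus> t \<cdot> c"
    by (rule ses_codiff[OF c(1) eq f(1) vu(1) f(2) vu(2)])
  have "null (v \<cdot> u1)" "null (t \<cdot> c)" using nullI[of u1 v] nullI[of c t] u1(1-3) t(1,3) c(3) uv(5) by simp_all
  then have "null (v \<cdot> u1 \<oplus> t \<cdot> c)" by (rule null_plus) (use t(1-3) u1(1-3) d in simp_all)
  then show ?thesis using t(4) by simp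
qed

text \<open>The map \<open>b\<close> is lifted along \<open>q\<close> first. The failure of this
  lift on \<open>i\<close> lies in the trivially fibrant kernel of \<open>q\<close>, so it extends
  along \<open>i\<close>, whose cokernel is cofibrant, and can be subtracted.\<close>

lemma lift_square:
  assumes ses: "ses i p" "Cod C p \<in> Q" and kq: "ses k q" "Dom C k \<in> R" "Dom C k \<in> W"
    and ab: "a \<in> Ar C" "b \<in> Ar C" "Dom C a = Dom C i" "Cod C a = Cod C k" "Dom C b = Cod C i" "Cod C b = Cod C q"
    and sq: "q \<cdot> a = b \<cdot> i" and i: "Cod C i \<in> Q"
  obtains g where "g \<in> Ar C" "Dom C g = Cod C i" "Cod C g = Cod C k" "g \<cdot> i = a" "q \<cdot> g = b"
proof -
  note [simp] = sesD[OF ses(1)] sesD[OF kq(1)] ab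
  obtain g0 where g0: "g0 \<in> Ar C" "Dom C g0 = Cod C i" "Cod C g0 = Cod C k" "q \<cdot> g0 = b"
    by (rule lift_cofibrant[OF i kq(1,2) _ ab(2)]) (use kq in auto)
  note [simp] = g0(1-3)
  have "q \<cdot> (g0 \<cdot> i) = q \<cdot> a" using cmp_reduce[OF g0(4), of i] sq by simp
  then obtain t where t: "t \<in> Ar C" "Dom C t = Dom C a" "Cod C t = Dom C k" "g0 \<cdot> i = a \<oplus> k \<cdot> t"
    by (rule ses_diff[OF kq(1)]) auto
  obtain t' where t': "t' \<in> Ar C" "Cod C t' = Dom C k" "Dom C t' = Cod C i" "t' \<cdot> i = t"
    by (rule extend_fibrant[OF kq(2) ses _ t(1,3)]) (use t kq in auto)
  have "(g0 \<ominus> k \<cdot> t') \<cdot> i = (a \<oplus> k \<cdot> t) \<ominus> k \<cdot> t" using t' t(4) by simp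
  also have "\<dots> = a" using t(1-3) by simp
  finally have "(g0 \<ominus> k \<cdot> t') \<cdot> i = a" .
  moreover have "q \<cdot> (g0 \<ominus> k \<cdot> t') = b" using t'(1-3) g0(4) cmp_reduce[OF sesD(4)[OF kq(1)], of t'] by simp
  ultimately show ?thesis using that[of "g0 \<ominus> k \<cdot> t'"] t'(1-3) by simp
qed

text \<open>\<open>RQX \<rightarrow> T \<rightarrow> RQZ\<close> with \<open>T\<close> in the core, compatible with \<open>(i, p)\<close> through replacements \<open>qX\<close>, \<open>rX\<close> of \<open>X\<close> and
  \<open>qZ\<close>, \<open>rZ\<close> of \<open>Z\<close>.\<close>
definition bifibrant_ses where
  "bifibrant_ses i p qX rX qZ rZ j s \<longleftrightarrow> ses j s \<and> Cod C j \<in> Q \<inter> W \<inter> R \<and>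
     Dom C j = Cod C rX \<and> Cod C s = Cod C rZ \<and>
     (\<exists>q r i' p'. cof_repl q \<and> Cod C q = Cod C i \<and> ses i' p' \<and> Dom C i' = Dom C qX \<and>
        Cod C i' = Dom C q \<and> Cod C p' = Dom C qZ \<and> q \<cdot> i' = i \<cdot> qX \<and> qZ \<cdot> p' = p \<cdot> q \<and>
        fib_repl r \<and> Dom C r = Dom C q \<and> Cod C r = Cod C j \<and> r \<cdot> i' = j \<cdot> rX \<and> s \<cdot> r = rZ \<cdot> p')"

lemma fibrant_map_bifibrant:
  assumes "fib_repl r" "Dom C r \<in> Q"
  shows "Cod C r \<in> Q" "Cod C r \<in> R"
  using assms cofibrant_extension by (auto simp: fibrant_map_def)

lemma bifibrant_ses_exists:
  assumes ses: "ses i p" "Cod C i \<in> W"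
    and qX: "cof_repl qX" "Cod C qX = Dom C i" and qZ: "cof_repl qZ" "Cod C qZ = Cod C p"
    and rX: "fib_repl rX" "Dom C rX = Dom C qX" and rZ: "fib_repl rZ" "Dom C rZ = Dom C qZ"
  shows "\<exists>j s. bifibrant_ses i p qX rX qZ rZ j s"
proof -
  obtain q i' p' where q: "cof_repl q" "Cod C q = Cod C i" "ses i' p'" "Dom C i' = Dom C qX"
    "Cod C i' = Dom C q" "Cod C p' = Dom C qZ" "q \<cdot> i' = i \<cdot> qX" "qZ \<cdot> p' = p \<cdot> q"
    using cofibrant_ses[OF ses(1) qX qZ] by blast
  obtain r j s where r: "fib_repl r" "Dom C r = Cod C i'" "ses j s" "Dom C j = Cod C rX"
    "Cod C j = Cod C r" "Cod C s = Cod C rZ" "r \<cdot> i' = j \<cdot> rX" "s \<cdot> r = rZ \<cdot> p'"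
    using fibrant_ses[OF q(3), of rX rZ] rX rZ q by auto
  have "Dom C q \<in> Q" using q(1) by (simp add: cofibrant_map_def)
  then have "Cod C r \<in> Q" "Cod C r \<in> R" using fibrant_map_bifibrant[OF r(1)] r(2) q(5) by simp_all
  moreover have "Cod C r \<in> W"
  proof -
    obtain k where k: "ses k q" "Dom C k \<in> W" using q(1) by (auto simp: cofibrant_map_def)
    have "Dom C q \<in> W" using W_closed(2)[OF k(1)] k(2) q(2) ses(2) sesD(3)[OF k(1)] by simp
    moreover obtain c where "ses r c" "Cod C c \<in> W" using r(1) by (auto simp: fibrant_map_def)
    ultimately show ?thesis using W_closed(2)[of r c] r(2) q(5) by simp
  qed
  ultimately have "bifibrant_ses i p qX rX qZ rZ j s"
    unfolding bifibrant_ses_def using q r by auto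
  then show ?thesis by blast
qed

lemma bifibrant_ses_tri:
  assumes "bifibrant_ses i p qX rX qZ rZ j s"
    and "fib_repl rX" "Dom C rX \<in> Q" "fib_repl rZ" "Dom C rZ \<in> Q"
  shows "tri j s"
  using assms fibrant_map_bifibrant unfolding bifibrant_ses_def trivial_ses_def by auto

text \<open>The map \<open>g\<close> compares the cofibrant stages and induces \<open>c0\<close> on
  \<open>Dom C qZ\<close>, stably the identity since \<open>qZ \<cdot> c0 = qZ\<close>. The map
  \<open>h\<close> of the final sequences may fail to be compatible with \<open>g\<close>, but the
  defect vanishes on \<open>i1\<close>, so it changes \<open>c \<cdot> rZ\<close> only by a map
  through the trivial object \<open>Cod C j2\<close>. Cancelling \<open>rZ\<close> stably by
  \<open>null_fibrant_map\<close> gives the claim for \<open>c\<close>.\<close>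

lemma bifibrant_ses_unique:
  assumes b: "bifibrant_ses i p qX rX qZ rZ j1 s1" "bifibrant_ses i p qX rX qZ rZ j2 s2"
    and ses: "ses i p"
    and qX: "cof_repl qX" "Cod C qX = Dom C i" and qZ: "cof_repl qZ" "Cod C qZ = Cod C p"
    and rX: "fib_repl rX" "Dom C rX = Dom C qX" and rZ: "fib_repl rZ" "Dom C rZ = Dom C qZ"
  shows "\<exists>w c. ses_morphism C (j1, s1) (j2, s2) (Idt C (Cod C rX)) w c \<and> c \<approx> Idt C (Cod C rZ)"
proof -
  obtain q1 r1 i1 p1 where b1: "ses j1 s1" "Cod C j1 \<in> Q" "Cod C j1 \<in> W" "Cod C j1 \<in> R"
     "Dom C j1 = Cod C rX" "Cod C s1 = Cod C rZ"
     "cof_repl q1" "Cod C q1 = Cod C i" "ses i1 p1" "Dom C i1 = Dom C qX"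
     "Cod C i1 = Dom C q1" "Cod C p1 = Dom C qZ" "q1 \<cdot> i1 = i \<cdot> qX" "qZ \<cdot> p1 = p \<cdot> q1"
     "fib_repl r1" "Dom C r1 = Dom C q1" "Cod C r1 = Cod C j1" "r1 \<cdot> i1 = j1 \<cdot> rX" "s1 \<cdot> r1 = rZ \<cdot> p1"
    using b(1) unfolding bifibrant_ses_def by auto
  obtain q2 r2 i2 p2 where b2: "ses j2 s2" "Cod C j2 \<in> Q" "Cod C j2 \<in> W" "Cod C j2 \<in> R"
     "Dom C j2 = Cod C rX" "Cod C s2 = Cod C rZ"
     "cof_repl q2" "Cod C q2 = Cod C i" "ses i2 p2" "Dom C i2 = Dom C qX"
     "Cod C i2 = Dom C q2" "Cod C p2 = Dom C qZ" "q2 \<cdot> i2 = i \<cdot> qX" "qZ \<cdot> p2 = p \<cdot> q2"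
     "fib_repl r2" "Dom C r2 = Dom C q2" "Cod C r2 = Cod C j2" "r2 \<cdot> i2 = j2 \<cdot> rX" "s2 \<cdot> r2 = rZ \<cdot> p2"
    using b(2) unfolding bifibrant_ses_def by auto
  have ar: "q1 \<in> Ar C" "r1 \<in> Ar C" "q2 \<in> Ar C" "r2 \<in> Ar C" "qX \<in> Ar C" "qZ \<in> Ar C" "rX \<in> Ar C" "rZ \<in> Ar C"
    using b1(7,15) b2(7,15) qX(1) qZ(1) rX(1) rZ(1) sesD(1,2) unfolding cofibrant_map_def fibrant_map_def by blast+
  have QQ: "Dom C qX \<in> Q" "Dom C qZ \<in> Q" "Dom C q1 \<in> Q" "Dom C q2 \<in> Q"
    using b1(7) b2(7) qX qZ by (auto simp: cofibrant_map_def)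
  have Rz: "Cod C rZ \<in> Q" "Cod C rZ \<in> R" using fibrant_map_bifibrant[OF rZ(1)] rZ(2) QQ by simp_all
  obtain k2 where k2: "ses k2 q2" "Dom C k2 \<in> R" "Dom C k2 \<in> W" using b2(7) by (auto simp: cofibrant_map_def)
  obtain kZ where kZ: "ses kZ qZ" "Dom C kZ \<in> R" "Dom C kZ \<in> W" using qZ(1) by (auto simp: cofibrant_map_def)
  note S1 = sesD[OF b1(1)] sesD[OF b1(9)] ar b1(5,6,8,10-12,16,17) qX(2) qZ(2) rX(2) rZ(2)
  note S2 = sesD[OF b2(1)] sesD[OF b2(9)] b2(5,6,8,10-12,16,17) sesD[OF ses]
  note [simp] = S1 S2
  have k2c: "Cod C k2 = Dom C q2" using sesD(3)[OF k2(1)] by simp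
  have kZc: "Cod C kZ = Dom C qZ" using sesD(3)[OF kZ(1)] by simp
  obtain g where g: "g \<in> Ar C" "Dom C g = Dom C q1" "Cod C g = Dom C q2" "g \<cdot> i1 = i2" "q2 \<cdot> g = q1"
    by (rule lift_square[OF b1(9) _ k2, of i2 q1]) (use QQ k2c b1(13) b2(13) in auto)
  note [simp] = g(1-3)
  have "(p2 \<cdot> g) \<cdot> i1 = \<zero>\<^bsub>Dom C i1,Cod C p2\<^esub>" using g(4) by simp
  then obtain c0 where c0: "c0 \<in> Ar C" "Cod C c0 = Dom C qZ" "Dom C c0 = Dom C qZ" "c0 \<cdot> p1 = p2 \<cdot> g"
    using ses_colift[OF b1(9), of "p2 \<cdot> g"] by auto
  note [simp] = c0(1-3)
  have "(qZ \<cdot> c0) \<cdot> p1 = qZ \<cdot> (p2 \<cdot> g)" unfolding c0(4)[symmetric] by simp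
  also have "\<dots> = p \<cdot> (q2 \<cdot> g)" by (rule cmp_reduce2[OF b2(14)]) simp_all
  also have "\<dots> = qZ \<cdot> p1" unfolding g(5) by (rule b1(14)[symmetric])
  finally have "qZ \<cdot> c0 = qZ" by (rule epi_cancel[OF sesD(6)[OF b1(9)]]) simp_all
  then have "qZ \<cdot> c0 = qZ \<cdot> Idt C (Dom C qZ)" by simp
  then obtain m where m: "m \<in> Ar C" "Dom C m = Dom C qZ" "Cod C m = Dom C kZ" "c0 = Idt C (Dom C qZ) \<oplus> kZ \<cdot> m"
    using ses_diff[OF kZ(1), of c0 "Idt C (Dom C qZ)"] kZc by auto
  have "null (kZ \<cdot> m)" using nullI[of m kZ] m(1-3) kZ sesD(1)[OF kZ(1)] by simp
  then have c01: "c0 \<approx> Idt C (Dom C qZ)"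
    unfolding m(4) by (intro st_plus_null) (use m(1-3) kZc sesD(1)[OF kZ(1)] in simp_all)
  obtain h where h: "h \<in> Ar C" "Cod C h = Cod C j2" "Dom C h = Cod C j1" "h \<cdot> j1 = j2"
    by (rule extend_fibrant[OF b2(4) b1(1), of j2]) (use Rz b2(3) in auto)
  note [simp] = h(1-3)
  have "(s2 \<cdot> h) \<cdot> j1 = \<zero>\<^bsub>Dom C j1,Cod C s2\<^esub>" using h(4) by simp
  then obtain c where c: "c \<in> Ar C" "Cod C c = Cod C rZ" "Dom C c = Cod C rZ" "c \<cdot> s1 = s2 \<cdot> h"
    using ses_colift[OF b1(1), of "s2 \<cdot> h"] by auto
  note [simp] = c(1-3)
  have "(h \<cdot> r1) \<cdot> i1 = (r2 \<cdot> g) \<cdot> i1"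
  proof -
    have "(h \<cdot> r1) \<cdot> i1 = h \<cdot> (j1 \<cdot> rX)" unfolding b1(18)[symmetric] by simp
    also have "\<dots> = j2 \<cdot> rX" by (rule cmp_reduce[OF h(4)]) simp_all
    also have "\<dots> = r2 \<cdot> (g \<cdot> i1)" unfolding g(4) by (rule b2(18)[symmetric])
    also have "\<dots> = (r2 \<cdot> g) \<cdot> i1" by simp
    finally show ?thesis .
  qed
  then obtain u where u: "u \<in> Ar C" "Cod C u = Cod C (r2 \<cdot> g)" "Dom C u = Cod C p1" "h \<cdot> r1 = r2 \<cdot> g \<oplus> u \<cdot> p1"
    by (rule ses_codiff[OF b1(9)]) simp_all
  have uc [simp]: "u \<in> Ar C" "Cod C u = Cod C j2" "Dom C u = Dom C qZ" using u(1-3) by simp_all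
  have "(c \<cdot> rZ) \<cdot> p1 = c \<cdot> (s1 \<cdot> r1)" unfolding b1(19) by simp
  also have "\<dots> = s2 \<cdot> (h \<cdot> r1)" by (rule cmp_reduce2[OF c(4)]) simp_all
  also have "\<dots> = s2 \<cdot> (r2 \<cdot> g) \<oplus> s2 \<cdot> (u \<cdot> p1)" unfolding u(4) by simp
  also have "s2 \<cdot> (r2 \<cdot> g) = rZ \<cdot> (p2 \<cdot> g)" by (rule cmp_reduce2[OF b2(19)]) simp_all
  also have "rZ \<cdot> (p2 \<cdot> g) \<oplus> s2 \<cdot> (u \<cdot> p1) = (rZ \<cdot> c0 \<oplus> s2 \<cdot> u) \<cdot> p1" unfolding c0(4)[symmetric] by simp
  finally have crz: "c \<cdot> rZ = rZ \<cdot> c0 \<oplus> s2 \<cdot> u" by (rule epi_cancel[OF sesD(6)[OF b1(9)]]) simp_all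
  have "null (s2 \<cdot> u)" using nullI[of u s2] b2(3) by simp
  then have "c \<cdot> rZ \<approx> rZ \<cdot> c0" unfolding crz by (intro st_plus_null) simp_all
  also have "rZ \<cdot> c0 \<approx> rZ \<cdot> Idt C (Dom C qZ)" by (rule st_cmp[OF c01 st_refl]) simp_all
  also have "rZ \<cdot> Idt C (Dom C qZ) = Idt C (Cod C rZ) \<cdot> rZ" by simp
  finally have "null ((c \<ominus> Idt C (Cod C rZ)) \<cdot> rZ)" using stD(5) by fastforce
  then have "null (c \<ominus> Idt C (Cod C rZ))" by (rule null_fibrant_map[OF rZ(1), rotated 4]) (use QQ Rz in simp_all)
  then have "c \<approx> Idt C (Cod C rZ)" by (simp add: stably_eq_def)
  moreover have "ses_morphism C (j1, s1) (j2, s2) (Idt C (Cod C rX)) h c"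
    unfolding ses_morphism_iff using h(4) c(4) by simp
  ultimately show ?thesis by blast
qed

section \<open>Towers\<close>

text \<open>\<open>X\<^sub>k\<close> is the codomain of \<open>s k\<close>.\<close>
definition tower :: "(int \<Rightarrow> 'm) \<Rightarrow> (int \<Rightarrow> 'm) \<Rightarrow> bool" where
  "tower j s \<longleftrightarrow> (\<forall>k. tri (j k) (s k) \<and> Dom C (j k) = Cod C (s (k + 1)))"

text \<open>Only the components between the bifibrant terms are data, because these are what is
  compared up to stable equality; the middle maps are asked to exist.\<close>

definition tower_map where
  "tower_map j s j' s' f \<longleftrightarrow> (\<forall>k::int. \<exists>w. ses_morphism C (j k, s k) (j' k, s' k) (f (k + 1)) w (f k))"

lemma tower_mapD:
  assumes "tower_map j s j' s' f"
  shows "f k \<in> Ar C" "Dom C (f k) = Cod C (s k)" "Cod C (f k) = Cod C (s' k)"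
  using assms unfolding tower_map_def ses_morphism_iff by blast+

lemma tower_tri: "tower j s \<Longrightarrow> tri (j k) (s k)" and tower_Dom: "tower j s \<Longrightarrow> Dom C (j k) = Cod C (s (k + 1))"
  by (simp_all add: tower_def)

lemma tower_ses: "tower j s \<Longrightarrow> ses (j k) (s k)"
  using tower_tri triD(1) by blast

lemma tower_shift: "tower j s \<Longrightarrow> tower (\<lambda>k. j (k + n)) (\<lambda>k. s (k + n))"
  by (simp add: tower_def add.commute add.left_commute)

lemma tower_map_shift:
  assumes "tower_map j s j' s' f"
  shows "tower_map (\<lambda>k. j (k + n)) (\<lambda>k. s (k + n)) (\<lambda>k. j' (k + n)) (\<lambda>k. s' (k + n)) (\<lambda>k. f (k + n))"
  unfolding tower_map_def
proof
  fix k
  show "\<exists>w. ses_morphism C (j (k + n), s (k + n)) (j' (k + n), s' (k + n)) (f (k + 1 + n)) w (f (k + n))"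
    using assms[unfolded tower_map_def, rule_format, of "k + n"] by (simp add: algebra_simps)
qed

text \<open>Lifting yields component \<open>k + 1\<close> from \<open>k\<close>, extending yields
  \<open>k - 1\<close> from \<open>k\<close>. Each choice depends on the preceding one, so the two
  half-lines are built by separate dependent choices from \<open>g\<close> and joined at index
  0.\<close>

lemma tower_map_exists:
  assumes T: "tower j s" "tower j' s'" and g: "g \<in> Ar C" "Dom C g = Cod C (s 0)" "Cod C g = Cod C (s' 0)"
  obtains f where "tower_map j s j' s' f" "f 0 = g"
proof -
  let ?H = "\<lambda>k x. x \<in> Ar C \<and> Dom C x = Cod C (s k) \<and> Cod C x = Cod C (s' k)"
  let ?S = "\<lambda>k a c. \<exists>w. ses_morphism C (j k, s k) (j' k, s' k) a w c"
  have up: "\<exists>y. ?H (k + 1) y \<and> ?S k y x" if "?H k x" for k x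
    using tri_lift[OF tower_tri[OF T(1), of k] tower_tri[OF T(2), of k], of x] that tower_Dom[OF T(1), of k] tower_Dom[OF T(2), of k]
    unfolding ses_morphism_iff by metis
  have down: "\<exists>y. ?H (k - 1) y \<and> ?S (k - 1) x y" if "?H k x" for k x
    using tri_extend[OF tower_tri[OF T(1), of "k - 1"] tower_tri[OF T(2), of "k - 1"], of x] that
      tower_Dom[OF T(1), of "k - 1"] tower_Dom[OF T(2), of "k - 1"]
    unfolding ses_morphism_iff by (metis diff_add_cancel)
  have "\<exists>a. \<forall>n. (?H (int n) (a n) \<and> (n = 0 \<longrightarrow> a n = g)) \<and> ?S (int n) (a (Suc n)) (a n)"
  proof (rule dependent_nat_choice)
    show "\<exists>x. ?H (int 0) x \<and> (0 = (0::nat) \<longrightarrow> x = g)" using g by auto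
    show "\<exists>y. (?H (int (Suc n)) y \<and> (Suc n = 0 \<longrightarrow> y = g)) \<and> ?S (int n) y x"
      if "?H (int n) x \<and> (n = 0 \<longrightarrow> x = g)" for x n
      using up[where k = "int n" and x = x] that by (simp add: add.commute)
  qed
  then obtain a where a: "a 0 = g" "\<And>n. ?S (int n) (a (Suc n)) (a n)" by blast
  \<comment> \<open>On the negative half, the components \<open>- n\<close> and
    \<open>- n - 1\<close> are the two ends over the sequence with index
    \<open>- n - 1\<close>.\<close>
  have "\<exists>b. \<forall>n. (?H (- int n) (b n) \<and> (n = 0 \<longrightarrow> b n = g)) \<and> ?S (- int n - 1) (b n) (b (Suc n))"
  proof (rule dependent_nat_choice)
    show "\<exists>x. ?H (- int 0) x \<and> (0 = (0::nat) \<longrightarrow> x = g)" using g by auto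
    show "\<exists>y. (?H (- int (Suc n)) y \<and> (Suc n = 0 \<longrightarrow> y = g)) \<and> ?S (- int n - 1) x y"
      if "?H (- int n) x \<and> (n = 0 \<longrightarrow> x = g)" for x n
    proof -
      have e: "- int (Suc n) = - int n - 1" by simp
      show ?thesis unfolding e using down[where k = "- int n" and x = x] that by simp
    qed
  qed
  then obtain b where b: "b 0 = g" "\<And>n. ?S (- int n - 1) (b n) (b (Suc n))" by blast
  define f where "f k = (if k \<ge> 0 then a (nat k) else b (nat (- k)))" for k
  have "tower_map j s j' s' f"
    unfolding tower_map_def
  proof
    fix k :: int
    show "?S k (f (k + 1)) (f k)"
    proof (cases "k \<ge> 0")
      case True
      then show ?thesis using a(2)[of "nat k"] by (simp add: f_def nat_add_distrib)
    next
      case False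
      then have "nat (- k) = Suc (nat (- k - 1))" by simp
      moreover have "f (k + 1) = b (nat (- k - 1))" using False a(1) b(1) by (auto simp: f_def)
      ultimately show ?thesis using False b(2)[of "nat (- k - 1)"] by (simp add: f_def)
    qed
  qed
  then show ?thesis using that[of f] a by (simp add: f_def)
qed

lemma tower_map_null:
  assumes T: "tower j s" "tower j' s'" and f: "tower_map j s j' s' f"
  shows "null (f k) \<longleftrightarrow> null (f l)"
proof -
  have step: "null (f (k + 1)) \<longleftrightarrow> null (f k)" for k
    using f tri_null_iff[OF tower_tri[OF T(1)] tower_tri[OF T(2)]] unfolding tower_map_def by blast
  have "null (f k) \<longleftrightarrow> null (f 0)" for k
    by (induction k rule: int_induct[where k = 0]) (use step in \<open>simp, simp, metis diff_add_cancel\<close>)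
  then show ?thesis by blast
qed

lemma tower_map_sub:
  assumes T: "tower j s" "tower j' s'" and f: "tower_map j s j' s' f" "tower_map j s j' s' g"
  shows "tower_map j s j' s' (\<lambda>k. f k \<ominus> g k)"
  using f ses_morphism_sub[OF tower_ses[OF T(1)] tower_ses[OF T(2)]] unfolding tower_map_def by meson

lemma tower_map_plus:
  assumes T: "tower j s" "tower j' s'" and f: "tower_map j s j' s' f" "tower_map j s j' s' g"
  shows "tower_map j s j' s' (\<lambda>k. f k \<oplus> g k)"
  using f ses_morphism_plus[OF tower_ses[OF T(1)] tower_ses[OF T(2)]] unfolding tower_map_def by meson

lemma tower_map_cmp:
  assumes T: "tower j s" "tower j' s'" "tower j'' s''" and f: "tower_map j s j' s' f" "tower_map j' s' j'' s'' g"
  shows "tower_map j s j'' s'' (\<lambda>k. g k \<cdot> f k)"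
  using f ses_morphism_cmp[OF tower_ses[OF T(1)] tower_ses[OF T(2)] tower_ses[OF T(3)]] unfolding tower_map_def by meson

lemma tower_map_Idt:
  assumes T: "tower j s"
  shows "tower_map j s j s (\<lambda>k. Idt C (Cod C (s k)))"
  using ses_morphism_Idt[OF tower_ses[OF T]] tower_Dom[OF T] unfolding tower_map_def by metis

lemma tower_map_st:
  assumes T: "tower j s" "tower j' s'" and f: "tower_map j s j' s' f" "tower_map j s j' s' g" and e: "f k \<approx> g k"
  shows "f l \<approx> g l"
  using tower_map_null[OF T tower_map_sub[OF T f], of k l] stD(5)[OF e] tower_mapD[OF f(1)] tower_mapD[OF f(2)]
  by (simp add: stably_eq_def)

end

section \<open>Isomorphisms of quotient groups from additive relations\<close>

lemma (in comm_group) coset_eq_iff: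
  assumes "subgroup H G" "a \<in> carrier G" "b \<in> carrier G"
  shows "H #> a = H #> b \<longleftrightarrow> a \<otimes> inv b \<in> H"
proof -
  have "H #> a = H #> b \<longleftrightarrow> a \<in> H #> b"
    using repr_independence[OF _ assms(3,1)] rcos_self[OF assms(2,1)] by auto
  also have "\<dots> \<longleftrightarrow> a \<otimes> inv b \<in> H"
    using subgroup.rcos_module[OF assms(1) is_group assms(3,2)] .
  finally show ?thesis .
qed

text \<open>A correspondence of representatives becomes an isomorphism of quotients although it is
  not a function. Additivity reduces well-definedness and injectivity to the one condition
  \<open>zero\<close> that the two subgroups correspond.\<close>

lemma quotient_iso:
  fixes G1 :: "('a, 'c) monoid_scheme" and G2 :: "('b, 'd) monoid_scheme"
  assumes "comm_group G1" "comm_group G2" and H: "subgroup H1 G1" "subgroup H2 G2"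
    and sub: "\<And>f x. (f, x) \<in> S \<Longrightarrow> f \<in> carrier G1 \<and> x \<in> carrier G2"
    and mult: "\<And>f x g y. (f, x) \<in> S \<Longrightarrow> (g, y) \<in> S \<Longrightarrow> (f \<otimes>\<^bsub>G1\<^esub> g, x \<otimes>\<^bsub>G2\<^esub> y) \<in> S"
    and total: "\<And>f. f \<in> carrier G1 \<Longrightarrow> \<exists>x. (f, x) \<in> S"
    and surj: "\<And>x. x \<in> carrier G2 \<Longrightarrow> \<exists>f. (f, x) \<in> S"
    and zero: "\<And>f x. (f, x) \<in> S \<Longrightarrow> f \<in> H1 \<longleftrightarrow> x \<in> H2"
  shows "\<exists>\<phi>. \<phi> \<in> iso (G1 Mod H1) (G2 Mod H2) \<and> (\<forall>(f, x)\<in>S. \<phi> (H1 #>\<^bsub>G1\<^esub> f) = H2 #>\<^bsub>G2\<^esub> x)"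
proof -
  interpret G1: comm_group G1 by fact
  interpret G2: comm_group G2 by fact
  have key: "H1 #>\<^bsub>G1\<^esub> f = H1 #>\<^bsub>G1\<^esub> f' \<longleftrightarrow> H2 #>\<^bsub>G2\<^esub> x = H2 #>\<^bsub>G2\<^esub> x'"
    if S: "(f, x) \<in> S" "(f', x') \<in> S" for f x f' x'
  proof -
    note c = sub[OF S(1)] sub[OF S(2)]
    \<comment> \<open>A partner \<open>y\<close> of the inverse of \<open>f'\<close> need not be the
      inverse of \<open>x'\<close>, but it is so modulo \<open>H2\<close>.\<close>
    obtain y where y: "(inv\<^bsub>G1\<^esub> f', y) \<in> S" using total c by blast
    have yc: "y \<in> carrier G2" using sub[OF y] by simp
    have "f' \<otimes>\<^bsub>G1\<^esub> inv\<^bsub>G1\<^esub> f' \<in> H1" using c subgroup.one_closed[OF H(1)] by simp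
    then have "x' \<otimes>\<^bsub>G2\<^esub> y \<in> H2" using zero[OF mult[OF S(2) y]] by simp
    then have "H2 #>\<^bsub>G2\<^esub> x' = H2 #>\<^bsub>G2\<^esub> inv\<^bsub>G2\<^esub> y" using G2.coset_eq_iff[OF H(2)] c yc by simp
    moreover have "H1 #>\<^bsub>G1\<^esub> f = H1 #>\<^bsub>G1\<^esub> f' \<longleftrightarrow> x \<otimes>\<^bsub>G2\<^esub> y \<in> H2"
      using zero[OF mult[OF S(1) y]] G1.coset_eq_iff[OF H(1)] c by simp
    moreover have "H2 #>\<^bsub>G2\<^esub> x = H2 #>\<^bsub>G2\<^esub> inv\<^bsub>G2\<^esub> y \<longleftrightarrow> x \<otimes>\<^bsub>G2\<^esub> y \<in> H2"
      using G2.coset_eq_iff[OF H(2)] c yc by simp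
    ultimately show ?thesis by metis
  qed
  define \<phi> where "\<phi> X = (SOME Y. \<exists>f x. (f, x) \<in> S \<and> X = H1 #>\<^bsub>G1\<^esub> f \<and> Y = H2 #>\<^bsub>G2\<^esub> x)" for X
  have \<phi>: "\<phi> (H1 #>\<^bsub>G1\<^esub> f) = H2 #>\<^bsub>G2\<^esub> x" if "(f, x) \<in> S" for f x
  proof -
    have "\<exists>f' x'. (f', x') \<in> S \<and> H1 #>\<^bsub>G1\<^esub> f = H1 #>\<^bsub>G1\<^esub> f' \<and> \<phi> (H1 #>\<^bsub>G1\<^esub> f) = H2 #>\<^bsub>G2\<^esub> x'"
      unfolding \<phi>_def by (rule someI_ex) (use that in blast)
    then show ?thesis using key[OF that] by metis
  qed
  have N: "H1 \<lhd> G1" "H2 \<lhd> G2" using G1.subgroup_imp_normal H(1) G2.subgroup_imp_normal H(2) by blast+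
  have "\<phi> \<in> hom (G1 Mod H1) (G2 Mod H2)"
  proof (rule homI)
    fix X assume "X \<in> carrier (G1 Mod H1)"
    then obtain f where f: "f \<in> carrier G1" "X = H1 #>\<^bsub>G1\<^esub> f" by (auto simp: FactGroup_def RCOSETS_def)
    obtain x where x: "(f, x) \<in> S" using total f by blast
    show "\<phi> X \<in> carrier (G2 Mod H2)" using \<phi>[OF x] f(2) sub[OF x] by (auto simp: FactGroup_def RCOSETS_def)
    fix Y assume "Y \<in> carrier (G1 Mod H1)"
    then obtain g where g: "g \<in> carrier G1" "Y = H1 #>\<^bsub>G1\<^esub> g" by (auto simp: FactGroup_def RCOSETS_def)
    obtain y where y: "(g, y) \<in> S" using total g by blast
    have "X \<otimes>\<^bsub>G1 Mod H1\<^esub> Y = H1 #>\<^bsub>G1\<^esub> (f \<otimes>\<^bsub>G1\<^esub> g)"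
      unfolding f g using normal.rcos_sum[OF N(1) f(1) g(1)] by (simp add: FactGroup_def)
    moreover have "\<phi> X \<otimes>\<^bsub>G2 Mod H2\<^esub> \<phi> Y = H2 #>\<^bsub>G2\<^esub> (x \<otimes>\<^bsub>G2\<^esub> y)"
      unfolding f g \<phi>[OF x] \<phi>[OF y] using normal.rcos_sum[OF N(2)] sub[OF x] sub[OF y] by (simp add: FactGroup_def)
    ultimately show "\<phi> (X \<otimes>\<^bsub>G1 Mod H1\<^esub> Y) = \<phi> X \<otimes>\<^bsub>G2 Mod H2\<^esub> \<phi> Y" using \<phi>[OF mult[OF x y]] by simp
  qed
  moreover have "bij_betw \<phi> (carrier (G1 Mod H1)) (carrier (G2 Mod H2))"
  proof (rule bij_betw_imageI[OF inj_onI equalityI[OF subsetI subsetI]])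
    fix X Y assume XY: "X \<in> carrier (G1 Mod H1)" "Y \<in> carrier (G1 Mod H1)" "\<phi> X = \<phi> Y"
    obtain f g where fg: "f \<in> carrier G1" "X = H1 #>\<^bsub>G1\<^esub> f" "g \<in> carrier G1" "Y = H1 #>\<^bsub>G1\<^esub> g"
      using XY by (auto simp: FactGroup_def RCOSETS_def)
    obtain x y where "(f, x) \<in> S" "(g, y) \<in> S" using total fg by blast
    then show "X = Y" using key[of f x g y] \<phi> XY(3) fg by metis
  next
    fix Y assume "Y \<in> \<phi> ` carrier (G1 Mod H1)"
    then show "Y \<in> carrier (G2 Mod H2)" using calculation by (auto simp: hom_def)
  next
    fix Y assume "Y \<in> carrier (G2 Mod H2)"
    then obtain x where x: "x \<in> carrier G2" "Y = H2 #>\<^bsub>G2\<^esub> x" by (auto simp: FactGroup_def RCOSETS_def)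
    obtain f where f: "(f, x) \<in> S" using surj x by blast
    have "H1 #>\<^bsub>G1\<^esub> f \<in> carrier (G1 Mod H1)" using sub[OF f] by (auto simp: FactGroup_def RCOSETS_def)
    then show "Y \<in> \<phi> ` carrier (G1 Mod H1)" using \<phi>[OF f] x by blast
  qed
  ultimately have "\<phi> \<in> iso (G1 Mod H1) (G2 Mod H2)" by (simp add: iso_def)
  then show ?thesis using \<phi> by blast
qed

text \<open>The isomorphisms send related representatives to each other, so naturality only asks for
  one related pair \<open>f'\<close>, \<open>x'\<close> that represents the two images.\<close>

lemma natural_isoI:
  assumes iso: "\<And>A B. A \<in> Ob C \<Longrightarrow> B \<in> Ob C \<Longrightarrow> comm_group (G1 A B) \<and> comm_group (G2 A B) \<and>
      subgroup (H1 A B) (G1 A B) \<and> subgroup (H2 A B) (G2 A B)"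
    and FG: "\<And>A B. F A B = G1 A B Mod H1 A B" "\<And>A B. G A B = G2 A B Mod H2 A B"
    and sub: "\<And>A B f x. A \<in> Ob C \<Longrightarrow> B \<in> Ob C \<Longrightarrow> (f, x) \<in> S A B \<Longrightarrow> f \<in> carrier (G1 A B) \<and> x \<in> carrier (G2 A B)"
    and mult: "\<And>A B f x g y. A \<in> Ob C \<Longrightarrow> B \<in> Ob C \<Longrightarrow> (f, x) \<in> S A B \<Longrightarrow> (g, y) \<in> S A B \<Longrightarrow>
      (f \<otimes>\<^bsub>G1 A B\<^esub> g, x \<otimes>\<^bsub>G2 A B\<^esub> y) \<in> S A B"
    and total: "\<And>A B f. A \<in> Ob C \<Longrightarrow> B \<in> Ob C \<Longrightarrow> f \<in> carrier (G1 A B) \<Longrightarrow> \<exists>x. (f, x) \<in> S A B"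
    and surj: "\<And>A B x. A \<in> Ob C \<Longrightarrow> B \<in> Ob C \<Longrightarrow> x \<in> carrier (G2 A B) \<Longrightarrow> \<exists>f. (f, x) \<in> S A B"
    and zero: "\<And>A B f x. A \<in> Ob C \<Longrightarrow> B \<in> Ob C \<Longrightarrow> (f, x) \<in> S A B \<Longrightarrow> f \<in> H1 A B \<longleftrightarrow> x \<in> H2 A B"
    and nat: "\<And>A A' B B' \<alpha> \<beta> f x. A \<in> Ob C \<Longrightarrow> A' \<in> Ob C \<Longrightarrow> B \<in> Ob C \<Longrightarrow> B' \<in> Ob C \<Longrightarrow>
      \<alpha> \<in> carrier (Ho C M K A' A) \<Longrightarrow> \<beta> \<in> carrier (Ho C M K B B') \<Longrightarrow> (f, x) \<in> S A B \<Longrightarrow>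
      \<exists>f' x'. (f', x') \<in> S A' B' \<and> Fm A A' B B' \<alpha> \<beta> (H1 A B #>\<^bsub>G1 A B\<^esub> f) = H1 A' B' #>\<^bsub>G1 A' B'\<^esub> f' \<and>
        Gm A A' B B' \<alpha> \<beta> (H2 A B #>\<^bsub>G2 A B\<^esub> x) = H2 A' B' #>\<^bsub>G2 A' B'\<^esub> x'"
  shows "\<exists>\<phi>. natural_iso C M K F Fm G Gm \<phi>"
proof -
  have ex: "\<exists>\<phi>. \<phi> \<in> iso (F A B) (G A B) \<and> (\<forall>(f, x)\<in>S A B. \<phi> (H1 A B #>\<^bsub>G1 A B\<^esub> f) = H2 A B #>\<^bsub>G2 A B\<^esub> x)"
    if AB: "A \<in> Ob C" "B \<in> Ob C" for A B
    unfolding FG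
  proof (rule quotient_iso)
    show "comm_group (G1 A B)" "comm_group (G2 A B)" "subgroup (H1 A B) (G1 A B)" "subgroup (H2 A B) (G2 A B)"
      using iso[OF AB] by blast+
    fix f x assume fx: "(f, x) \<in> S A B"
    show "f \<in> carrier (G1 A B) \<and> x \<in> carrier (G2 A B)" by (rule sub[OF AB fx])
    show "f \<in> H1 A B \<longleftrightarrow> x \<in> H2 A B" by (rule zero[OF AB fx])
    fix g y assume "(g, y) \<in> S A B"
    then show "(f \<otimes>\<^bsub>G1 A B\<^esub> g, x \<otimes>\<^bsub>G2 A B\<^esub> y) \<in> S A B" by (rule mult[OF AB fx])
  next
    show "\<exists>x. (f, x) \<in> S A B" if "f \<in> carrier (G1 A B)" for f by (rule total[OF AB that])
    show "\<exists>f. (f, x) \<in> S A B" if "x \<in> carrier (G2 A B)" for x by (rule surj[OF AB that])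
  qed
  define \<phi> where "\<phi> A B = (SOME \<phi>. \<phi> \<in> iso (F A B) (G A B) \<and>
    (\<forall>(f, x)\<in>S A B. \<phi> (H1 A B #>\<^bsub>G1 A B\<^esub> f) = H2 A B #>\<^bsub>G2 A B\<^esub> x))" for A B
  have "\<phi> A B \<in> iso (F A B) (G A B) \<and> (\<forall>(f, x)\<in>S A B. \<phi> A B (H1 A B #>\<^bsub>G1 A B\<^esub> f) = H2 A B #>\<^bsub>G2 A B\<^esub> x)"
    if "A \<in> Ob C" "B \<in> Ob C" for A B
    using someI_ex[OF ex[OF that]] unfolding \<phi>_def .
  then have \<phi>1: "\<phi> A B \<in> iso (F A B) (G A B)"
    and \<phi>2: "(f, x) \<in> S A B \<Longrightarrow> \<phi> A B (H1 A B #>\<^bsub>G1 A B\<^esub> f) = H2 A B #>\<^bsub>G2 A B\<^esub> x"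
    if "A \<in> Ob C" "B \<in> Ob C" for A B f x
    using that by blast+
  have "\<phi> A' B' (Fm A A' B B' \<alpha> \<beta> X) = Gm A A' B B' \<alpha> \<beta> (\<phi> A B X)"
    if ob: "A \<in> Ob C" "A' \<in> Ob C" "B \<in> Ob C" "B' \<in> Ob C"
      and ab: "\<alpha> \<in> carrier (Ho C M K A' A)" "\<beta> \<in> carrier (Ho C M K B B')" and X: "X \<in> carrier (F A B)"
    for A A' B B' \<alpha> \<beta> X
  proof -
    obtain f where f: "f \<in> carrier (G1 A B)" "X = H1 A B #>\<^bsub>G1 A B\<^esub> f"
      using X by (auto simp: FG FactGroup_def RCOSETS_def)
    obtain x where x: "(f, x) \<in> S A B" using total[OF ob(1,3) f(1)] by blast
    obtain f' x' where "(f', x') \<in> S A' B'"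
      "Fm A A' B B' \<alpha> \<beta> (H1 A B #>\<^bsub>G1 A B\<^esub> f) = H1 A' B' #>\<^bsub>G1 A' B'\<^esub> f'"
      "Gm A A' B B' \<alpha> \<beta> (H2 A B #>\<^bsub>G2 A B\<^esub> x) = H2 A' B' #>\<^bsub>G2 A' B'\<^esub> x'"
      using nat[OF ob ab x] by blast
    then show ?thesis using \<phi>2[OF ob(1,3) x] \<phi>2[OF ob(2,4)] f(2) by simp
  qed
  then show ?thesis unfolding natural_iso_def using \<phi>1 by blast
qed

section \<open>Stable classes\<close>

locale chosen_model = abelian_category C
  for C :: "('o, 'm) additive_cat" (structure) +
  fixes M :: "'o model_triple" and K :: "('o, 'm) model_choice"
  assumes hereditary: "hereditary_abelian_model C M" and valid: "valid_choice C M K"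

sublocale chosen_model \<subseteq> model C "cofibrant M" "trivial M" "fibrant M"
  by (rule hereditary_abelian_model_model) (rule abelian_category_axioms, rule hereditary)

context chosen_model
begin

notation stably_eq (infix "\<approx>" 50)

lemma factors_null_iff:
  assumes "X \<in> cofibrant M" "Y \<in> fibrant M"
  shows "f \<in> factors_through_core C M X Y \<longleftrightarrow> f \<in> Hom C X Y \<and> null f"
proof
  assume "f \<in> factors_through_core C M X Y"
  then obtain g h Z where "Z \<in> core M" "g \<in> Hom C X Z" "h \<in> Hom C Z Y" "f = h \<cdot> g"
    by (auto simp: factors_through_core_def)
  then show "f \<in> Hom C X Y \<and> null f" using nullI[of g h] by (auto simp: Hom_iff core_def)
next
  assume f: "f \<in> Hom C X Y \<and> null f"
  then obtain u v where uv: "u \<in> Ar C" "v \<in> Ar C" "Dom C v = Cod C u" "Cod C u \<in> cofibrant M" "Cod C u \<in> trivial M"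
    "Cod C u \<in> fibrant M" "f = v \<cdot> u"
    using null_through_core[of f] assms by (auto simp: Hom_iff)
  have d: "Dom C u = X" "Cod C v = Y" using f cmp_Ar(2,3)[OF uv(1,2,3)] uv(7) by (auto simp: Hom_iff)
  have "Cod C u \<in> core M" "u \<in> Hom C X (Cod C u)" "v \<in> Hom C (Cod C u) Y"
    using uv(1-6) d by (simp_all add: Hom_iff core_def)
  then show "f \<in> factors_through_core C M X Y" unfolding factors_through_core_def uv(7) by blast
qed

lemma Hom_group_inv:
  assumes "f \<in> Hom C X Y"
  shows "inv\<^bsub>Hom_group C X Y\<^esub> f = neg f"
  using assms by (auto simp: neg_def Hom_iff)

lemma factors_subgroup:
  assumes "X \<in> cofibrant M" "Y \<in> fibrant M"
  shows "subgroup (factors_through_core C M X Y) (Hom_group C X Y)"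
proof -
  have ob [simp]: "X \<in> Ob C" "Y \<in> Ob C" using assms QR_Ob by blast+
  interpret G: comm_group "Hom_group C X Y" by (rule Hom_comm_group) simp_all
  note iff = factors_null_iff[OF assms]
  show ?thesis
  proof
    show "factors_through_core C M X Y \<subseteq> carrier (Hom_group C X Y)" using iff by auto
    show "\<one>\<^bsub>Hom_group C X Y\<^esub> \<in> factors_through_core C M X Y" by (simp add: iff null_zero Hom_iff)
    fix f assume f: "f \<in> factors_through_core C M X Y"
    then show "inv\<^bsub>Hom_group C X Y\<^esub> f \<in> factors_through_core C M X Y"
      using null_neg Hom_group_inv by (auto simp: iff Hom_iff)
    fix g assume "g \<in> factors_through_core C M X Y"
    then show "f \<otimes>\<^bsub>Hom_group C X Y\<^esub> g \<in> factors_through_core C M X Y"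
      using f null_plus[of f g] by (simp add: iff Hom_iff)
  qed
qed

lemma stable_class_eq_iff:
  assumes "X \<in> cofibrant M" "Y \<in> fibrant M" "f \<in> Hom C X Y" "g \<in> Hom C X Y"
  shows "stable_class C M X Y f = stable_class C M X Y g \<longleftrightarrow> f \<approx> g"
proof -
  have ob [simp]: "X \<in> Ob C" "Y \<in> Ob C" using assms QR_Ob by blast+
  interpret G: comm_group "Hom_group C X Y" by (rule Hom_comm_group) simp_all
  show ?thesis
    using G.coset_eq_iff[OF factors_subgroup[OF assms(1,2)], of f g] assms(3,4)
    by (auto simp: stable_class_def factors_null_iff[OF assms(1,2)] Hom_group_inv stably_eq_def Hom_iff)
qed

lemma in_stable_class_iff:
  assumes "X \<in> cofibrant M" "Y \<in> fibrant M" "f \<in> Hom C X Y"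
  shows "g \<in> stable_class C M X Y f \<longleftrightarrow> g \<in> Hom C X Y \<and> g \<approx> f"
proof -
  have ob [simp]: "X \<in> Ob C" "Y \<in> Ob C" using assms QR_Ob by blast+
  interpret G: comm_group "Hom_group C X Y" by (rule Hom_comm_group) simp_all
  note s = factors_subgroup[OF assms(1,2)]
  show ?thesis
  proof
    assume g: "g \<in> stable_class C M X Y f"
    then have h: "g \<in> Hom C X Y"
      using G.r_coset_subset_G[OF subgroup.subset[OF s], of f] assms(3) by (auto simp: stable_class_def)
    then show "g \<in> Hom C X Y \<and> g \<approx> f"
      using g stable_class_eq_iff[OF assms(1,2) h assms(3)] G.repr_independence[OF _ _ s, of g f] assms(3)
      by (auto simp: stable_class_def)
  next
    assume g: "g \<in> Hom C X Y \<and> g \<approx> f"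
    then have "stable_class C M X Y g = stable_class C M X Y f" using stable_class_eq_iff assms by blast
    then show "g \<in> stable_class C M X Y f" using G.rcos_self[OF _ s, of g] g by (auto simp: stable_class_def)
  qed
qed

lemma carrier_stable_Hom: "carrier (stable_Hom C M X Y) = stable_class C M X Y ` Hom C X Y"
  by (auto simp: stable_Hom_def FactGroup_def RCOSETS_def stable_class_def)

text \<open>Composition and suspension of classes are defined as unions over representatives, which give the expected
  class only if the family of representatives is nonempty and stably constant.\<close>
lemma Union_stable_class:
  assumes "X \<in> cofibrant M" "Y \<in> fibrant M" "h \<in> Hom C X Y" "\<exists>g. P g"
    and "\<And>g. P g \<Longrightarrow> g \<approx> h"
  shows "\<Union>{stable_class C M X Y g | g. P g} = stable_class C M X Y h"
proof -
  have "stable_class C M X Y g = stable_class C M X Y h" if "P g" for g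
    using stable_class_eq_iff[OF assms(1,2) _ assms(3), of g] assms(5)[OF that] stD[OF assms(5)[OF that]] assms(3)
    by (auto simp: Hom_iff)
  then have "{stable_class C M X Y g | g. P g} = {stable_class C M X Y h}" using assms(4) by blast
  then show ?thesis by simp
qed

section \<open>Replacements and suspension\<close>

abbreviation "RQ \<equiv> RQ_ob C K"
abbreviation "susp \<equiv> susp_ob C K"
abbreviation "loop \<equiv> loop_ob C K"
abbreviation "Om \<equiv> Omega_ob C K"
abbreviation "Sg \<equiv> Sigma_ob C K"
abbreviation "bif_seq \<equiv> bifibrant_sequence C M K"
abbreviation "RQ_Hom A B \<equiv> Hom C (RQ A) (RQ B)"
abbreviation "RQ_group A B \<equiv> Hom_group C (RQ A) (RQ B)"
abbreviation "core_maps A B \<equiv> factors_through_core C M (RQ A) (RQ B)"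
abbreviation "scl A B \<equiv> stable_class C M (RQ A) (RQ B)"

lemma cofibrant_replacement_iff:
  "cofibrant_replacement C M A q \<longleftrightarrow> Cod C q = A \<and> cof_repl q"
  by (auto simp: cofibrant_replacement_def cofibrant_map_def trivially_fibrant_def)

lemma fibrant_replacement_iff:
  "fibrant_replacement C M A r \<longleftrightarrow> Dom C r = A \<and> fib_repl r"
  by (auto simp: fibrant_replacement_def fibrant_map_def trivially_cofibrant_def)

lemma replacements:
  assumes "X \<in> Ob C"
  shows "cof_repl (cof_map K X)" "Cod C (cof_map K X) = X"
    "Dom C (cof_map K X) = Q_ob C K X" "Q_ob C K X \<in> cofibrant M"
    "fib_repl (fib_map K (Q_ob C K X))"
    "Dom C (fib_map K (Q_ob C K X)) = Q_ob C K X" "Cod C (fib_map K (Q_ob C K X)) = RQ X"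
    "RQ X \<in> cofibrant M" "RQ X \<in> fibrant M" "RQ X \<in> Ob C"
proof -
  show c: "cof_repl (cof_map K X)" "Cod C (cof_map K X) = X"
    using valid assms unfolding valid_choice_def cofibrant_replacement_iff by blast+
  show "Dom C (cof_map K X) = Q_ob C K X" by (simp add: Q_ob_def)
  then show q: "Q_ob C K X \<in> cofibrant M" using c by (simp add: cofibrant_map_def)
  then have "Q_ob C K X \<in> Ob C" using QR_Ob by blast
  then show f: "fib_repl (fib_map K (Q_ob C K X))" "Dom C (fib_map K (Q_ob C K X)) = Q_ob C K X"
    using valid unfolding valid_choice_def fibrant_replacement_iff by blast+
  show "Cod C (fib_map K (Q_ob C K X)) = RQ X" by (simp add: RQ_ob_def)
  then show "RQ X \<in> cofibrant M" "RQ X \<in> fibrant M" using fibrant_map_bifibrant[OF f(1)] f(2) q by auto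
  then show "RQ X \<in> Ob C" using QR_Ob by blast
qed

lemma bifibrant_sequence_iff:
  "bif_seq (i, p) (j, s) \<longleftrightarrow>
    bifibrant_ses i p (cof_map K (Dom C i)) (fib_map K (Q_ob C K (Dom C i)))
      (cof_map K (Cod C p)) (fib_map K (Q_ob C K (Cod C p))) j s"
  unfolding bifibrant_sequence_def bifibrant_ses_def Let_def split cofibrant_replacement_iff fibrant_replacement_iff
    core_def Q_ob_def RQ_ob_def by blast

lemma bifibrant_sequence_exists:
  assumes "ses i p" "Cod C i \<in> trivial M"
  shows "\<exists>j s. bif_seq (i, p) (j, s)"
  unfolding bifibrant_sequence_iff
  by (rule bifibrant_ses_exists[OF assms]) (use replacements sesD[OF assms(1)] in simp_all)

lemma bifibrant_sequence_tri:
  assumes "ses i p" "bif_seq (i, p) (j, s)"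
  shows "tri j s" "Dom C j = RQ (Dom C i)" "Cod C s = RQ (Cod C p)"
proof -
  note b = assms(2)[unfolded bifibrant_sequence_iff]
  show "tri j s" by (rule bifibrant_ses_tri[OF b]) (use replacements sesD[OF assms(1)] in simp_all)
  show "Dom C j = RQ (Dom C i)" "Cod C s = RQ (Cod C p)"
    using b replacements sesD[OF assms(1)] by (simp_all add: bifibrant_ses_def)
qed

lemma bifibrant_sequence_unique:
  assumes "ses i p" "bif_seq (i, p) (j1, s1)" "bif_seq (i, p) (j2, s2)"
  shows "\<exists>w c. ses_morphism C (j1, s1) (j2, s2) (Idt C (RQ (Dom C i))) w c \<and> c \<approx> Idt C (RQ (Cod C p))"
proof -
  have d: "Dom C i \<in> Ob C" "Cod C p \<in> Ob C" using sesD[OF assms(1)] by simp_all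
  show ?thesis
    using bifibrant_ses_unique[OF assms(2,3)[unfolded bifibrant_sequence_iff] assms(1)]
      replacements[OF d(1)] replacements[OF d(2)] by simp
qed

text \<open>One morphism followed by the comparison of the targets, and the other preceded by the
  comparison of the sources, run between the same two sequences. The comparisons are the identity on
  the left and stably the identity on the right, so \<open>tri_st_iff\<close> decides both
  ends.\<close>

lemma bifibrant_sequence_independent:
  assumes ses: "ses i p" "ses i' p'"
    and b: "bif_seq (i, p) (j1, s1)" "bif_seq (i, p) (j2, s2)"
    and b': "bif_seq (i', p') (j1', s1')" "bif_seq (i', p') (j2', s2')"
    and m: "ses_morphism C (j1, s1) (j1', s1') a1 w1 c1" "ses_morphism C (j2, s2) (j2', s2') a2 w2 c2"
  shows "a1 \<approx> a2 \<longleftrightarrow> c1 \<approx> c2"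
proof -
  note t1 = bifibrant_sequence_tri[OF ses(1) b(1)] and t2 = bifibrant_sequence_tri[OF ses(1) b(2)]
  note t1' = bifibrant_sequence_tri[OF ses(2) b'(1)] and t2' = bifibrant_sequence_tri[OF ses(2) b'(2)]
  note sx = triD(1)[OF t1(1)] triD(1)[OF t2(1)] triD(1)[OF t1'(1)] triD(1)[OF t2'(1)]
  obtain u e where e: "ses_morphism C (j1, s1) (j2, s2) (Idt C (RQ (Dom C i))) u e" "e \<approx> Idt C (RQ (Cod C p))"
    using bifibrant_sequence_unique[OF ses(1) b] by blast
  obtain u' e' where e': "ses_morphism C (j1', s1') (j2', s2') (Idt C (RQ (Dom C i'))) u' e'" "e' \<approx> Idt C (RQ (Cod C p'))"
    using bifibrant_sequence_unique[OF ses(2) b'] by blast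
  have ac: "a1 \<in> Ar C" "Dom C a1 = RQ (Dom C i)" "Cod C a1 = RQ (Dom C i')"
    "a2 \<in> Ar C" "Dom C a2 = RQ (Dom C i)" "Cod C a2 = RQ (Dom C i')"
    "c1 \<in> Ar C" "Dom C c1 = RQ (Cod C p)" "Cod C c1 = RQ (Cod C p')"
    "c2 \<in> Ar C" "Dom C c2 = RQ (Cod C p)" "Cod C c2 = RQ (Cod C p')"
    using m t1 t2 t1' t2' unfolding ses_morphism_iff by auto
  have ob: "RQ (Dom C i) \<in> Ob C" "RQ (Dom C i') \<in> Ob C" "RQ (Cod C p) \<in> Ob C" "RQ (Cod C p') \<in> Ob C"
    using ac ends_in_Ob by metis+
  have "Idt C (RQ (Dom C i')) \<cdot> a1 \<approx> a2 \<cdot> Idt C (RQ (Dom C i)) \<longleftrightarrow> e' \<cdot> c1 \<approx> c2 \<cdot> e"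
    by (rule tri_st_iff[OF t1(1) t2'(1) ses_morphism_cmp[OF sx(1,3,4) m(1) e'(1)]
          ses_morphism_cmp[OF sx(1,2,4) e(1) m(2)]])
  moreover have "e' \<cdot> c1 \<approx> Idt C (RQ (Cod C p')) \<cdot> c1" by (rule st_cmp[OF st_refl e'(2)]) (use ac ob in simp_all)
  then have "e' \<cdot> c1 \<approx> c1" using ac by simp
  moreover have "c2 \<cdot> e \<approx> c2 \<cdot> Idt C (RQ (Cod C p))" by (rule st_cmp[OF e(2) st_refl]) (use ac ob in simp_all)
  then have "c2 \<cdot> e \<approx> c2" using ac by simp
  ultimately show ?thesis using ac by (metis Idt_cmp' cmp_Idt' st_sym st_trans)
qed

lemma susp_seq:
  assumes "X \<in> Ob C"
  obtains i p where "susp_seq K X = (i, p)" "ses i p" "Dom C i = X" "Cod C i \<in> trivial M"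
    "Cod C p = susp X" "susp X \<in> Ob C"
proof -
  obtain i p where ip: "susp_seq K X = (i, p)" "ses i p" "Dom C i = X" "Cod C i \<in> trivial M"
    using valid assms unfolding valid_choice_def by blast
  then show ?thesis using that[of i p] sesD[OF ip(2)] by (simp add: susp_ob_def)
qed

lemma loop_seq:
  assumes "X \<in> Ob C"
  obtains i p where "loop_seq K X = (i, p)" "ses i p" "Cod C p = X" "Cod C i \<in> trivial M"
    "Dom C i = loop X" "loop X \<in> Ob C"
proof -
  obtain i p where ip: "loop_seq K X = (i, p)" "ses i p" "Cod C p = X" "Cod C i \<in> trivial M"
    using valid assms unfolding valid_choice_def by blast
  then show ?thesis using that[of i p] sesD[OF ip(2)] by (simp add: loop_ob_def)
qed

lemma susp_map_class:
  assumes X: "X \<in> Ob C" "X' \<in> Ob C"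
    and b: "bif_seq (susp_seq K X) (j, s)" "bif_seq (susp_seq K X') (j', s')"
    and m: "ses_morphism C (j, s) (j', s') f w c"
  shows "susp_map C M K X X' (scl X X' f) =
    scl (susp X) (susp X') c"
proof -
  obtain i p where ip: "susp_seq K X = (i, p)" "ses i p" "Dom C i = X" "Cod C i \<in> trivial M"
    "Cod C p = susp X" "susp X \<in> Ob C" by (rule susp_seq[OF X(1)])
  obtain i' p' where ip': "susp_seq K X' = (i', p')" "ses i' p'" "Dom C i' = X'" "Cod C i' \<in> trivial M"
    "Cod C p' = susp X'" "susp X' \<in> Ob C" by (rule susp_seq[OF X(2)])
  note b1 = b[unfolded ip(1) ip'(1)]
  note t = bifibrant_sequence_tri[OF ip(2) b1(1)] bifibrant_sequence_tri[OF ip'(2) b1(2)]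
  note m' = m[unfolded ses_morphism_iff]
  have f: "f \<in> RQ_Hom X X'" and c: "c \<in> RQ_Hom (susp X) (susp X')"
    using m' t ip ip' by (auto simp: Hom_iff)
  let ?P = "\<lambda>c. \<exists>S S' f' w. bif_seq (susp_seq K X) S \<and> bif_seq (susp_seq K X') S' \<and>
        f' \<in> scl X X' f \<and> ses_morphism C S S' f' w c"
  have ff: "f \<in> scl X X' f"
    using in_stable_class_iff[OF _ _ f] replacements X f st_refl by (auto simp: Hom_iff)
  have "\<Union>{scl (susp X) (susp X') c | c. ?P c} =
    scl (susp X) (susp X') c"
  proof (rule Union_stable_class)
    show "\<exists>c. ?P c" using b m ff by blast
    fix c2 assume "?P c2"
    then obtain j2 s2 j2' s2' f2 w2 where 2: "bif_seq (i, p) (j2, s2)"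
      "bif_seq (i', p') (j2', s2')"
      "f2 \<in> scl X X' f" "ses_morphism C (j2, s2) (j2', s2') f2 w2 c2"
      using ip(1) ip'(1) by auto
    have "f2 \<approx> f" using 2(3) in_stable_class_iff[OF _ _ f] replacements X by blast
    then show "c2 \<approx> c"
      using bifibrant_sequence_independent[OF ip(2) ip'(2) 2(1) b1(1) 2(2) b1(2) 2(4) m] by blast
  qed (use replacements ip ip' c in auto)
  moreover have "susp_map C M K X X' (scl X X' f) =
    \<Union>{scl (susp X) (susp X') c | c. ?P c}"
    unfolding susp_map_def by (rule arg_cong[where f = Union]) blast
  ultimately show ?thesis by simp
qed

lemma loop_map_class:
  assumes X: "X \<in> Ob C" "X' \<in> Ob C"
    and b: "bif_seq (loop_seq K X) (j, s)" "bif_seq (loop_seq K X') (j', s')"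
    and m: "ses_morphism C (j, s) (j', s') a w f"
  shows "loop_map C M K X X' (scl X X' f) =
    scl (loop X) (loop X') a"
proof -
  obtain i p where ip: "loop_seq K X = (i, p)" "ses i p" "Cod C p = X" "Cod C i \<in> trivial M"
    "Dom C i = loop X" "loop X \<in> Ob C" by (rule loop_seq[OF X(1)])
  obtain i' p' where ip': "loop_seq K X' = (i', p')" "ses i' p'" "Cod C p' = X'" "Cod C i' \<in> trivial M"
    "Dom C i' = loop X'" "loop X' \<in> Ob C" by (rule loop_seq[OF X(2)])
  note b1 = b[unfolded ip(1) ip'(1)]
  note t = bifibrant_sequence_tri[OF ip(2) b1(1)] bifibrant_sequence_tri[OF ip'(2) b1(2)]
  note m' = m[unfolded ses_morphism_iff]
  have f: "f \<in> RQ_Hom X X'" and a: "a \<in> RQ_Hom (loop X) (loop X')"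
    using m' t ip ip' by (auto simp: Hom_iff)
  let ?P = "\<lambda>a. \<exists>S S' f' w. bif_seq (loop_seq K X) S \<and> bif_seq (loop_seq K X') S' \<and>
        f' \<in> scl X X' f \<and> ses_morphism C S S' a w f'"
  have ff: "f \<in> scl X X' f"
    using in_stable_class_iff[OF _ _ f] replacements X f st_refl by (auto simp: Hom_iff)
  have "\<Union>{scl (loop X) (loop X') a | a. ?P a} =
    scl (loop X) (loop X') a"
  proof (rule Union_stable_class)
    show "\<exists>a. ?P a" using b m ff by blast
    fix a2 assume "?P a2"
    then obtain j2 s2 j2' s2' f2 w2 where 2: "bif_seq (i, p) (j2, s2)"
      "bif_seq (i', p') (j2', s2')"
      "f2 \<in> scl X X' f" "ses_morphism C (j2, s2) (j2', s2') a2 w2 f2"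
      using ip(1) ip'(1) by auto
    have "f2 \<approx> f" using 2(3) in_stable_class_iff[OF _ _ f] replacements X by blast
    then show "a2 \<approx> a"
      using bifibrant_sequence_independent[OF ip(2) ip'(2) 2(1) b1(1) 2(2) b1(2) 2(4) m] by blast
  qed (use replacements ip ip' a in auto)
  moreover have "loop_map C M K X X' (scl X X' f) =
    \<Union>{scl (loop X) (loop X') a | a. ?P a}"
    unfolding loop_map_def by (rule arg_cong[where f = Union]) blast
  ultimately show ?thesis by simp
qed


lemma self_in_stable_class:
  assumes "X \<in> cofibrant M" "Y \<in> fibrant M" "f \<in> Hom C X Y"
  shows "f \<in> stable_class C M X Y f"
  using in_stable_class_iff[OF assms] assms(3) st_refl by (simp add: Hom_iff)

lemma Ho_cmp_class:
  assumes ob: "A \<in> Ob C" "D \<in> Ob C" "B \<in> Ob C" and f: "f \<in> RQ_Hom A D" and g: "g \<in> RQ_Hom D B"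
  shows "Ho_cmp C M K A B (scl D B g) (scl A D f) =
    scl A B (g \<cdot> f)"
proof -
  note r = replacements[OF ob(1)] replacements[OF ob(2)] replacements[OF ob(3)]
  let ?\<alpha> = "scl A D f" and ?\<beta> = "scl D B g"
  have "\<Union>{scl A B h | h. \<exists>f'\<in>?\<alpha>. \<exists>g'\<in>?\<beta>. h = g' \<cdot> f'} = scl A B (g \<cdot> f)"
  proof (rule Union_stable_class)
    show "g \<cdot> f \<in> RQ_Hom A B" by (rule cmp_in_Hom[OF f g])
    have "f \<in> ?\<alpha>" "g \<in> ?\<beta>" using self_in_stable_class[OF r(8,19) f] self_in_stable_class[OF r(18,29) g] by blast+
    then show "\<exists>h. \<exists>f'\<in>?\<alpha>. \<exists>g'\<in>?\<beta>. h = g' \<cdot> f'" by blast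
    fix h assume "\<exists>f'\<in>?\<alpha>. \<exists>g'\<in>?\<beta>. h = g' \<cdot> f'"
    then obtain f' g' where "f' \<in> ?\<alpha>" "g' \<in> ?\<beta>" and h: "h = g' \<cdot> f'" by blast
    then have "f' \<approx> f" "g' \<approx> g"
      using in_stable_class_iff[OF r(8) r(19) f] in_stable_class_iff[OF r(18) r(29) g] by blast+
    then show "h \<approx> g \<cdot> f" unfolding h by (rule st_cmp) (use f g in \<open>simp add: Hom_iff\<close>)
  qed (use r in simp_all)
  moreover have "Ho_cmp C M K A B ?\<beta> ?\<alpha> = \<Union>{scl A B h | h. \<exists>f'\<in>?\<alpha>. \<exists>g'\<in>?\<beta>. h = g' \<cdot> f'}"
    unfolding Ho_cmp_def by blast
  ultimately show ?thesis by simp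
qed

section \<open>The tower of iterated suspensions and loops\<close>

lemma Omega_ob_Ob:
  assumes "A \<in> Ob C"
  shows "Om n A \<in> Ob C"
proof -
  have "(loop ^^ m) A \<in> Ob C" for m by (induction m) (use assms loop_seq in auto)
  moreover have "(susp ^^ m) A \<in> Ob C" for m by (induction m) (use assms susp_seq in auto)
  ultimately show ?thesis by (simp add: Omega_ob_def)
qed

lemma Omega_ob_loop: "k \<ge> 0 \<Longrightarrow> Om (k + 1) A = loop (Om k A)"
  by (simp add: Omega_ob_def nat_add_distrib)

lemma Omega_ob_susp:
  assumes "k < 0"
  shows "Om k A = susp (Om (k + 1) A)"
proof -
  have "nat (- k) = Suc (nat (- (k + 1)))" using assms by simp
  then show ?thesis using assms by (cases "k = - 1") (simp_all add: Omega_ob_def)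
qed

text \<open>Both branches replace a sequence from \<open>Om (k + 1) A\<close> through a trivial
  object to \<open>Om k A\<close>: the loop sequence of \<open>Om k A\<close> for
  \<open>k \<ge> 0\<close>, the suspension sequence of \<open>Om (k + 1) A\<close> for negative
  \<open>k\<close>. One tower thus carries iterated loops and suspensions.\<close>

definition Omega_ses :: "'o \<Rightarrow> int \<Rightarrow> 'm \<times> 'm" where
  "Omega_ses A k = (SOME S. bifibrant_sequence C M K
     (if k \<ge> 0 then loop_seq K (Om k A) else susp_seq K (Om (k + 1) A)) S)"

abbreviation "oj A k \<equiv> fst (Omega_ses A k)"
abbreviation "os A k \<equiv> snd (Omega_ses A k)"

lemma Omega_ses:
  assumes A: "A \<in> Ob C"
  shows "bifibrant_sequence C M K
     (if k \<ge> 0 then loop_seq K (Om k A) else susp_seq K (Om (k + 1) A)) (oj A k, os A k)"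
    and "tri (oj A k) (os A k)" and "Dom C (oj A k) = RQ (Om (k + 1) A)"
    and "Cod C (os A k) = RQ (Om k A)"
proof -
  let ?E = "if k \<ge> 0 then loop_seq K (Om k A) else susp_seq K (Om (k + 1) A)"
  obtain i p where ip: "?E = (i, p)" "ses i p" "Cod C i \<in> trivial M"
    "Dom C i = Om (k + 1) A" "Cod C p = Om k A"
  proof (cases "k \<ge> 0")
    case True
    obtain i p where "loop_seq K (Om k A) = (i, p)" "ses i p" "Cod C p = Om k A" "Cod C i \<in> trivial M"
      "Dom C i = loop (Om k A)"
      using loop_seq[OF Omega_ob_Ob[OF A, of k]] by metis
    then show ?thesis using that[of i p] True Omega_ob_loop[OF True] by simp
  next
    case False
    obtain i p where "susp_seq K (Om (k + 1) A) = (i, p)" "ses i p" "Dom C i = Om (k + 1) A"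
      "Cod C i \<in> trivial M" "Cod C p = susp (Om (k + 1) A)"
      using susp_seq[OF Omega_ob_Ob[OF A, of "k + 1"]] by metis
    then show ?thesis using that[of i p] False Omega_ob_susp[of k A] by simp
  qed
  have "\<exists>S. bif_seq ?E S" using bifibrant_sequence_exists[OF ip(2,3)] unfolding ip(1) by blast
  then have b: "bif_seq ?E (Omega_ses A k)" unfolding Omega_ses_def by (rule someI_ex)
  then show "bif_seq ?E (oj A k, os A k)" by simp
  have b': "bif_seq (i, p) (oj A k, os A k)" using b unfolding ip(1) by simp
  show "tri (oj A k) (os A k)" "Dom C (oj A k) = RQ (Om (k + 1) A)" "Cod C (os A k) = RQ (Om k A)"
    using bifibrant_sequence_tri[OF ip(2) b'] ip(4,5) by simp_all
qed

lemma Omega_tower: "A \<in> Ob C \<Longrightarrow> tower (oj A) (os A)"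
  unfolding tower_def using Omega_ses by simp

lemma Omega_ob_0: "Om 0 A = A"
  by (simp add: Omega_ob_def)

text \<open>Going up, component \<open>k + 1\<close> is a left end over component \<open>k\<close>
  and represents its loop; going down, component \<open>k\<close> is a right end over component
  \<open>k + 1\<close> and represents its suspension.\<close>

lemma Omega_map_class:
  assumes A: "A \<in> Ob C" "A' \<in> Ob C" and f: "tower_map (oj A') (os A') (oj A) (os A) f"
  shows "Omega_map C M K n A' A (scl A' A (f 0)) =
    scl (Om n A') (Om n A) (f n)"
proof -
  have loop: "Om (int m) B = (loop ^^ m) B" for m B by (simp add: Omega_ob_def)
  have susp: "Om (- int m) B = (susp ^^ m) B" for m B by (cases "m = 0") (simp_all add: Omega_ob_def)
  have m: "\<exists>w. ses_morphism C (oj A' k, os A' k) (oj A k, os A k) (f (k + 1)) w (f k)" for k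
    using f unfolding tower_map_def by blast
  have L: "loop_pow C M K m A' A (scl A' A (f 0)) =
    scl (Om (int m) A') (Om (int m) A) (f (int m))" for m
  proof (induction m)
    case 0
    then show ?case by (simp add: Omega_ob_def)
  next
    case (Suc m)
    obtain w where w: "ses_morphism C (oj A' (int m), os A' (int m)) (oj A (int m), os A (int m)) (f (int m + 1)) w (f (int m))"
      using m by blast
    have "loop_map C M K (Om (int m) A') (Om (int m) A)
      (scl (Om (int m) A') (Om (int m) A) (f (int m))) =
      scl (loop (Om (int m) A')) (loop (Om (int m) A)) (f (int m + 1))"
      by (rule loop_map_class[OF Omega_ob_Ob[OF A(2)] Omega_ob_Ob[OF A(1)] _ _ w])
        (use Omega_ses(1)[OF A(1), of "int m"] Omega_ses(1)[OF A(2), of "int m"] in simp_all)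
    then show ?case using Suc.IH Omega_ob_loop[of "int m"] by (simp add: loop[symmetric] add.commute)
  qed
  have S: "susp_pow C M K m A' A (scl A' A (f 0)) =
    scl (Om (- int m) A') (Om (- int m) A) (f (- int m))" for m
  proof (induction m)
    case 0
    then show ?case by (simp add: Omega_ob_def)
  next
    case (Suc m)
    \<comment> \<open>At a negative index \<open>k\<close>, \<open>Omega_ses\<close> replaces the
      suspension sequence of the object with index \<open>k + 1\<close>, so suspending the object
      with index \<open>- m\<close> uses \<open>k = - m - 1\<close>.\<close>
    let ?k = "- int m - 1"
    obtain w where w: "ses_morphism C (oj A' ?k, os A' ?k) (oj A ?k, os A ?k) (f (- int m)) w (f ?k)"
      using m[of ?k] by auto
    have "susp_map C M K (Om (- int m) A') (Om (- int m) A)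
      (scl (Om (- int m) A') (Om (- int m) A) (f (- int m))) =
      scl (susp (Om (- int m) A')) (susp (Om (- int m) A)) (f ?k)"
      by (rule susp_map_class[OF Omega_ob_Ob[OF A(2)] Omega_ob_Ob[OF A(1)] _ _ w])
        (use Omega_ses(1)[OF A(1), of ?k] Omega_ses(1)[OF A(2), of ?k] in simp_all)
    moreover have e: "- int (Suc m) = ?k" by simp
    ultimately show ?case unfolding e using Suc.IH Omega_ob_susp[of ?k] by (simp add: susp[symmetric])
  qed
  show ?thesis using L[of "nat n"] S[of "nat (- n)"] by (simp add: Omega_map_def)
qed

lemma Sigma_Omega:
  "Sg n A = Om (- n) A" "Sigma_map C M K n A' A \<alpha> = Omega_map C M K (- n) A' A \<alpha>"
  by (cases "n = 0"; simp add: Sigma_ob_def Omega_ob_def Sigma_map_def Omega_map_def)+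

section \<open>Resolutions as towers\<close>

text \<open>\<open>X\<^sub>k\<close> is the image of the differential from degree \<open>k\<close> to degree \<open>k - 1\<close>; in particular \<open>X\<^sub>0\<close> is the
  resolved object.\<close>
definition resolution_tower :: "'m resolution \<Rightarrow> (int \<Rightarrow> 'm) \<Rightarrow> (int \<Rightarrow> 'm) \<Rightarrow> bool" where
  "resolution_tower V j s \<longleftrightarrow> tower j s \<and> j (- 1) = coaug V \<and> s 0 = aug V \<and> (\<forall>i. diff V i = j (i - 1) \<cdot> s i)"

text \<open>The resolution supplies fibrancy of the cycles with index \<open>\<ge> 0\<close> and
  cofibrancy of those with index \<open>\<le> 0\<close>. The other halves follow by induction away
  from 0, from closure of cofibrant objects under kernels going up and of fibrant objects under
  cokernels going down.\<close>

lemma resolution_tower_exists: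
  assumes X: "X \<in> cofibrant M" "X \<in> fibrant M" and V: "model_resolution C M X V"
  shows "\<exists>j s. resolution_tower V j s"
proof -
  note v = V[unfolded model_resolution_def]
  have ex: "exact_at C (diff V (i + 1)) (diff V i)" for i using v by blast
  have "\<forall>i. \<exists>k e. is_kernel C k (diff V i) \<and> is_epi C e \<and> Cod C e = Dom C k \<and> diff V (i + 1) = k \<cdot> e"
    using exact_factor[OF ex] by metis
  then obtain k e where ke: "\<And>i. is_kernel C (k i) (diff V i)" "\<And>i. is_epi C (e i)" "\<And>i. Cod C (e i) = Dom C (k i)"
    "\<And>i. diff V (i + 1) = k i \<cdot> e i" by metis
  have aug: "is_epi C (aug V)" "Cod C (aug V) = X" "is_mono C (coaug V)" "Dom C (coaug V) = X" "diff V 0 = coaug V \<cdot> aug V"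
    using v by (auto simp: Hom_iff)
  have coaug: "is_kernel C (coaug V) (diff V (- 1))" by (rule exact_mono_kernel) (use v in blast)+
  \<comment> \<open>The monomorphism at -1 and the epimorphism at 0 are the given coaugmentation and
    augmentation, so that the term with index 0 is the resolved object itself and not just
    isomorphic to it.\<close>
  define j where "j i = (if i = - 1 then coaug V else k i)" for i
  define s where "s i = (if i = 0 then aug V else e (i - 1))" for i
  have j: "is_kernel C (j i) (diff V i)" for i using ke(1) coaug by (simp add: j_def)
  have s: "is_epi C (s i)" "Cod C (s i) = Dom C (j (i - 1))" "diff V i = j (i - 1) \<cdot> s i" for i
    using ke(2) aug ke(3) ke(4)[of "i - 1"] by (auto simp: s_def j_def)
  have dims: "Dom C (j (i - 1) \<cdot> s i) = Dom C (s i)" for i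
    using s(1,2) kernelD(1)[OF j] by (intro cmp_Ar) simp_all
  have ses: "ses (j i) (s i)" for i
  proof (rule ses_kernelI[OF _ s(1)])
    show "is_kernel C (j i) (s i)"
      by (rule kernel_factor_mono[of _ "j (i - 1)"]) (use j[of i] kernelD(5)[OF j[of "i - 1"]] s in simp_all)
  qed
  have Dj: "Dom C (j i) = Cod C (s (i + 1))" for i using s(2)[of "i + 1"] by simp
  have Cj: "Cod C (j i) = cx_ob C V i" for i using kernelD(3)[OF j] by (simp add: cx_ob_def)
  have X0: "Cod C (s 0) = X" using aug by (simp add: s_def)
  have fib0: "Cod C (s i) \<in> fibrant M" if i: "i \<ge> 0" for i
  proof -
    consider "i = 0" | "i = 1" | "i \<ge> 2" using i by linarith
    then show ?thesis
    proof cases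
      case 1
      then show ?thesis using X0 X by simp
    next
      case 2
      have "is_kernel C (j 0) (aug V)" using ses[of 0] by (simp add: short_exact_def s_def)
      then show ?thesis using v s(2)[of i] 2 by simp
    next
      case 3
      then have "1 \<le> i - 1" by simp
      then show ?thesis using v j[of "i - 1"] unfolding s(2) by blast
    qed
  qed
  have cof0: "Cod C (s i) \<in> cofibrant M" if i: "i \<le> 0" for i
  proof -
    consider "i = 0" | "i = - 1" | "i \<le> - 2" using i by linarith
    then show ?thesis
    proof cases
      case 1
      then show ?thesis using X0 X by simp
    next
      case 2
      have "is_cokernel C (s (- 1)) (coaug V)" using ses[of "- 1"] by (simp add: short_exact_def j_def)
      then show ?thesis using v 2 by simp
    next
      case 3
      have "is_cokernel C (s i) (diff V (i + 1))"
        using cokernel_cmp_epi[OF ses[of i] s(1)[of "i + 1"]] s(2,3)[of "i + 1"] by simp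
      moreover have "i + 1 \<le> - 1" using 3 by simp
      ultimately show ?thesis using v by blast
    qed
  qed
  have Wc: "Cod C (j i) \<in> cofibrant M \<and> Cod C (j i) \<in> trivial M" if "i \<ge> 0" for i
    using v that unfolding Cj trivially_cofibrant_def by blast
  have Wf: "Cod C (j i) \<in> fibrant M \<and> Cod C (j i) \<in> trivial M" if "i \<le> - 1" for i
    using v that unfolding Cj trivially_fibrant_def by blast
  have cof1: "Cod C (s (int m)) \<in> cofibrant M" for m
  proof (induction m)
    case 0
    then show ?case using cof0[of 0] by simp
  next
    case (Suc m)
    then show ?case using cofibrant_kernel[OF ses[of "int m"]] Wc[of "int m"] Dj[of "int m"] by (simp add: add.commute)
  qed
  have fib1: "Cod C (s (- int m)) \<in> fibrant M" for m
  proof (induction m)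
    case 0
    then show ?case using fib0[of 0] by simp
  next
    case (Suc m)
    have "- int (Suc m) + 1 = - int m" by simp
    then show ?case using fibrant_cokernel[OF ses[of "- int (Suc m)"]] Wf[of "- int (Suc m)"] Dj[of "- int (Suc m)"] Suc by simp
  qed
  have bif: "Cod C (s i) \<in> cofibrant M" "Cod C (s i) \<in> fibrant M" for i
    using cof0[of i] fib0[of i] cof1[of "nat i"] fib1[of "nat (- i)"] by (cases "i \<ge> 0"; simp)+
  have "Cod C (j i) \<in> trivial M" for i using Wc[of i] Wf[of i] by (cases "i \<ge> 0") simp_all
  then have "tower j s" unfolding tower_def trivial_ses_def using ses bif Dj by simp
  then have "resolution_tower V j s" unfolding resolution_tower_def using s(3) by (simp add: j_def s_def)
  then show ?thesis by blast
qed

lemma resolution_towerD: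
  assumes "resolution_tower V j s"
  shows "tower j s" "j (- 1) = coaug V" "s 0 = aug V" "diff V i = j (i - 1) \<cdot> s i"
    "ses (j i) (s i)" "Dom C (j i) = Cod C (s (i + 1))" "cx_ob C V i = Cod C (j i)"
    "Dom C (j (i - 1)) = Cod C (s i)"
proof -
  show t: "tower j s" "j (- 1) = coaug V" "s 0 = aug V" "diff V i = j (i - 1) \<cdot> s i"
    using assms by (auto simp: resolution_tower_def)
  show ses: "ses (j i) (s i)" for i by (rule tower_ses[OF t(1)])
  show d: "Dom C (j i) = Cod C (s (i + 1))" for i by (rule tower_Dom[OF t(1)])
  show d1: "Dom C (j (i - 1)) = Cod C (s i)" using d[of "i - 1"] by simp
  show "cx_ob C V i = Cod C (j i)"
    unfolding cx_ob_def t(4) using sesD[OF ses[of i]] sesD[OF ses[of "i - 1"]] d1 by simp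
qed

text \<open>The composite \<open>s' i \<cdot> t i\<close> kills \<open>j i\<close>, as is seen after
  composing with the monomorphism \<open>j' (i - 1)\<close>. A chain map thus descends along each
  \<open>s i\<close>, and its components serve as the middle maps of a tower map.\<close>

lemma chain_lift_tower_map:
  assumes V: "resolution_tower V j s" and V': "resolution_tower V' j' s'"
    and f: "f \<in> Hom C (Cod C (s 0)) (Cod C (s' 0))" and t: "chain_lift C V V' f t"
  obtains r where "tower_map j s j' s' r" "r 0 = f" "\<And>i. s' i \<cdot> t i = r i \<cdot> s i"
proof -
  note d = resolution_towerD[OF V] and d' = resolution_towerD[OF V']
  note ses = sesD[OF d(5)] and ses' = sesD[OF d'(5)]
  have t1: "t i \<in> Ar C" "Dom C (t i) = Cod C (j i)" "Cod C (t i) = Cod C (j' i)" for i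
    using t d(7) d'(7) unfolding chain_lift_def Hom_iff by auto
  have t2: "(j' (i - 1) \<cdot> s' i) \<cdot> t i = t (i - 1) \<cdot> (j (i - 1) \<cdot> s i)" for i
    using t unfolding chain_lift_def d(4)[symmetric] d'(4)[symmetric] by blast
  note [simp] = ses ses' t1 d(8) d'(8)
  have t3: "j' (i - 1) \<cdot> (s' i \<cdot> t i) = t (i - 1) \<cdot> (j (i - 1) \<cdot> s i)" for i using t2[of i] by simp
  have "\<exists>r. r \<in> Ar C \<and> Dom C r = Cod C (s i) \<and> Cod C r = Cod C (s' i) \<and> r \<cdot> s i = s' i \<cdot> t i" for i
  proof -
    have "j' (i - 1) \<cdot> ((s' i \<cdot> t i) \<cdot> j i) = (j' (i - 1) \<cdot> (s' i \<cdot> t i)) \<cdot> j i" by (rule assoc[symmetric]) simp_all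
    also have "\<dots> = \<zero>\<^bsub>Dom C (j i),Cod C (j' (i - 1))\<^esub>" unfolding t3 by simp
    finally have "(s' i \<cdot> t i) \<cdot> j i = \<zero>\<^bsub>Dom C ((s' i \<cdot> t i) \<cdot> j i),Dom C (j' (i - 1))\<^esub>"
      by (rule mono_zero[OF sesD(5)[OF d'(5)]]) simp_all
    then have "(s' i \<cdot> t i) \<cdot> j i = \<zero>\<^bsub>Dom C (j i),Cod C (s' i)\<^esub>" by simp
    then obtain r where "r \<in> Ar C" "Cod C r = Cod C (s' i \<cdot> t i)" "Dom C r = Cod C (s i)" "r \<cdot> s i = s' i \<cdot> t i"
      using ses_colift[OF d(5)[of i], of "s' i \<cdot> t i"] by auto
    then show ?thesis by auto
  qed
  then obtain r where r: "\<And>i. r i \<in> Ar C" "\<And>i. Dom C (r i) = Cod C (s i)" "\<And>i. Cod C (r i) = Cod C (s' i)"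
    "\<And>i. r i \<cdot> s i = s' i \<cdot> t i" by metis
  note [simp] = r(1-3)
  have sq: "j' (i - 1) \<cdot> r i = t (i - 1) \<cdot> j (i - 1)" for i
  proof (rule epi_cancel[OF sesD(6)[OF d(5)[of i]]])
    show "(j' (i - 1) \<cdot> r i) \<cdot> s i = (t (i - 1) \<cdot> j (i - 1)) \<cdot> s i"
      using t3[of i] by (simp add: r(4))
  qed simp_all
  have "tower_map j s j' s' r"
    unfolding tower_map_def
  proof
    fix k
    have "t k \<cdot> j k = j' k \<cdot> r (k + 1)" using sq[of "k + 1"] by simp
    moreover have "Dom C (j k) = Cod C (s (k + 1))" "Dom C (j' k) = Cod C (s' (k + 1))" by (rule d(6) d'(6))+
    ultimately show "\<exists>w. ses_morphism C (j k, s k) (j' k, s' k) (r (k + 1)) w (r k)"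
      unfolding ses_morphism_iff using r(4)[of k] by (intro exI[of _ "t k"]) simp
  qed
  moreover have "r 0 = f"
  proof (rule epi_cancel[OF sesD(6)[OF d(5)[of 0]]])
    have "s' 0 \<cdot> t 0 = f \<cdot> s 0" using t unfolding chain_lift_def d(3)[symmetric] d'(3)[symmetric] by blast
    then show "r 0 \<cdot> s 0 = f \<cdot> s 0" using r(4)[of 0] by simp
  qed (use f in \<open>simp_all add: Hom_iff\<close>)
  ultimately show ?thesis using that[of r] r(4) by simp
qed

text \<open>The middle maps form the chain map: they commute with both factors of each differential
  \<open>j (i - 1) \<cdot> s i\<close>.\<close>

lemma tower_map_chain_lift:
  assumes V: "resolution_tower V j s" and V': "resolution_tower V' j' s'" and r: "tower_map j s j' s' r"
  shows "\<exists>t. chain_lift C V V' (r 0) t"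
proof -
  note d = resolution_towerD[OF V] and d' = resolution_towerD[OF V']
  note ses = sesD[OF d(5)] and ses' = sesD[OF d'(5)]
  obtain t where t: "\<And>k. ses_morphism C (j k, s k) (j' k, s' k) (r (k + 1)) (t k) (r k)"
    using r unfolding tower_map_def by metis
  have t1: "t k \<in> Ar C" "Dom C (t k) = Cod C (j k)" "Cod C (t k) = Cod C (j' k)"
    "t k \<cdot> j k = j' k \<cdot> r (k + 1)" "r k \<cdot> s k = s' k \<cdot> t k" for k
    using t[of k] unfolding ses_morphism_iff by blast+
  note [simp] = ses ses' t1(1-3) d(8) d'(8) tower_mapD[OF r]
  have "(j' (i - 1) \<cdot> s' i) \<cdot> t i = t (i - 1) \<cdot> (j (i - 1) \<cdot> s i)" for i
  proof -
    have "(j' (i - 1) \<cdot> s' i) \<cdot> t i = j' (i - 1) \<cdot> (r i \<cdot> s i)" unfolding t1(5) by simp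
    also have "\<dots> = (j' (i - 1) \<cdot> r i) \<cdot> s i" by simp
    also have "j' (i - 1) \<cdot> r i = t (i - 1) \<cdot> j (i - 1)" using t1(4)[of "i - 1"] by simp
    finally show ?thesis by simp
  qed
  moreover have "s' 0 \<cdot> t 0 = r 0 \<cdot> s 0" using t1(5)[of 0] by simp
  moreover have "t (- 1) \<cdot> j (- 1) = j' (- 1) \<cdot> r 0" using t1(4)[of "- 1"] by simp
  ultimately have "chain_lift C V V' (r 0) t"
    unfolding chain_lift_def d(4) d'(4) d(2)[symmetric] d(3)[symmetric] d'(2)[symmetric] d'(3)[symmetric]
    using t1 by (simp add: d(7) d'(7) Hom_iff)
  then show ?thesis by blast
qed

section \<open>Cohomology of a resolution\<close>

abbreviation "cocycle_group V B n \<equiv> (Hom_group C (cx_ob C V n) B)\<lparr>carrier := cocycles C V B n\<rparr>"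

text \<open>Since \<open>s (n + 1)\<close> is epic, vanishing on the differential means vanishing on
  \<open>j n\<close>, so a cocycle factors through the cokernel \<open>s n\<close>.\<close>

lemma cocycles_eq:
  assumes V: "resolution_tower V j s" and B: "B \<in> Ob C"
  shows "cocycles C V B n = {g \<cdot> s n | g. g \<in> Hom C (Cod C (s n)) B}"
proof -
  note d = resolution_towerD[OF V]
  note [simp] = sesD[OF d(5)] B d(8) d(7)
  have [simp]: "Dom C (j n) = Cod C (s (n + 1))" by (rule d(6))
  have dn: "diff V (n + 1) = j n \<cdot> s (n + 1)" using d(4)[of "n + 1"] by simp
  show ?thesis
  proof (intro equalityI subsetI)
    fix x assume "x \<in> cocycles C V B n"
    then have x: "x \<in> Ar C" "Dom C x = Cod C (j n)" "Cod C x = B" "x \<cdot> (j n \<cdot> s (n + 1)) = \<zero>\<^bsub>Cod C (j (n + 1)),B\<^esub>"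
      by (auto simp: cocycles_def Hom_iff dn)
    have "(x \<cdot> j n) \<cdot> s (n + 1) = \<zero>\<^bsub>Dom C (s (n + 1)),Cod C (x \<cdot> j n)\<^esub>" using x by simp
    then have "x \<cdot> j n = \<zero>\<^bsub>Cod C (s (n + 1)),Cod C (x \<cdot> j n)\<^esub>"
      by (rule epi_zero[OF sesD(6)[OF d(5)]]) (use x in simp_all)
    then have "x \<cdot> j n = \<zero>\<^bsub>Dom C (j n),Cod C x\<^esub>" using x(1,2) by simp
    then obtain g where "g \<in> Ar C" "Cod C g = Cod C x" "Dom C g = Cod C (s n)" "g \<cdot> s n = x"
      using ses_colift[OF d(5)[of n], of x] x by auto
    then show "x \<in> {g \<cdot> s n | g. g \<in> Hom C (Cod C (s n)) B}" using x by (auto simp: Hom_iff)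
  next
    fix x assume "x \<in> {g \<cdot> s n | g. g \<in> Hom C (Cod C (s n)) B}"
    then obtain g where g: "g \<in> Ar C" "Dom C g = Cod C (s n)" "Cod C g = B" "x = g \<cdot> s n" by (auto simp: Hom_iff)
    have "s n \<cdot> (j n \<cdot> s (n + 1)) = \<zero>\<^bsub>Cod C (j (n + 1)),Cod C (s n)\<^esub>"
      using cmp_reduce[OF sesD(4)[OF d(5)[of n]], of "s (n + 1)"] by simp
    then show "x \<in> cocycles C V B n" using g by (simp add: cocycles_def Hom_iff dn)
  qed
qed

text \<open>Cancelling \<open>s n\<close> in a coboundary leaves a factorisation of \<open>g\<close>
  through the trivial term in degree \<open>n - 1\<close>. Conversely, if \<open>g\<close> factors
  through the core, the first factor extends along \<open>j (n - 1)\<close>, whose cokernel is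
  cofibrant; followed by the second factor, this is a cochain with coboundary
  \<open>g \<cdot> s n\<close>.\<close>

lemma coboundary_iff:
  assumes V: "resolution_tower V j s" and B: "B \<in> fibrant M" and g: "g \<in> Hom C (Cod C (s n)) B"
  shows "g \<cdot> s n \<in> coboundaries C V B n \<longleftrightarrow> null g"
proof -
  note d = resolution_towerD[OF V]
  note t = triD[OF tower_tri[OF d(1)]]
  note [simp] = sesD[OF d(5)] d(8) d(7)
  have gs [simp]: "g \<in> Ar C" "Dom C g = Cod C (s n)" "Cod C g = B" using g by (auto simp: Hom_iff)
  show ?thesis
  proof
    assume "g \<cdot> s n \<in> coboundaries C V B n"
    then obtain h where h: "h \<in> Ar C" "Dom C h = Cod C (j (n - 1))" "Cod C h = B" "g \<cdot> s n = h \<cdot> (j (n - 1) \<cdot> s n)"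
      by (auto simp: coboundaries_def Hom_iff d(4))
    have "g \<cdot> s n = (h \<cdot> j (n - 1)) \<cdot> s n" using h by simp
    then have "g = h \<cdot> j (n - 1)" by (rule epi_cancel[OF sesD(6)[OF d(5)[of n]]]) (use h(1-3) in simp_all)
    then show "null g" using nullI[of "j (n - 1)" h] h(1-3) t(4) by simp
  next
    assume "null g"
    then obtain u v where uv: "u \<in> Ar C" "v \<in> Ar C" "Dom C v = Cod C u" "Cod C u \<in> cofibrant M" "Cod C u \<in> trivial M"
      "Cod C u \<in> fibrant M" "g = v \<cdot> u"
      using null_through_core[of g] t(5)[of n] B by auto
    have du: "Dom C u = Dom C (j (n - 1))" "Cod C v = B" using cmp_Ar(2,3)[OF uv(1,2,3)] uv(7) gs by simp_all
    obtain u1 where u1: "u1 \<in> Ar C" "Cod C u1 = Cod C u" "Dom C u1 = Cod C (j (n - 1))" "u1 \<cdot> j (n - 1) = u"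
      by (rule extend_fibrant[OF uv(6) t(1)[of "n - 1"] t(5) _ uv(1)]) (use uv du in auto)
    have "(v \<cdot> u1) \<cdot> (j (n - 1) \<cdot> s n) = v \<cdot> ((u1 \<cdot> j (n - 1)) \<cdot> s n)" using u1(1-3) uv(1-3) by simp
    also have "\<dots> = g \<cdot> s n" unfolding u1(4) uv(7) using uv(1-3) du by simp
    finally show "g \<cdot> s n \<in> coboundaries C V B n"
      unfolding coboundaries_def d(4) using u1(1-3) uv(1-3) du by (auto simp: Hom_iff intro!: exI[of _ "v \<cdot> u1"])
  qed
qed

lemma coboundaries_sub:
  assumes V: "resolution_tower V j s" and B: "B \<in> Ob C"
  shows "coboundaries C V B n \<subseteq> cocycles C V B n"
proof
  note d = resolution_towerD[OF V]
  note [simp] = sesD[OF d(5)] d(8) d(7)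
  fix x assume "x \<in> coboundaries C V B n"
  then obtain h where h: "h \<in> Ar C" "Dom C h = Cod C (j (n - 1))" "Cod C h = B" "x = h \<cdot> (j (n - 1) \<cdot> s n)"
    by (auto simp: coboundaries_def Hom_iff d(4))
  then have "x = (h \<cdot> j (n - 1)) \<cdot> s n" "h \<cdot> j (n - 1) \<in> Hom C (Cod C (s n)) B" by (simp_all add: Hom_iff)
  then show "x \<in> cocycles C V B n" unfolding cocycles_eq[OF V B] by blast
qed

lemma cocycle_group:
  assumes V: "resolution_tower V j s" and B: "B \<in> fibrant M"
  shows "comm_group (cocycle_group V B n)" "subgroup (coboundaries C V B n) (cocycle_group V B n)"
    "g \<in> Hom C (Cod C (s n)) B \<Longrightarrow> inv\<^bsub>cocycle_group V B n\<^esub> (g \<cdot> s n) = neg (g \<cdot> s n)"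
proof -
  note d = resolution_towerD[OF V]
  have ob [simp]: "B \<in> Ob C" using B QR_Ob by blast
  note [simp] = sesD[OF d(5)]
  have cx [simp]: "cx_ob C V n = Cod C (j n)" by (rule d(7))
  interpret G: comm_group "Hom_group C (cx_ob C V n) B" by (rule Hom_comm_group) simp_all
  note cy = cocycles_eq[OF V ob, of n]
  have sub: "subgroup (cocycles C V B n) (Hom_group C (cx_ob C V n) B)"
  proof
    show "cocycles C V B n \<subseteq> carrier (Hom_group C (cx_ob C V n) B)" by (auto simp: cocycles_def)
    have "\<zero>\<^bsub>Cod C (s n),B\<^esub> \<cdot> s n = \<zero>\<^bsub>Cod C (j n),B\<^esub>" "\<zero>\<^bsub>Cod C (s n),B\<^esub> \<in> Hom C (Cod C (s n)) B" by (simp_all add: Hom_iff)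
    then show "\<one>\<^bsub>Hom_group C (cx_ob C V n) B\<^esub> \<in> cocycles C V B n" unfolding cy by force
    fix x assume "x \<in> cocycles C V B n"
    then obtain g where g: "g \<in> Hom C (Cod C (s n)) B" "x = g \<cdot> s n" unfolding cy by blast
    have "inv\<^bsub>Hom_group C (cx_ob C V n) B\<^esub> x = neg g \<cdot> s n"
      using Hom_group_inv[of x "cx_ob C V n" B] g by (simp add: Hom_iff)
    moreover have "neg g \<in> Hom C (Cod C (s n)) B" using g by (simp add: Hom_iff)
    ultimately show "inv\<^bsub>Hom_group C (cx_ob C V n) B\<^esub> x \<in> cocycles C V B n" unfolding cy by blast
    fix y assume "y \<in> cocycles C V B n"
    then obtain h where h: "h \<in> Hom C (Cod C (s n)) B" "y = h \<cdot> s n" unfolding cy by blast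
    have "x \<otimes>\<^bsub>Hom_group C (cx_ob C V n) B\<^esub> y = (g \<oplus> h) \<cdot> s n" using g h by (simp add: Hom_iff)
    moreover have "g \<oplus> h \<in> Hom C (Cod C (s n)) B" using g h by (simp add: Hom_iff)
    ultimately show "x \<otimes>\<^bsub>Hom_group C (cx_ob C V n) B\<^esub> y \<in> cocycles C V B n" unfolding cy by blast
  qed
  have grp: "group (cocycle_group V B n)" using G.subgroup_imp_group[OF sub] .
  show cg: "comm_group (cocycle_group V B n)"
    by (rule group.group_comm_groupI[OF grp]) (use G.m_comm subgroup.subset[OF sub] in auto)
  have inv: "inv\<^bsub>cocycle_group V B n\<^esub> (g \<cdot> s n) = neg (g \<cdot> s n)" if g: "g \<in> Hom C (Cod C (s n)) B" for g
  proof -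
    have "g \<cdot> s n \<in> cocycles C V B n" using g unfolding cy by blast
    then have "inv\<^bsub>cocycle_group V B n\<^esub> (g \<cdot> s n) = inv\<^bsub>Hom_group C (cx_ob C V n) B\<^esub> (g \<cdot> s n)"
      using G.m_inv_consistent[OF sub] by simp
    also have "\<dots> = neg (g \<cdot> s n)" by (rule Hom_group_inv) (use g in \<open>simp add: Hom_iff\<close>)
    finally show ?thesis .
  qed
  then show "g \<in> Hom C (Cod C (s n)) B \<Longrightarrow> inv\<^bsub>cocycle_group V B n\<^esub> (g \<cdot> s n) = neg (g \<cdot> s n)" .
  have el: "\<exists>g. g \<in> Hom C (Cod C (s n)) B \<and> x = g \<cdot> s n \<and> null g" if x: "x \<in> coboundaries C V B n" for x
  proof -
    obtain g where "g \<in> Hom C (Cod C (s n)) B" "x = g \<cdot> s n"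
      using coboundaries_sub[OF V ob, of n] x unfolding cy by blast
    then show ?thesis using coboundary_iff[OF V B] x by blast
  qed
  show "subgroup (coboundaries C V B n) (cocycle_group V B n)"
  proof (rule group.subgroupI[OF grp])
    show "coboundaries C V B n \<subseteq> carrier (cocycle_group V B n)" using coboundaries_sub[OF V ob] by simp
    have "\<zero>\<^bsub>Cod C (s n),B\<^esub> \<in> Hom C (Cod C (s n)) B" "null \<zero>\<^bsub>Cod C (s n),B\<^esub>" by (simp_all add: Hom_iff null_zero)
    then show "coboundaries C V B n \<noteq> {}" using coboundary_iff[OF V B] by blast
    fix x assume "x \<in> coboundaries C V B n"
    then obtain g where g: "g \<in> Hom C (Cod C (s n)) B" "x = g \<cdot> s n" "null g" using el by blast
    have "neg g \<in> Hom C (Cod C (s n)) B" "neg (g \<cdot> s n) = neg g \<cdot> s n" using g(1) by (simp_all add: Hom_iff)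
    then show "inv\<^bsub>cocycle_group V B n\<^esub> x \<in> coboundaries C V B n"
      unfolding g(2) inv[OF g(1)] using coboundary_iff[OF V B] null_neg[OF g(3)] by simp
    fix y assume "y \<in> coboundaries C V B n"
    then obtain h where h: "h \<in> Hom C (Cod C (s n)) B" "y = h \<cdot> s n" "null h" using el by blast
    have "g \<oplus> h \<in> Hom C (Cod C (s n)) B" "x \<otimes>\<^bsub>cocycle_group V B n\<^esub> y = (g \<oplus> h) \<cdot> s n" "null (g \<oplus> h)"
      using g h null_plus by (simp_all add: Hom_iff)
    then show "x \<otimes>\<^bsub>cocycle_group V B n\<^esub> y \<in> coboundaries C V B n" using coboundary_iff[OF V B] by simp
  qed
qed

text \<open>A coset depends on the multiplication alone, so restricting the carrier to the cocycles
  leaves it unchanged.\<close>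

lemma cohomology_class_coset:
  "cohomology_class C V B n x = coboundaries C V B n #>\<^bsub>cocycle_group V B n\<^esub> x"
  by (simp add: cohomology_class_def r_coset_def)

lemma cohomology_class_eq_iff:
  assumes V: "resolution_tower V j s" and B: "B \<in> fibrant M"
    and g: "g \<in> Hom C (Cod C (s n)) B" and h: "h \<in> Hom C (Cod C (s n)) B"
  shows "cohomology_class C V B n (g \<cdot> s n) = cohomology_class C V B n (h \<cdot> s n) \<longleftrightarrow> g \<approx> h"
proof -
  note c = cocycle_group[OF V B, where n = n]
  note [simp] = sesD[OF resolution_towerD(5)[OF V]]
  have ob: "B \<in> Ob C" using B QR_Ob by blast
  have cy: "g \<cdot> s n \<in> cocycles C V B n" "h \<cdot> s n \<in> cocycles C V B n" using g h cocycles_eq[OF V ob] by blast+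
  have gh: "g \<ominus> h \<in> Hom C (Cod C (s n)) B" "(g \<cdot> s n) \<ominus> (h \<cdot> s n) = (g \<ominus> h) \<cdot> s n" using g h by (simp_all add: Hom_iff)
  have "cohomology_class C V B n (g \<cdot> s n) = cohomology_class C V B n (h \<cdot> s n) \<longleftrightarrow>
    (g \<cdot> s n) \<otimes>\<^bsub>cocycle_group V B n\<^esub> inv\<^bsub>cocycle_group V B n\<^esub> (h \<cdot> s n) \<in> coboundaries C V B n"
    unfolding cohomology_class_coset by (rule comm_group.coset_eq_iff[OF c(1,2)]) (use cy in simp_all)
  also have "(g \<cdot> s n) \<otimes>\<^bsub>cocycle_group V B n\<^esub> inv\<^bsub>cocycle_group V B n\<^esub> (h \<cdot> s n) = (g \<ominus> h) \<cdot> s n"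
    unfolding c(3)[OF h] using gh(2) by simp
  also have "(g \<ominus> h) \<cdot> s n \<in> coboundaries C V B n \<longleftrightarrow> g \<approx> h"
    using coboundary_iff[OF V B gh(1)] g h by (simp add: stably_eq_def Hom_iff)
  finally show ?thesis .
qed

lemma in_cohomology_class:
  assumes V: "resolution_tower V j s" and B: "B \<in> fibrant M" and g: "g \<in> Hom C (Cod C (s n)) B"
    and x: "x \<in> cohomology_class C V B n (g \<cdot> s n)"
  obtains g' where "g' \<in> Hom C (Cod C (s n)) B" "x = g' \<cdot> s n" "g' \<approx> g"
proof -
  note c = cocycle_group[OF V B, where n = n]
  have ob: "B \<in> Ob C" using B QR_Ob by blast
  interpret G: comm_group "cocycle_group V B n" by (rule c(1))
  have cy: "g \<cdot> s n \<in> carrier (cocycle_group V B n)" using g cocycles_eq[OF V ob] by auto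
  have "x \<in> carrier (cocycle_group V B n)"
    using x G.r_coset_subset_G[OF subgroup.subset[OF c(2)] cy] unfolding cohomology_class_coset by blast
  then obtain g' where g': "g' \<in> Hom C (Cod C (s n)) B" "x = g' \<cdot> s n" using cocycles_eq[OF V ob] by auto
  have "cohomology_class C V B n (g \<cdot> s n) = cohomology_class C V B n x"
    using G.repr_independence[OF _ cy c(2), of x] x unfolding cohomology_class_coset by simp
  then have "g' \<approx> g" using cohomology_class_eq_iff[OF V B g g'(1)] g'(2) st_sym by simp
  then show ?thesis using that g' by blast
qed

lemma self_in_cohomology_class:
  assumes V: "resolution_tower V j s" and B: "B \<in> fibrant M" and g: "g \<in> Hom C (Cod C (s n)) B"
  shows "g \<cdot> s n \<in> cohomology_class C V B n (g \<cdot> s n)"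
proof -
  note c = cocycle_group[OF V B, where n = n]
  have ob: "B \<in> Ob C" using B QR_Ob by blast
  interpret G: comm_group "cocycle_group V B n" by (rule c(1))
  have "g \<cdot> s n \<in> carrier (cocycle_group V B n)" using g cocycles_eq[OF V ob] by auto
  then show ?thesis unfolding cohomology_class_coset by (rule G.rcos_self[OF _ c(2)])
qed

section \<open>The two isomorphisms\<close>

definition res_pair :: "'o \<Rightarrow> (int \<Rightarrow> 'm) \<times> (int \<Rightarrow> 'm)" where
  "res_pair A = (SOME p. resolution_tower (reso K (RQ A)) (fst p) (snd p))"

abbreviation "rj A \<equiv> fst (res_pair A)"
abbreviation "rs A \<equiv> snd (res_pair A)"

lemma res_tower:
  assumes "A \<in> Ob C"
  shows "resolution_tower (reso K (RQ A)) (rj A) (rs A)" "tower (rj A) (rs A)" "Cod C (rs A 0) = RQ A"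
    "rs A n \<in> Ar C" "Cod C (rs A n) \<in> Ob C"
proof -
  note r = replacements[OF assms]
  have V: "model_resolution C M (RQ A) (reso K (RQ A))" using valid r(8) unfolding valid_choice_def by blast
  have "\<exists>p. resolution_tower (reso K (RQ A)) (fst p) (snd p)"
    using resolution_tower_exists[OF r(8,9) V] by auto
  then show t: "resolution_tower (reso K (RQ A)) (rj A) (rs A)" unfolding res_pair_def by (rule someI_ex)
  then show "tower (rj A) (rs A)" by (rule resolution_towerD)
  show "Cod C (rs A 0) = RQ A" using resolution_towerD(3)[OF t] V by (auto simp: model_resolution_def Hom_iff)
  show "rs A n \<in> Ar C" using sesD(2)[OF resolution_towerD(5)[OF t]] .
  then show "Cod C (rs A n) \<in> Ob C" by simp
qed

abbreviation "cocyc A B \<equiv> cocycle_group (reso K (RQ A)) (RQ B)"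
abbreviation "cobd A B \<equiv> coboundaries C (reso K (RQ A)) (RQ B)"
abbreviation "coh A B n \<equiv> cohomology_class C (reso K (RQ A)) (RQ B) n"

text \<open>The union ranges over representatives and chain lifts. A lift of \<open>a1\<close>
  induces a tower map starting at \<open>a1\<close>, and \<open>a1 \<approx> r 0\<close> propagates
  to index \<open>n\<close>, so all members are one cohomology class.\<close>

lemma Ext_Ho_map_class:
  assumes ob: "A \<in> Ob C" "A' \<in> Ob C" "B \<in> Ob C" "B' \<in> Ob C"
    and b: "b \<in> RQ_Hom B B'" and r: "tower_map (rj A') (rs A') (rj A) (rs A) r"
    and g: "g \<in> Hom C (Cod C (rs A n)) (RQ B)"
  shows "Ext_Ho_map C K n A A' B B' (scl A' A (r 0)) (scl B B' b)
      (coh A B n (g \<cdot> rs A n)) = coh A' B' n ((b \<cdot> (g \<cdot> r n)) \<cdot> rs A' n)"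
proof -
  note rep = replacements[OF ob(1)] replacements[OF ob(2)] replacements[OF ob(3)] replacements[OF ob(4)]
  note R = res_tower[OF ob(1)] and R' = res_tower[OF ob(2)]
  note rD = tower_mapD[OF r]
  have a: "r 0 \<in> RQ_Hom A' A" using rD R R' by (simp add: Hom_iff)
  have bgr: "b \<cdot> (g \<cdot> r n) \<in> Hom C (Cod C (rs A' n)) (RQ B')" using b g rD by (simp add: Hom_iff)
  have one: "coh A' B' n (b1 \<cdot> (x1 \<cdot> t1 n)) = coh A' B' n ((b \<cdot> (g \<cdot> r n)) \<cdot> rs A' n)"
    if m: "a1 \<in> scl A' A (r 0)" "b1 \<in> scl B B' b"
      "x1 \<in> coh A B n (g \<cdot> rs A n)" "chain_lift C (reso K (RQ A')) (reso K (RQ A)) a1 t1" for a1 b1 x1 t1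
  proof -
    have a1: "a1 \<in> RQ_Hom A' A" "a1 \<approx> r 0" using m(1) in_stable_class_iff[OF rep(18,9) a] by blast+
    have b1: "b1 \<in> RQ_Hom B B'" "b1 \<approx> b" using m(2) in_stable_class_iff[OF rep(28,39) b] by blast+
    obtain g1 where g1: "g1 \<in> Hom C (Cod C (rs A n)) (RQ B)" "x1 = g1 \<cdot> rs A n" "g1 \<approx> g"
      by (rule in_cohomology_class[OF R(1) rep(29) g m(3)])
    obtain r1 where r1: "tower_map (rj A') (rs A') (rj A) (rs A) r1" "r1 0 = a1" "\<And>i. rs A i \<cdot> t1 i = r1 i \<cdot> rs A' i"
      by (rule chain_lift_tower_map[OF R'(1) R(1) _ m(4)]) (use a1 R R' in auto)
    note r1D = tower_mapD[OF r1(1)]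
    have t1: "t1 n \<in> Ar C" "Cod C (t1 n) = Dom C (rs A n)"
      using m(4) resolution_towerD(7)[OF R(1), of n] sesD(3)[OF resolution_towerD(5)[OF R(1)]]
      unfolding chain_lift_def by (auto simp: Hom_iff)
    have "x1 \<cdot> t1 n = g1 \<cdot> (r1 n \<cdot> rs A' n)"
      unfolding g1(2) r1(3)[symmetric] using g1(1) t1 R(4) by (intro assoc) (auto simp: Hom_iff)
    then have e: "b1 \<cdot> (x1 \<cdot> t1 n) = (b1 \<cdot> (g1 \<cdot> r1 n)) \<cdot> rs A' n"
      using b1(1) g1(1) r1D R(4) R'(4) by (simp add: Hom_iff)
    have "r1 n \<approx> r n" by (rule tower_map_st[OF R'(2) R(2) r1(1) r, of 0]) (use r1 a1 in simp)
    then have "g1 \<cdot> r1 n \<approx> g \<cdot> r n" by (rule st_cmp[OF _ g1(3)]) (use g rD in \<open>simp add: Hom_iff\<close>)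
    then have "b1 \<cdot> (g1 \<cdot> r1 n) \<approx> b \<cdot> (g \<cdot> r n)" by (rule st_cmp[OF _ b1(2)]) (use b g rD in \<open>simp add: Hom_iff\<close>)
    moreover have "b1 \<cdot> (g1 \<cdot> r1 n) \<in> Hom C (Cod C (rs A' n)) (RQ B')" using b1 g1 r1D by (simp add: Hom_iff)
    ultimately show ?thesis unfolding e using cohomology_class_eq_iff[OF R'(1) rep(39) _ bgr] by blast
  qed
  obtain t where t: "chain_lift C (reso K (RQ A')) (reso K (RQ A)) (r 0) t"
    using tower_map_chain_lift[OF R'(1) R(1) r] by blast
  have self: "r 0 \<in> scl A' A (r 0)" "b \<in> scl B B' b"
    "g \<cdot> rs A n \<in> coh A B n (g \<cdot> rs A n)"
    using self_in_stable_class[OF rep(18,9) a] self_in_stable_class[OF rep(28,39) b]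
      self_in_cohomology_class[OF R(1) rep(29) g] by blast+
  show ?thesis
    unfolding Ext_Ho_map_def
    using one self t by blast
qed

lemma Ho_carrierE:
  assumes "\<alpha> \<in> carrier (Ho C M K A B)"
  obtains a where "a \<in> RQ_Hom A B" "\<alpha> = scl A B a"
  using assms unfolding Ho_def carrier_stable_Hom by blast

lemma Omega_natural_iso:
  "\<exists>\<phi>. natural_iso C M K (\<lambda>A B. Ho C M K (Om n A) B) (Ho_Omega_map C M K n)
     (Ext_Ho C K n) (Ext_Ho_map C K n) \<phi>"
proof -
  have "\<exists>u. tower_map (rj A) (rs A) (oj A) (os A) u \<and> u 0 = Idt C (RQ A)" if "A \<in> Ob C" for A
    using tower_map_exists[OF res_tower(2)[OF that] Omega_tower[OF that], of "Idt C (RQ A)"]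
      replacements(10)[OF that] res_tower(3)[OF that] Omega_ses(4)[OF that, of 0] by (auto simp: Omega_ob_0)
  then obtain \<theta> where \<theta>: "\<And>A. A \<in> Ob C \<Longrightarrow> tower_map (rj A) (rs A) (oj A) (os A) (\<theta> A)"
    "\<And>A. A \<in> Ob C \<Longrightarrow> \<theta> A 0 = Idt C (RQ A)" by metis
  have "\<exists>u. tower_map (oj A) (os A) (rj A) (rs A) u \<and> u 0 = Idt C (RQ A)" if "A \<in> Ob C" for A
    using tower_map_exists[OF Omega_tower[OF that] res_tower(2)[OF that], of "Idt C (RQ A)"]
      replacements(10)[OF that] res_tower(3)[OF that] Omega_ses(4)[OF that, of 0] by (auto simp: Omega_ob_0)
  then obtain \<eta> where \<eta>: "\<And>A. A \<in> Ob C \<Longrightarrow> tower_map (oj A) (os A) (rj A) (rs A) (\<eta> A)"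
    "\<And>A. A \<in> Ob C \<Longrightarrow> \<eta> A 0 = Idt C (RQ A)" by metis
  have \<theta>D: "\<theta> A n \<in> Ar C" "Dom C (\<theta> A n) = Cod C (rs A n)" "Cod C (\<theta> A n) = RQ (Om n A)"
    if "A \<in> Ob C" for A using tower_mapD[OF \<theta>(1)[OF that]] Omega_ses(4)[OF that] by simp_all
  have \<eta>D: "\<eta> A n \<in> Ar C" "Cod C (\<eta> A n) = Cod C (rs A n)" "Dom C (\<eta> A n) = RQ (Om n A)"
    if "A \<in> Ob C" for A using tower_mapD[OF \<eta>(1)[OF that]] Omega_ses(4)[OF that] by simp_all
  \<comment> \<open>The composite tower map and the identity tower map agree at index 0, hence
    stably at every index.\<close>
  have inv1: "\<theta> A n \<cdot> \<eta> A n \<approx> Idt C (RQ (Om n A))" if A: "A \<in> Ob C" for A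
    using tower_map_st[OF Omega_tower[OF A] Omega_tower[OF A] tower_map_cmp[OF Omega_tower[OF A] res_tower(2)[OF A]
      Omega_tower[OF A] \<eta>(1)[OF A] \<theta>(1)[OF A]] tower_map_Idt[OF Omega_tower[OF A]], of 0 n]
      \<theta>(2)[OF A] \<eta>(2)[OF A] Omega_ses(4)[OF A] replacements(10)[OF A] st_refl by (simp add: Omega_ob_0)
  have inv2: "\<eta> A n \<cdot> \<theta> A n \<approx> Idt C (Cod C (rs A n))" if A: "A \<in> Ob C" for A
    using tower_map_st[OF res_tower(2)[OF A] res_tower(2)[OF A] tower_map_cmp[OF res_tower(2)[OF A] Omega_tower[OF A]
      res_tower(2)[OF A] \<theta>(1)[OF A] \<eta>(1)[OF A]] tower_map_Idt[OF res_tower(2)[OF A]], of 0 n]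
      \<theta>(2)[OF A] \<eta>(2)[OF A] res_tower(3)[OF A] replacements(10)[OF A] st_refl by simp
  \<comment> \<open>A relation is used because \<open>\<theta> A n\<close> is invertible only
    stably: the partner of a cocycle \<open>g \<cdot> rs A n\<close> is
    \<open>g \<cdot> \<eta> A n\<close>, whose composite with \<open>\<theta> A n\<close> is
    \<open>g\<close> up to \<open>\<approx>\<close>.\<close>
  define S where "S A B = {(f, g \<cdot> rs A n) | f g. f \<in> RQ_Hom (Om n A) B \<and>
    g \<in> Hom C (Cod C (rs A n)) (RQ B) \<and> g \<approx> f \<cdot> \<theta> A n}" for A B
  have SE: "\<exists>g. x = g \<cdot> rs A n \<and> f \<in> RQ_Hom (Om n A) B \<and>
    g \<in> Hom C (Cod C (rs A n)) (RQ B) \<and> g \<approx> f \<cdot> \<theta> A n" if "(f, x) \<in> S A B" for f x A B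
    using that unfolding S_def by blast
  have SI: "(f, g \<cdot> rs A n) \<in> S A B" if "f \<in> RQ_Hom (Om n A) B"
    "g \<in> Hom C (Cod C (rs A n)) (RQ B)" "g \<approx> f \<cdot> \<theta> A n" for f g A B
    using that unfolding S_def by blast
  show ?thesis
  proof (rule natural_isoI[where S = S and ?G1.0 = "\<lambda>A B. RQ_group (Om n A) B"
        and ?H1.0 = "\<lambda>A B. core_maps (Om n A) B"
        and ?G2.0 = "\<lambda>A B. cocyc A B n"
        and ?H2.0 = "\<lambda>A B. cobd A B n"])
    fix A B assume ob: "A \<in> Ob C" "B \<in> Ob C"
    note rep = replacements[OF Omega_ob_Ob[OF ob(1), of n]] replacements[OF ob(2)]
    note R = res_tower[OF ob(1)]
    note [simp] = R(4,5) \<theta>D[OF ob(1)] \<eta>D[OF ob(1)]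
    show "comm_group (RQ_group (Om n A) B) \<and> comm_group (cocyc A B n) \<and>
      subgroup (core_maps (Om n A) B) (RQ_group (Om n A) B) \<and>
      subgroup (cobd A B n) (cocyc A B n)"
      using Hom_comm_group[OF rep(10,20)] factors_subgroup[OF rep(8,19)] cocycle_group(1,2)[OF R(1) rep(19)] by blast
    show "\<exists>x. (f, x) \<in> S A B" if "f \<in> carrier (RQ_group (Om n A) B)" for f
      using SI[of f A B "f \<cdot> \<theta> A n"] that st_refl by (auto simp: Hom_iff)
    show "\<exists>f. (f, x) \<in> S A B" if x: "x \<in> carrier (cocyc A B n)" for x
    proof -
      obtain g where g: "g \<in> Hom C (Cod C (rs A n)) (RQ B)" "x = g \<cdot> rs A n"
        using x cocycles_eq[OF R(1) rep(20)] by auto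
      have gs [simp]: "g \<in> Ar C" "Dom C g = Cod C (rs A n)" using g by (auto simp: Hom_iff)
      have "g \<cdot> Idt C (Cod C (rs A n)) \<approx> g \<cdot> (\<eta> A n \<cdot> \<theta> A n)"
        by (rule st_cmp[OF st_sym[OF inv2[OF ob(1)]] st_refl]) simp_all
      then have "g \<approx> (g \<cdot> \<eta> A n) \<cdot> \<theta> A n" by simp
      then have "(g \<cdot> \<eta> A n, x) \<in> S A B" unfolding g(2) by (intro SI) (use g in \<open>simp_all add: Hom_iff\<close>)
      then show ?thesis by blast
    qed
    fix f x assume fx: "(f, x) \<in> S A B"
    then obtain g where g: "x = g \<cdot> rs A n" "f \<in> RQ_Hom (Om n A) B"
      "g \<in> Hom C (Cod C (rs A n)) (RQ B)" "g \<approx> f \<cdot> \<theta> A n" using SE by blast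
    have gs [simp]: "g \<in> Ar C" "Dom C g = Cod C (rs A n)" "Cod C g = RQ B"
      "f \<in> Ar C" "Dom C f = RQ (Om n A)" "Cod C f = RQ B" using g by (auto simp: Hom_iff)
    show "f \<in> carrier (RQ_group (Om n A) B) \<and> x \<in> carrier (cocyc A B n)"
      using g cocycles_eq[OF R(1) rep(20)] by auto
    show "f \<in> core_maps (Om n A) B \<longleftrightarrow> x \<in> cobd A B n"
      unfolding factors_null_iff[OF rep(8,19)] g(1) coboundary_iff[OF R(1) rep(19) g(3)]
    proof safe
      assume "null f"
      then have "null (f \<cdot> \<theta> A n)" by (rule null_cmp_right) simp_all
      then show "null g" using st_null g(4) by blast
    next
      assume "null g"
      then have "null (f \<cdot> \<theta> A n)" using st_null st_sym g(4) by blast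
      then have "null ((f \<cdot> \<theta> A n) \<cdot> \<eta> A n)" by (rule null_cmp_right) simp_all
      then have n: "null (f \<cdot> (\<theta> A n \<cdot> \<eta> A n))" by simp
      have "f \<cdot> Idt C (RQ (Om n A)) \<approx> f \<cdot> (\<theta> A n \<cdot> \<eta> A n)"
        by (rule st_cmp[OF st_sym[OF inv1[OF ob(1)]] st_refl]) simp_all
      then show "null f" using st_null[OF _ n] by simp
    qed (use g in simp)
    fix f' y assume fy: "(f', y) \<in> S A B"
    then obtain g' where g': "y = g' \<cdot> rs A n" "f' \<in> RQ_Hom (Om n A) B"
      "g' \<in> Hom C (Cod C (rs A n)) (RQ B)" "g' \<approx> f' \<cdot> \<theta> A n" using SE by blast
    have gs' [simp]: "g' \<in> Ar C" "Dom C g' = Cod C (rs A n)" "Cod C g' = RQ B"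
      "f' \<in> Ar C" "Dom C f' = RQ (Om n A)" "Cod C f' = RQ B" using g' by (auto simp: Hom_iff)
    have "g \<oplus> g' \<approx> f \<cdot> \<theta> A n \<oplus> f' \<cdot> \<theta> A n" by (rule st_plus[OF g(4) g'(4)]) simp_all
    then have "g \<oplus> g' \<approx> (f \<oplus> f') \<cdot> \<theta> A n" by simp
    then have "(f \<oplus> f', (g \<oplus> g') \<cdot> rs A n) \<in> S A B" by (intro SI) (simp_all add: Hom_iff)
    then show "(f \<otimes>\<^bsub>RQ_group (Om n A) B\<^esub> f', x \<otimes>\<^bsub>cocyc A B n\<^esub> y) \<in> S A B"
      unfolding g(1) g'(1) by simp
  next
    fix A B
    show "Ho C M K (Om n A) B = RQ_group (Om n A) B Mod
      core_maps (Om n A) B" by (simp add: Ho_def stable_Hom_def)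
    show "Ext_Ho C K n A B = cocyc A B n Mod cobd A B n"
      by (simp add: Ext_Ho_def Ext_model_def Hom_cohomology_def)
  next
    fix A A' B B' \<alpha> \<beta> f x
    assume ob: "A \<in> Ob C" "A' \<in> Ob C" "B \<in> Ob C" "B' \<in> Ob C"
      and ab: "\<alpha> \<in> carrier (Ho C M K A' A)" "\<beta> \<in> carrier (Ho C M K B B')" and fx: "(f, x) \<in> S A B"
    obtain a where a: "a \<in> RQ_Hom A' A" "\<alpha> = scl A' A a" by (rule Ho_carrierE[OF ab(1)])
    obtain b where b: "b \<in> RQ_Hom B B'" "\<beta> = scl B B' b" by (rule Ho_carrierE[OF ab(2)])
    obtain g where g: "x = g \<cdot> rs A n" "f \<in> RQ_Hom (Om n A) B"
      "g \<in> Hom C (Cod C (rs A n)) (RQ B)" "g \<approx> f \<cdot> \<theta> A n" using SE[OF fx] by blast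
    have aH: "a \<in> Ar C" "Dom C a = Cod C (os A' 0)" "Cod C a = Cod C (os A 0)"
      "Dom C a = Cod C (rs A' 0)" "Cod C a = Cod C (rs A 0)"
      using a(1) Omega_ses(4)[OF ob(1), of 0] Omega_ses(4)[OF ob(2), of 0] res_tower(3)[OF ob(1)] res_tower(3)[OF ob(2)]
      by (auto simp: Hom_iff Omega_ob_0)
    obtain w where w: "tower_map (oj A') (os A') (oj A) (os A) w" "w 0 = a"
      by (rule tower_map_exists[OF Omega_tower[OF ob(2)] Omega_tower[OF ob(1)] aH(1,2,3)])
    obtain r where r: "tower_map (rj A') (rs A') (rj A) (rs A) r" "r 0 = a"
      by (rule tower_map_exists[OF res_tower(2)[OF ob(2)] res_tower(2)[OF ob(1)] aH(1,4,5)])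
    note wD = tower_mapD[OF w(1), of n, unfolded Omega_ses(4)[OF ob(1)] Omega_ses(4)[OF ob(2)]]
    note rD = tower_mapD[OF r(1), of n]
    note [simp] = wD rD \<theta>D[OF ob(1)] \<theta>D[OF ob(2)]
    have gs [simp]: "g \<in> Ar C" "Dom C g = Cod C (rs A n)" "Cod C g = RQ B"
      "f \<in> Ar C" "Dom C f = RQ (Om n A)" "Cod C f = RQ B" "b \<in> Ar C" "Dom C b = RQ B" "Cod C b = RQ B'"
      using g b by (auto simp: Hom_iff)
    note T = res_tower(2)[OF ob(1)] res_tower(2)[OF ob(2)] Omega_tower[OF ob(1)] Omega_tower[OF ob(2)]
    \<comment> \<open>Both sides are components at \<open>n\<close> of tower maps that equal
      \<open>a\<close> at index 0; this is naturality of the comparison of towers.\<close>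
    have "\<theta> A n \<cdot> r n \<approx> w n \<cdot> \<theta> A' n"
      by (rule tower_map_st[OF T(2,3) tower_map_cmp[OF T(2,1,3) r(1) \<theta>(1)[OF ob(1)]]
            tower_map_cmp[OF T(2,4,3) \<theta>(1)[OF ob(2)] w(1)], of 0])
        (use \<theta>(2)[OF ob(1)] \<theta>(2)[OF ob(2)] r(2) w(2) a(1) st_refl in \<open>simp add: Hom_iff\<close>)
    then have "f \<cdot> (\<theta> A n \<cdot> r n) \<approx> f \<cdot> (w n \<cdot> \<theta> A' n)" by (rule st_cmp[OF _ st_refl]) simp_all
    moreover have "g \<cdot> r n \<approx> (f \<cdot> \<theta> A n) \<cdot> r n" by (rule st_cmp[OF st_refl g(4)]) simp_all
    ultimately have "g \<cdot> r n \<approx> f \<cdot> (w n \<cdot> \<theta> A' n)" using st_trans by simp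
    then have "b \<cdot> (g \<cdot> r n) \<approx> b \<cdot> (f \<cdot> (w n \<cdot> \<theta> A' n))" by (rule st_cmp[OF _ st_refl]) simp_all
    then have rel: "(b \<cdot> (f \<cdot> w n), (b \<cdot> (g \<cdot> r n)) \<cdot> rs A' n) \<in> S A' B'" by (intro SI) (simp_all add: Hom_iff)
    have "Omega_map C M K n A' A \<alpha> = scl (Om n A') (Om n A) (w n)"
      using Omega_map_class[OF ob(1,2) w(1)] w(2) a(2) by simp
    moreover have "Ho_cmp C M K (Om n A') B (scl (Om n A) B f)
        (scl (Om n A') (Om n A) (w n)) =
      scl (Om n A') B (f \<cdot> w n)"
      by (rule Ho_cmp_class[OF Omega_ob_Ob[OF ob(2)] Omega_ob_Ob[OF ob(1)] ob(3)]) (simp_all add: Hom_iff)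
    moreover have "Ho_cmp C M K (Om n A') B' \<beta> (scl (Om n A') B (f \<cdot> w n)) =
      scl (Om n A') B' (b \<cdot> (f \<cdot> w n))"
      unfolding b(2) by (rule Ho_cmp_class[OF Omega_ob_Ob[OF ob(2)] ob(3,4)]) (simp_all add: Hom_iff)
    ultimately have 1: "Ho_Omega_map C M K n A A' B B' \<alpha> \<beta> (scl (Om n A) B f) =
      scl (Om n A') B' (b \<cdot> (f \<cdot> w n))"
      by (simp add: Ho_Omega_map_def)
    have 2: "Ext_Ho_map C K n A A' B B' \<alpha> \<beta> (coh A B n x) = coh A' B' n ((b \<cdot> (g \<cdot> r n)) \<cdot> rs A' n)"
      using Ext_Ho_map_class[OF ob b(1) r(1) g(3)] unfolding r(2) a(2) b(2) g(1) .
    show "\<exists>f' x'. (f', x') \<in> S A' B' \<and>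
        Ho_Omega_map C M K n A A' B B' \<alpha> \<beta> (core_maps (Om n A) B #>\<^bsub>RQ_group (Om n A) B\<^esub> f) =
          core_maps (Om n A') B' #>\<^bsub>RQ_group (Om n A') B'\<^esub> f' \<and>
        Ext_Ho_map C K n A A' B B' \<alpha> \<beta> (cobd A B n #>\<^bsub>cocyc A B n\<^esub> x) =
          cobd A' B' n #>\<^bsub>cocyc A' B' n\<^esub> x'"
      using rel 1 2 unfolding stable_class_def cohomology_class_coset by blast
  qed
qed

lemma Sigma_natural_iso:
  "\<exists>\<psi>. natural_iso C M K (Ext_Ho C K n) (Ext_Ho_map C K n)
     (\<lambda>A B. Ho C M K A (Sg n B)) (Ho_Sigma_map C M K n) \<psi>"
proof -
  \<comment> \<open>Shifted by \<open>- n\<close>, the tower of \<open>B\<close> has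
    \<open>RQ (Sg n B)\<close> at index 0 and \<open>RQ B\<close> at index \<open>n\<close>.\<close>
  let ?j = "\<lambda>B k. oj B (k + (- n))" and ?s = "\<lambda>B k. os B (k + (- n))"
  have T: "tower (?j B) (?s B)" if "B \<in> Ob C" for B by (rule tower_shift[OF Omega_tower[OF that]])
  have s0: "Cod C (?s B 0) = RQ (Sg n B)" and sn: "Cod C (?s B n) = RQ B" if "B \<in> Ob C" for B
    using Omega_ses(4)[OF that] by (simp_all add: Sigma_Omega Omega_ob_0)
  \<comment> \<open>One tower map carries both representatives: component 0 is a morphism into the
    suspension, component \<open>n\<close> gives the cocycle. Tower maps extend from either index,
    and nullity at \<open>n\<close> and at 0 is equivalent.\<close>
  define S where "S A B = {(g n \<cdot> rs A n, g 0) | g. tower_map (rj A) (rs A) (?j B) (?s B) g}" for A B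
  have SE: "\<exists>g. x = g n \<cdot> rs A n \<and> f = g 0 \<and> tower_map (rj A) (rs A) (?j B) (?s B) g" if "(x, f) \<in> S A B" for f x A B
    using that unfolding S_def by blast
  have SI: "(g n \<cdot> rs A n, g 0) \<in> S A B" if "tower_map (rj A) (rs A) (?j B) (?s B) g" for g A B
    using that unfolding S_def by blast
  have gD: "g 0 \<in> RQ_Hom A (Sg n B)" "g n \<in> Hom C (Cod C (rs A n)) (RQ B)"
    if "A \<in> Ob C" "B \<in> Ob C" "tower_map (rj A) (rs A) (?j B) (?s B) g" for g A B
    using tower_mapD[OF that(3)] s0[OF that(2)] sn[OF that(2)] res_tower(3)[OF that(1)] by (simp_all add: Hom_iff)
  have Sob: "Sg n B \<in> Ob C" if "B \<in> Ob C" for B using Omega_ob_Ob[OF that] by (simp add: Sigma_Omega)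
  show ?thesis
  proof (rule natural_isoI[where S = S and ?G2.0 = "\<lambda>A B. RQ_group A (Sg n B)"
        and ?H2.0 = "\<lambda>A B. core_maps A (Sg n B)"
        and ?G1.0 = "\<lambda>A B. cocyc A B n"
        and ?H1.0 = "\<lambda>A B. cobd A B n"])
    fix A B assume ob: "A \<in> Ob C" "B \<in> Ob C"
    note rep = replacements[OF ob(1)] replacements[OF ob(2)] replacements[OF Sob[OF ob(2)]]
    note R = res_tower[OF ob(1)]
    note [simp] = R(4,5)
    show "comm_group (cocyc A B n) \<and> comm_group (RQ_group A (Sg n B)) \<and>
      subgroup (cobd A B n) (cocyc A B n) \<and>
      subgroup (core_maps A (Sg n B)) (RQ_group A (Sg n B))"
      using Hom_comm_group[OF rep(10,30)] factors_subgroup[OF rep(8,29)] cocycle_group(1,2)[OF R(1) rep(19)] by blast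
    show "\<exists>x. (x, f) \<in> S A B" if f: "f \<in> carrier (RQ_group A (Sg n B))" for f
    proof -
      obtain g where "tower_map (rj A) (rs A) (?j B) (?s B) g" "g 0 = f"
        by (rule tower_map_exists[OF R(2) T[OF ob(2)], of f]) (use f R(3) s0[OF ob(2)] in \<open>simp_all add: Hom_iff\<close>)
      then show ?thesis using SI[of A B g] by auto
    qed
    show "\<exists>f. (x, f) \<in> S A B" if x: "x \<in> carrier (cocyc A B n)" for x
    proof -
      obtain h where h: "h \<in> Hom C (Cod C (rs A n)) (RQ B)" "x = h \<cdot> rs A n"
        using x cocycles_eq[OF R(1) rep(20)] by auto
      \<comment> \<open>\<open>tower_map_exists\<close> starts at index 0, so the resolution is
        shifted to put \<open>h\<close> there, and the resulting tower map is shifted back.\<close>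
      obtain g' where g': "tower_map (\<lambda>k. rj A (k + n)) (\<lambda>k. rs A (k + n)) (oj B) (os B) g'" "g' 0 = h"
        by (rule tower_map_exists[OF tower_shift[OF R(2)] Omega_tower[OF ob(2)], of h n])
          (use h(1) Omega_ses(4)[OF ob(2), of 0] in \<open>simp_all add: Hom_iff Omega_ob_0\<close>)
      have "tower_map (rj A) (rs A) (?j B) (?s B) (\<lambda>k. g' (k + (- n)))"
        using tower_map_shift[OF g'(1), of "- n"] by simp
      then show ?thesis using SI[of A B "\<lambda>k. g' (k + (- n))"] g'(2) h(2) by auto
    qed
    fix x f assume xf: "(x, f) \<in> S A B"
    then obtain g where g: "x = g n \<cdot> rs A n" "f = g 0" "tower_map (rj A) (rs A) (?j B) (?s B) g" using SE by blast
    note gH = gD[OF ob g(3)]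
    show "x \<in> carrier (cocyc A B n) \<and> f \<in> carrier (RQ_group A (Sg n B))"
      using g gH cocycles_eq[OF R(1) rep(20)] by auto
    show "x \<in> cobd A B n \<longleftrightarrow> f \<in> core_maps A (Sg n B)"
      unfolding factors_null_iff[OF rep(8,29)] g(1,2) coboundary_iff[OF R(1) rep(19) gH(2)]
      using tower_map_null[OF R(2) T[OF ob(2)] g(3), of n 0] gH(1) by simp
    fix y f' assume yf: "(y, f') \<in> S A B"
    then obtain g' where g': "y = g' n \<cdot> rs A n" "f' = g' 0" "tower_map (rj A) (rs A) (?j B) (?s B) g'" using SE by blast
    note gH' = gD[OF ob g'(3)]
    have "((g n \<oplus> g' n) \<cdot> rs A n, g 0 \<oplus> g' 0) \<in> S A B"
      by (rule SI[OF tower_map_plus[OF R(2) T[OF ob(2)] g(3) g'(3)]])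
    then show "(x \<otimes>\<^bsub>cocyc A B n\<^esub> y, f \<otimes>\<^bsub>RQ_group A (Sg n B)\<^esub> f') \<in> S A B"
      unfolding g(1,2) g'(1,2) using gH gH' by (simp add: Hom_iff)
  next
    fix A B
    show "Ho C M K A (Sg n B) = RQ_group A (Sg n B) Mod
      core_maps A (Sg n B)" by (simp add: Ho_def stable_Hom_def)
    show "Ext_Ho C K n A B = cocyc A B n Mod cobd A B n"
      by (simp add: Ext_Ho_def Ext_model_def Hom_cohomology_def)
  next
    fix A A' B B' \<alpha> \<beta> x f
    assume ob: "A \<in> Ob C" "A' \<in> Ob C" "B \<in> Ob C" "B' \<in> Ob C"
      and ab: "\<alpha> \<in> carrier (Ho C M K A' A)" "\<beta> \<in> carrier (Ho C M K B B')" and xf: "(x, f) \<in> S A B"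
    obtain a where a: "a \<in> RQ_Hom A' A" "\<alpha> = scl A' A a" by (rule Ho_carrierE[OF ab(1)])
    obtain b where b: "b \<in> RQ_Hom B B'" "\<beta> = scl B B' b" by (rule Ho_carrierE[OF ab(2)])
    obtain g where g: "x = g n \<cdot> rs A n" "f = g 0" "tower_map (rj A) (rs A) (?j B) (?s B) g" using SE[OF xf] by blast
    have aH: "a \<in> Ar C" "Dom C a = Cod C (rs A' 0)" "Cod C a = Cod C (rs A 0)"
      using a(1) res_tower(3)[OF ob(1)] res_tower(3)[OF ob(2)] by (auto simp: Hom_iff)
    have bH: "b \<in> Ar C" "Dom C b = Cod C (os B 0)" "Cod C b = Cod C (os B' 0)"
      using b(1) Omega_ses(4)[OF ob(3), of 0] Omega_ses(4)[OF ob(4), of 0] by (auto simp: Hom_iff Omega_ob_0)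
    obtain r where r: "tower_map (rj A') (rs A') (rj A) (rs A) r" "r 0 = a"
      by (rule tower_map_exists[OF res_tower(2)[OF ob(2)] res_tower(2)[OF ob(1)] aH])
    obtain w where w: "tower_map (oj B) (os B) (oj B') (os B') w" "w 0 = b"
      by (rule tower_map_exists[OF Omega_tower[OF ob(3)] Omega_tower[OF ob(4)] bH])
    note T' = res_tower(2)[OF ob(1)] res_tower(2)[OF ob(2)] T[OF ob(3)] T[OF ob(4)]
    \<comment> \<open>Composition with the tower maps over \<open>a\<close> and \<open>b\<close>
      acts at index \<open>n\<close> as on cocycles and at index 0 as in the homotopy category, so
      one composite witnesses naturality on both sides.\<close>
    have tm: "tower_map (rj A') (rs A') (?j B') (?s B') (\<lambda>k. w (k + (- n)) \<cdot> (g k \<cdot> r k))"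
      by (rule tower_map_cmp[OF T'(2,3,4) tower_map_cmp[OF T'(2,1,3) r(1) g(3)] tower_map_shift[OF w(1)]])
    have rel: "((b \<cdot> (g n \<cdot> r n)) \<cdot> rs A' n, w (- n) \<cdot> (g 0 \<cdot> a)) \<in> S A' B'"
      using SI[OF tm] w(2) r(2) by simp
    note gH = gD[OF ob(1,3) g(3)]
    have wH: "w (- n) \<in> RQ_Hom (Sg n B) (Sg n B')"
      using tower_mapD[OF w(1), of "- n"] Omega_ses(4)[OF ob(3)] Omega_ses(4)[OF ob(4)] by (simp add: Sigma_Omega Hom_iff)
    have "Sigma_map C M K n B B' \<beta> = scl (Sg n B) (Sg n B') (w (- n))"
      using Omega_map_class[OF ob(4,3) w(1), of "- n"] w(2) b(2) by (simp add: Sigma_Omega)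
    moreover have "Ho_cmp C M K A' (Sg n B) (scl A (Sg n B) (g 0)) \<alpha> =
      scl A' (Sg n B) (g 0 \<cdot> a)"
      unfolding a(2) by (rule Ho_cmp_class[OF ob(2,1) Sob[OF ob(3)] a(1) gH(1)])
    moreover have "Ho_cmp C M K A' (Sg n B') (scl (Sg n B) (Sg n B') (w (- n)))
        (scl A' (Sg n B) (g 0 \<cdot> a)) =
      scl A' (Sg n B') (w (- n) \<cdot> (g 0 \<cdot> a))"
      by (rule Ho_cmp_class[OF ob(2) Sob[OF ob(3)] Sob[OF ob(4)] cmp_in_Hom[OF a(1) gH(1)] wH])
    ultimately have 1: "Ho_Sigma_map C M K n A A' B B' \<alpha> \<beta> (scl A (Sg n B) f) =
      scl A' (Sg n B') (w (- n) \<cdot> (g 0 \<cdot> a))"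
      by (simp add: Ho_Sigma_map_def g(2))
    have 2: "Ext_Ho_map C K n A A' B B' \<alpha> \<beta> (coh A B n x) = coh A' B' n ((b \<cdot> (g n \<cdot> r n)) \<cdot> rs A' n)"
      using Ext_Ho_map_class[OF ob b(1) r(1) gH(2)] unfolding r(2) a(2) b(2) g(1) .
    show "\<exists>x' f'. (x', f') \<in> S A' B' \<and>
        Ext_Ho_map C K n A A' B B' \<alpha> \<beta> (cobd A B n #>\<^bsub>cocyc A B n\<^esub> x) =
          cobd A' B' n #>\<^bsub>cocyc A' B' n\<^esub> x' \<and>
        Ho_Sigma_map C M K n A A' B B' \<alpha> \<beta> (core_maps A (Sg n B) #>\<^bsub>RQ_group A (Sg n B)\<^esub> f) =
          core_maps A' (Sg n B') #>\<^bsub>RQ_group A' (Sg n B')\<^esub> f'"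
      using rel 1 2 unfolding stable_class_def cohomology_class_coset by blast
  qed
qed

end

theorem corollary6p6:
  fixes C :: "('o, 'm) additive_cat"
    and M :: "'o model_triple"
    and K :: "('o, 'm) model_choice"
    and n :: int
  assumes "abelian_category C"
    and "hereditary_abelian_model C M"
    and "valid_choice C M K"
  shows "(\<exists>\<phi>. natural_iso C M K
            (\<lambda>A B. Ho C M K (Omega_ob C K n A) B) (Ho_Omega_map C M K n)
            (Ext_Ho C K n) (Ext_Ho_map C K n) \<phi>) \<and>
         (\<exists>\<psi>. natural_iso C M K
            (Ext_Ho C K n) (Ext_Ho_map C K n)
            (\<lambda>A B. Ho C M K A (Sigma_ob C K n B)) (Ho_Sigma_map C M K n) \<psi>)"
proof -
  interpret chosen_model C M K
    using assms by (intro chosen_model.intro chosen_model_axioms.intro)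
  show ?thesis using Omega_natural_iso Sigma_natural_iso by blast
qed

end
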